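(* Let $E=B_p$ for some $1<p<\infty$ or $E=S_p$ for some $1\le p<\infty$. Then: (i) The family of non-trivial spatial ideals of $\mathscr{B}(E)$ is non-empty and has no minimal or maximal elements (with respect to inclusion). (ii) Let $\mathscr{I}\subsetneq\mathscr{J}$ be spatial ideals of $\mathscr{B}(E)$. Then there is a family $\{\Gamma_L : L\in\Delta\}$ such that: (1) the index set $\Delta$ has the cardinality of the continuum; (2) for each $L\in\Delta$, $\Gamma_L$ is an uncountable chain (with respect to inclusion) of spatial ideals of $\mathscr{B}(E)$ such that $\mathscr{I}\subsetneq\mathscr{L}\subsetneq\mathscr{J}$ for every $\mathscr{L}\in\Gamma_L$, and $\bigcup\Gamma_L$ is a closed ideal that is not spatial; (3) $\overline{\mathscr{L}+\mathscr{M}}=\mathscr{J}$ whenever $\mathscr{L}\in\Gamma_L$ and $\mathscr{M}\in\Gamma_M$ for distinct $L,M\in\Delta$. (iii) The Banach algebra $\mathscr{B}(E)$ contains at least continuum many maximal ideals. (iv) The ideal $\bigcap\{\mathscr{I} : \mathscr{I}\text{ is a non-trivial spatial ideal of }\mathscr{B}(E)\}$ is not contained in the ideal of strictly singular operators on $E$.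
   Context: Scalars are $\mathbb{K}\in\{\mathbb{R},\mathbb{C}\}$ and $\mathbb{N}=\{1,2,3,\ldots\}$. The Schreier sets are $\mathcal{S}_1=\{F\subset\mathbb{N}\text{ finite} : |F|\le\min F\}$, with the convention $\min\emptyset=0$. Let $c_{00}$ be the space of finitely supported elements of $\mathbb{K}^{\mathbb{N}}$. For $1\le p<\infty$, the $p$-th Schreier space $S_p$ is the completion of $c_{00}$ in the norm $\|x\|_{S_p}=\sup\{(\sum_{n\in F}|x(n)|^p)^{1/p} : F\in\mathcal{S}_1\setminus\{\emptyset\}\}$. For $1<p<\infty$, the $p$-th Baernstein space $B_p$ is the completion of $c_{00}$ in the norm $\|x\|_{B_p}=\sup\{(\sum_{j=1}^m(\sum_{n\in F_j}|x(n)|)^p)^{1/p} : m\in\mathbb{N},\ F_1,\ldots,F_m\in\mathcal{S}_1\setminus\{\emptyset\},\ \max F_j<\min F_{j+1}\text{ for }1\le j<m\}$. The unit vectors $(e_n)_{n\in\mathbb{N}}$ form a normalized, $1$-unconditional basis for $E$ with coordinate functionals $(e_n^* )$. For $M\subseteq\mathbb{N}$, $P_M\in\mathscr{B}(E)$ is the basis projection $P_Mx=\sum_{n\in M}\langle x,e_n^*\rangle e_n$. $\mathscr{B}(E)$ is the Banach algebra of bounded operators on $E$; ideals are two-sided. For $T\in\mathscr{B}(E)$, $\langle T\rangle=\{\sum_{j=1}^kU_jTV_j : k\in\mathbb{N},\ U_j,V_j\in\mathscr{B}(E)\}$ is the algebraic ideal generated by $T$. A closed ideal is called spatial if it has the form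 $\overline{\langle P_M\rangle}$ (norm closure) for some non-empty subset $M$ of $\mathbb{N}$. A spatial ideal $\mathscr{I}$ is non-trivial if $\mathscr{K}(E)\subsetneq\mathscr{I}\subsetneq\mathscr{B}(E)$, where $\mathscr{K}(E)$ is the ideal of compact operators. An operator is strictly singular if its restriction to any infinite-dimensional subspace fails to be an isomorphic embedding. *)

theory Defs
  imports "HOL-Analysis.Analysis" "HOL-Algebra.Ideal" "HOL-Library.Equipollence"
begin

text \<open>
  The scalar field is any type of class \<open>{real_normed_field, euclidean_space}\<close>. By the
  Gelfand--Mazur theorem the real and the complex numbers are, up to isometric isomorphism, the
  only ones. The library has no class of complex Banach spaces, so multiplication by scalars is
  an explicit operation on a real Banach space.
\<close>

locale banach_space_over = vector_space smul
  for smul :: "'k::{real_normed_field,euclidean_space} \<Rightarrow> 'e::banach \<Rightarrow> 'e" +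
  assumes scale_of_real: "smul (of_real r) x = r *\<^sub>R x"
    and norm_scale: "norm (smul a x) = norm a * norm x"


section \<open>The Schreier and Baernstein norms\<close>

text \<open>The positive integers are the set \<open>{1..}\<close>; sequences in \<open>c00\<close> have a dummy entry 0 at index 0.
  The norms below are meant for elements of \<open>c00\<close> only; there the sets under \<open>Sup\<close> are non-empty and
  bounded above by the sum of all \<open>norm (x n)\<close>.\<close>

definition schreier_sets :: "nat set set" where
  "schreier_sets =
     {F. finite F \<and> F \<subseteq> {1..} \<and> card F \<le> (if F = {} then 0 else Min F)}"

definition c00 :: "(nat \<Rightarrow> 'k::zero) set" where
  "c00 = {x. finite {n. x n \<noteq> 0} \<and> x 0 = 0}"

definition schreier_norm :: "real \<Rightarrow> (nat \<Rightarrow> 'k::real_normed_vector) \<Rightarrow> real" where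
  "schreier_norm p x =
     Sup {(\<Sum>n\<in>F. norm (x n) powr p) powr (1 / p) | F. F \<in> schreier_sets - {{}}}"

definition baernstein_norm :: "real \<Rightarrow> (nat \<Rightarrow> 'k::real_normed_vector) \<Rightarrow> real" where
  "baernstein_norm p x =
     Sup {(\<Sum>j=1..m. (\<Sum>n\<in>F j. norm (x n)) powr p) powr (1 / p) | (m::nat) F.
            1 \<le> m \<and> (\<forall>j\<in>{1..m}. F j \<in> schreier_sets - {{}}) \<and>
            (\<forall>j. 1 \<le> j \<and> j < m \<longrightarrow> Max (F j) < Min (F (j + 1)))}"

text \<open>
  \<open>\<iota>\<close> exhibits the Banach space as a completion of \<open>c00\<close> with respect to the norm \<open>N\<close>;
  values of \<open>\<iota>\<close> outside \<open>c00\<close> are irrelevant.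
\<close>

definition is_completion_of_c00 ::
  "('k::{real_normed_field,euclidean_space} \<Rightarrow> 'e::banach \<Rightarrow> 'e) \<Rightarrow>
     ((nat \<Rightarrow> 'k) \<Rightarrow> real) \<Rightarrow> ((nat \<Rightarrow> 'k) \<Rightarrow> 'e) \<Rightarrow> bool" where
  "is_completion_of_c00 smul N \<iota> \<longleftrightarrow>
     banach_space_over smul \<and>
     (\<forall>x\<in>c00. \<forall>y\<in>c00. \<iota> (\<lambda>n. x n + y n) = \<iota> x + \<iota> y) \<and>
     (\<forall>a. \<forall>x\<in>c00. \<iota> (\<lambda>n. a * x n) = smul a (\<iota> x)) \<and>
     (\<forall>x\<in>c00. norm (\<iota> x) = N x) \<and>
     closure (\<iota> ` c00) = UNIV"


section \<open>The unit vector basis and its projections\<close>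

definition unit_vector :: "((nat \<Rightarrow> 'k::zero_neq_one) \<Rightarrow> 'e) \<Rightarrow> nat \<Rightarrow> 'e" where
  "unit_vector \<iota> n = \<iota> (\<lambda>k. if k = n then 1 else 0)"

text \<open>\<open>coords smul \<iota> x n\<close> is the value of the \<open>n\<close>-th coordinate functional at \<open>x\<close>, that is, the
  \<open>n\<close>-th coefficient in the expansion of \<open>x\<close> in the Schauder basis of unit vectors indexed by \<open>{1..}\<close>;
  \<open>c 0 = 0\<close> fixes the dummy entry.\<close>

definition coords ::
  "('k::zero_neq_one \<Rightarrow> 'e::real_normed_vector \<Rightarrow> 'e) \<Rightarrow> ((nat \<Rightarrow> 'k) \<Rightarrow> 'e) \<Rightarrow>
     'e \<Rightarrow> nat \<Rightarrow> 'k" where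
  "coords smul \<iota> x =
     (THE c. c 0 = 0 \<and> (\<lambda>n. smul (c n) (unit_vector \<iota> n)) sums x)"

definition basis_projection ::
  "('k::zero_neq_one \<Rightarrow> 'e::real_normed_vector \<Rightarrow> 'e) \<Rightarrow> ((nat \<Rightarrow> 'k) \<Rightarrow> 'e) \<Rightarrow>
     nat set \<Rightarrow> 'e \<Rightarrow>\<^sub>L 'e" where
  "basis_projection smul \<iota> M =
     Blinfun (\<lambda>x. \<Sum>\<^sub>\<infinity>n\<in>M. smul (coords smul \<iota> x n) (unit_vector \<iota> n))"


section \<open>Operators and ideals\<close>

text \<open>
  \<open>'e \<Rightarrow>\<^sub>L 'e\<close> consists of the bounded real-linear maps; the carrier selects those which are linear
  over the scalar field. Scalar multiples of the identity belong to the carrier, so ideals of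
  this ring are automatically subspaces over the scalar field.
\<close>

definition operator_algebra ::
  "('k \<Rightarrow> 'e::real_normed_vector \<Rightarrow> 'e) \<Rightarrow> ('e \<Rightarrow>\<^sub>L 'e) ring" where
  "operator_algebra smul =
     \<lparr>carrier = {T. \<forall>a x. blinfun_apply T (smul a x) = smul a (blinfun_apply T x)},
      mult = (o\<^sub>L), one = id_blinfun, zero = 0, add = (+)\<rparr>"

lemma ring_operator_algebra:
  assumes "banach_space_over smul"
  shows "ring (operator_algebra smul)"
proof -
  interpret banach_space_over smul by fact
  show ?thesis
  proof (rule ringI)
    show "abelian_group (operator_algebra smul)"
    proof (rule abelian_groupI)
      fix S assume S: "S \<in> carrier (operator_algebra smul)"
      show "\<exists>T\<in>carrier (operator_algebra smul).
              T \<oplus>\<^bsub>operator_algebra smul\<^esub> S = \<zero>\<^bsub>operator_algebra smul\<^esub>"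
        by (rule bexI[of _ "- S"])
          (use S in \<open>auto simp: operator_algebra_def blinfun.minus_left scale_minus_right\<close>)
    qed (auto simp: operator_algebra_def blinfun.add_left blinfun.zero_left
        scale_right_distrib add.assoc add.commute)
    show "monoid (operator_algebra smul)"
      by (rule monoidI) (auto simp: operator_algebra_def blinfun_eqI)
  qed (auto simp: operator_algebra_def
      blinfun.add_left blinfun.add_right intro!: blinfun_eqI)
qed

definition compact_operators ::
  "('k \<Rightarrow> 'e::real_normed_vector \<Rightarrow> 'e) \<Rightarrow> ('e \<Rightarrow>\<^sub>L 'e) set" where
  "compact_operators smul =
     {T \<in> carrier (operator_algebra smul). compact (closure (blinfun_apply T ` cball 0 1))}"

definition strictly_singular_operators ::
  "('k::field \<Rightarrow> 'e::real_normed_vector \<Rightarrow> 'e) \<Rightarrow> ('e \<Rightarrow>\<^sub>L 'e) set" where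
  "strictly_singular_operators smul =
     {T \<in> carrier (operator_algebra smul).
        \<forall>W. module.subspace smul W \<and> \<not> (\<exists>B. finite B \<and> module.span smul B = W) \<longrightarrow>
          \<not> (\<exists>c>0. \<forall>x\<in>W. c * norm x \<le> norm (blinfun_apply T x))}"

definition generated_ideal ::
  "('k \<Rightarrow> 'e::real_normed_vector \<Rightarrow> 'e) \<Rightarrow> ('e \<Rightarrow>\<^sub>L 'e) \<Rightarrow> ('e \<Rightarrow>\<^sub>L 'e) set" where
  "generated_ideal smul T =
     {(\<Sum>j=1..k. U j o\<^sub>L T o\<^sub>L V j) | (k::nat) U V.
        1 \<le> k \<and> (\<forall>j\<in>{1..k}. U j \<in> carrier (operator_algebra smul) \<and>
                                V j \<in> carrier (operator_algebra smul))}"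

definition spatial_ideals ::
  "('k::zero_neq_one \<Rightarrow> 'e::real_normed_vector \<Rightarrow> 'e) \<Rightarrow> ((nat \<Rightarrow> 'k) \<Rightarrow> 'e) \<Rightarrow>
     ('e \<Rightarrow>\<^sub>L 'e) set set" where
  "spatial_ideals smul \<iota> =
     {closure (generated_ideal smul (basis_projection smul \<iota> M)) | M. M \<noteq> {} \<and> M \<subseteq> {1..}}"

definition nontrivial_spatial_ideals ::
  "('k::zero_neq_one \<Rightarrow> 'e::real_normed_vector \<Rightarrow> 'e) \<Rightarrow> ((nat \<Rightarrow> 'k) \<Rightarrow> 'e) \<Rightarrow>
     ('e \<Rightarrow>\<^sub>L 'e) set set" where
  "nontrivial_spatial_ideals smul \<iota> =
     {I \<in> spatial_ideals smul \<iota>.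
        compact_operators smul \<subset> I \<and> I \<subset> carrier (operator_algebra smul)}"

end

theory Submission
  imports Defs
begin

text \<open>
  Write \<open>P M\<close> for the basis projection of a set \<open>M\<close> and \<open>I M\<close> for the closed ideal that it generates. Everything
  rests on deciding, by the combinatorics of Schreier sets alone, when \<open>I N\<close> is contained in \<open>I M\<close>.

  The relevant notion is a stack: successive sets \<open>G 0 < G 1 < \<dots>\<close>, each with as many elements as its
  minimum. The normalised averages over the sets of a stack spread out so quickly that they
  behave like the basis of \<open>c\<^sub>0\<close> (Schreier spaces) or of \<open>\<ell>\<^sub>p\<close> (Baernstein spaces), see
  \<open>block_sum\<close>. In particular the sum of \<open>t\<close> of them has norm of smaller order than its norm
  in \<open>\<ell>\<^sub>1\<close> (or \<open>\<ell>\<^sub>p\<close> in the Schreier case), although a vector supported by one Schreier set has the latter norm.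
  Say that \<open>N\<close> has a gap over \<open>M\<close> if \<open>N\<close> contains, arbitrarily far out, arbitrarily high stacks with union \<open>W\<close>
  such that \<open>M\<close> has at most about \<open>Min W\<close> elements below \<open>card W\<close>.

  If \<open>N\<close> has no gap over its subset \<open>M\<close>, the order isomorphism from \<open>N\<close> onto \<open>M\<close> and its inverse
  induce bounded operators far out, so up to finite rank \<open>P N\<close> factors through \<open>P M\<close> (\<open>no_gap_imp_proj_in_spatial\<close>). Conversely, let \<open>P N\<close> be
  close to a sum of \<open>k\<close> products \<open>U P M V\<close>. Then for each \<open>n\<close> in \<open>N\<close> some product has an \<open>n\<close>-th diagonal coefficient
  of modulus at least \<open>1/(2k)\<close>. Vectors with small coordinates are of the type of \<open>c\<^sub>0\<close> or \<open>\<ell>\<^sub>p\<close> and cannot be mapped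
  back to the basis (\<open>small_coordinates_not_mapped_to_basis\<close>), so this coefficient is due to a single index \<open>m\<close> of
  \<open>M\<close>. On the stack of a gap, few \<open>n\<close> use an \<open>m\<close> below \<open>card W\<close>, and the remaining \<open>m\<close> form a Schreier
  set, which makes the norm of the vector of the stack too large (\<open>gap_imp_proj_notin_spatial\<close>).

  Now let \<open>I M\<close> be strictly contained in \<open>I N\<close>; one may assume that \<open>M\<close> is a subset of \<open>N\<close>. Divide the
  natural numbers into intervals so long that each one contains a stack witnessing the gap, and let \<open>L S\<close>
  arise from \<open>M\<close> by adding the part of \<open>N\<close> in the intervals with index in \<open>S\<close>. Then \<open>I (L S)\<close> is contained in \<open>I (L S')\<close> if
  and only if \<open>S - S'\<close> is finite (\<open>spatial_interpolation\<close>): between two spatial ideals there is a copy of the subsets of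
  the natural numbers modulo finite sets. An almost disjoint family of size continuum, maximal chains and
  pseudo-intersections give the chains of ideals (\<open>spatial_chains\<close>). Two of these ideals that belong to different members of
  the family add up to the larger ideal; for the whole algebra this separates continuum many maximal ideals.

  Finally, the copies of \<open>c\<^sub>0\<close> or \<open>\<ell>\<^sub>p\<close> spanned by the averages over different stacks are
  complemented and isomorphic to each other in the obvious way. A projection onto one of them therefore factors
  through every \<open>P N\<close> with \<open>N\<close> infinite, but it is not strictly singular (\<open>nonstrictly_singular_in_all_spatial\<close>).
\<close>


section \<open>Inequalities for powers and signs\<close>

lemma powr_above_tangent:
  fixes y t s :: real
  assumes "0 \<le> y" "0 < t" "1 \<le> s"
  shows "t powr s + s * t powr (s - 1) * (y - t) \<le> y powr s"
proof (cases "y = 0")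
  case True
  have "t powr s = t powr (s - 1) * t"
    using assms powr_add[of t "s - 1" 1] by simp
  then show ?thesis
    using True assms by (simp add: algebra_simps mult_right_mono)
next
  case False
  have "s * t powr (s - 1) * (y - t) \<le> y powr s - t powr s"
    by (rule convex_on_imp_above_tangent[OF powr_convex[OF assms(3)]])
      (use assms False in \<open>auto intro!: derivative_eq_intros
        simp: powr_diff at_within_open[of _ "{0<..}"] interior_open\<close>)
  then show ?thesis by simp
qed

text \<open>
  Jensen's inequality for weights whose sum may be less than one: sum the tangent inequality at the
  weighted sum \<open>t\<close>. What the weights lack to one only helps, since \<open>s \<ge> 1\<close>.
\<close>

lemma powr_weighted_sum_le:
  fixes w y :: "'a \<Rightarrow> real"
  assumes "finite A" and w: "\<And>i. i \<in> A \<Longrightarrow> 0 \<le> w i" "sum w A \<le> 1"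
    and y: "\<And>i. i \<in> A \<Longrightarrow> 0 \<le> y i" and s: "1 \<le> s"
  shows "(\<Sum>i\<in>A. w i * y i) powr s \<le> (\<Sum>i\<in>A. w i * y i powr s)"
proof -
  define t where "t = (\<Sum>i\<in>A. w i * y i)"
  have t0: "0 \<le> t" unfolding t_def by (intro sum_nonneg mult_nonneg_nonneg w y)
  show ?thesis
  proof (cases "t = 0")
    case True
    then show ?thesis unfolding t_def[symmetric] by (simp add: sum_nonneg w)
  next
    case False
    then have t: "0 < t" using t0 by simp
    have ts: "t powr s = t powr (s - 1) * t"
      using t powr_add[of t "s - 1" 1] by simp
    have "(\<Sum>i\<in>A. w i * (t powr s + s * t powr (s - 1) * (y i - t))) \<le> (\<Sum>i\<in>A. w i * y i powr s)"
      by (intro sum_mono mult_left_mono powr_above_tangent w y t s)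
    also have "(\<Sum>i\<in>A. w i * (t powr s + s * t powr (s - 1) * (y i - t)))
      = t powr s * sum w A + s * t powr (s - 1) * (t - t * sum w A)"
    proof -
      have "w i * (t powr s + s * t powr (s - 1) * (y i - t))
          = t powr s * w i + s * t powr (s - 1) * (w i * y i) - s * t powr (s - 1) * t * w i" for i
        by (simp add: algebra_simps)
      then show ?thesis
        by (simp add: sum.distrib sum_subtractf sum_distrib_left[symmetric] t_def[symmetric])
          (simp add: algebra_simps)
    qed
    also have "\<dots> = t powr s + t powr s * ((s - 1) * (1 - sum w A))"
      unfolding ts by (simp add: algebra_simps)
    finally have "t powr s + t powr s * ((s - 1) * (1 - sum w A)) \<le> (\<Sum>i\<in>A. w i * y i powr s)" .
    moreover have "0 \<le> t powr s * ((s - 1) * (1 - sum w A))"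
      using s w by simp
    ultimately show ?thesis unfolding t_def by linarith
  qed
qed

lemma powr_add_le:
  fixes x y s :: real
  assumes "0 \<le> x" "0 \<le> y" "1 \<le> s"
  shows "(x + y) powr s \<le> 2 powr s * (x powr s + y powr s)"
proof -
  have "(x + y) powr s \<le> (2 * max x y) powr s"
    using assms by (intro powr_mono2) auto
  also have "\<dots> = 2 powr s * max x y powr s"
    using assms by (simp add: powr_mult)
  also have "\<dots> \<le> 2 powr s * (x powr s + y powr s)"
    by (intro mult_left_mono) (auto simp: max_def)
  finally show ?thesis .
qed

lemma powr_sum_le:
  fixes y :: "'a \<Rightarrow> real"
  assumes "finite A" "\<And>i. i \<in> A \<Longrightarrow> 0 \<le> y i" "1 \<le> s"
  shows "(\<Sum>i\<in>A. y i) powr s \<le> real (card A) powr s * (\<Sum>i\<in>A. y i powr s)"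
proof (cases "A = {}")
  case False
  then obtain m where m: "m \<in> A" "\<And>i. i \<in> A \<Longrightarrow> y i \<le> y m"
    using Max_in[of "y ` A"] Max_ge[of "y ` A"] assms(1) by fastforce
  have "(\<Sum>i\<in>A. y i) \<le> real (card A) * y m"
    using sum_bounded_above[of A y "y m"] m by simp
  then have "(\<Sum>i\<in>A. y i) powr s \<le> (real (card A) * y m) powr s"
    using assms by (intro powr_mono2) (auto intro: sum_nonneg)
  also have "\<dots> = real (card A) powr s * y m powr s"
    using assms m by (simp add: powr_mult)
  also have "\<dots> \<le> real (card A) powr s * (\<Sum>i\<in>A. y i powr s)"
    using assms m by (intro mult_left_mono member_le_sum) auto
  finally show ?thesis .
qed simp

text \<open>
  Averaging over all choices of signs: each row keeps on average at least the modulus of any of its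
  entries, because reversing the sign of that entry alone produces two sums whose moduli add up to
  at least twice the modulus of the entry. Hence some choice of signs is good for all rows at once.
\<close>

lemma exists_signs:
  fixes t :: "'i \<Rightarrow> 'j \<Rightarrow> 'k::real_normed_vector"
  assumes A: "finite A" and B: "finite B" and \<rho>: "\<And>i. i \<in> A \<Longrightarrow> \<rho> i \<in> B" and r: "1 \<le> r"
  shows "\<exists>\<epsilon> :: 'j \<Rightarrow> real. (\<forall>j. \<bar>\<epsilon> j\<bar> = 1) \<and>
    (\<Sum>i\<in>A. norm (t i (\<rho> i)) powr r) \<le> (\<Sum>i\<in>A. norm (\<Sum>j\<in>B. \<epsilon> j *\<^sub>R t i j) powr r)"
proof -
  define e :: "'j set \<Rightarrow> 'j \<Rightarrow> real" where "e S j = (if j \<in> S then -1 else 1)" for S j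
  define g where "g S i = norm (\<Sum>j\<in>B. e S j *\<^sub>R t i j) powr r" for S i
  define flip where "flip i S = (if \<rho> i \<in> S then S - {\<rho> i} else insert (\<rho> i) S)" for i S
  have pair: "2 * norm (t i (\<rho> i)) powr r \<le> g S i + g (flip i S) i" if i: "i \<in> A" and S: "S \<in> Pow B" for i S
  proof -
    let ?a = "\<Sum>j\<in>B. e S j *\<^sub>R t i j" and ?b = "\<Sum>j\<in>B. e (flip i S) j *\<^sub>R t i j"
    have "?a - ?b = (\<Sum>j\<in>B. if j = \<rho> i then (2 * e S (\<rho> i)) *\<^sub>R t i (\<rho> i) else 0)"
      unfolding sum_subtractf[symmetric]
    proof (rule sum.cong[OF refl])
      fix j assume "j \<in> B"
      show "e S j *\<^sub>R t i j - e (flip i S) j *\<^sub>R t i j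
          = (if j = \<rho> i then (2 * e S (\<rho> i)) *\<^sub>R t i (\<rho> i) else 0)"
      proof (cases "j = \<rho> i")
        case True
        have "e (flip i S) (\<rho> i) = - e S (\<rho> i)" unfolding e_def flip_def by simp
        then have "e S (\<rho> i) - e (flip i S) (\<rho> i) = 2 * e S (\<rho> i)" by simp
        then show ?thesis
          unfolding True scaleR_diff_left[symmetric] by simp
      next
        case False
        then have "e (flip i S) j = e S j" unfolding e_def flip_def by simp
        then show ?thesis using False by simp
      qed
    qed
    also have "\<dots> = (2 * e S (\<rho> i)) *\<^sub>R t i (\<rho> i)"
      using B \<rho>[OF i] by simp
    finally have "norm (?a - ?b) = 2 * norm (t i (\<rho> i))"
      by (simp add: e_def)
    then have "norm (t i (\<rho> i)) \<le> (1/2) * norm ?a + (1/2) * norm ?b"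
      using norm_triangle_ineq4[of ?a ?b] by simp
    then have "norm (t i (\<rho> i)) powr r \<le> ((1/2) * norm ?a + (1/2) * norm ?b) powr r"
      using r by (intro powr_mono2) auto
    also have "\<dots> \<le> (1/2) * norm ?a powr r + (1/2) * norm ?b powr r"
      using powr_weighted_sum_le[of "UNIV :: bool set" "\<lambda>_. 1/2" "\<lambda>b. if b then norm ?a else norm ?b" r] r
      by (simp add: UNIV_bool algebra_simps)
    finally show ?thesis unfolding g_def by simp
  qed
  have "(\<Sum>S\<in>Pow B. \<Sum>i\<in>A. norm (t i (\<rho> i)) powr r) \<le> (\<Sum>S\<in>Pow B. \<Sum>i\<in>A. g S i)"
    unfolding sum.swap[of _ A]
  proof (rule sum_mono)
    fix i assume i: "i \<in> A"
    have "(\<Sum>S\<in>Pow B. g (flip i S) i) = (\<Sum>S\<in>Pow B. g S i)"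
      by (rule sum.reindex_bij_witness[where i = "flip i" and j = "flip i"])
        (use \<rho>[OF i] in \<open>auto simp: flip_def insert_absorb split: if_splits\<close>)
    then have "2 * (\<Sum>S\<in>Pow B. g S i) = (\<Sum>S\<in>Pow B. g S i + g (flip i S) i)"
      by (simp add: sum.distrib)
    also have "\<dots> \<ge> (\<Sum>S\<in>Pow B. 2 * norm (t i (\<rho> i)) powr r)"
      by (intro sum_mono pair i)
    finally show "(\<Sum>S\<in>Pow B. norm (t i (\<rho> i)) powr r) \<le> (\<Sum>S\<in>Pow B. g S i)"
      by simp
  qed
  then obtain S where S: "S \<in> Pow B" "(\<Sum>i\<in>A. norm (t i (\<rho> i)) powr r) \<le> (\<Sum>i\<in>A. g S i)"
  proof -
    have False if "\<forall>S\<in>Pow B. (\<Sum>i\<in>A. g S i) < (\<Sum>i\<in>A. norm (t i (\<rho> i)) powr r)"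
      using sum_strict_mono[of "Pow B" "\<lambda>S. \<Sum>i\<in>A. g S i" "\<lambda>_. \<Sum>i\<in>A. norm (t i (\<rho> i)) powr r"]
        that B \<open>sum _ (Pow B) \<le> sum _ (Pow B)\<close> by (auto simp: Pow_not_empty)
    then show thesis using that by (meson not_le)
  qed
  then show ?thesis
    by (intro exI[of _ "e S"]) (auto simp: g_def e_def)
qed


section \<open>Schreier sets, coverings and stacks\<close>

lemma schreier_sets_iff:
  "F \<in> schreier_sets \<longleftrightarrow> finite F \<and> F \<subseteq> {1..} \<and> (\<forall>a\<in>F. card F \<le> a)"
proof (cases "F = {}")
  case False
  then have "finite F \<Longrightarrow> card F \<le> Min F \<longleftrightarrow> (\<forall>a\<in>F. card F \<le> a)"
    by simp
  then show ?thesis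
    using False unfolding schreier_sets_def by (simp cong: conj_cong)
qed (simp add: schreier_sets_def)

lemma schreier_sets_subset: "F \<in> schreier_sets \<Longrightarrow> G \<subseteq> F \<Longrightarrow> G \<in> schreier_sets"
  unfolding schreier_sets_iff by (meson card_mono finite_subset order_trans subset_iff)

lemma singleton_schreier: "1 \<le> n \<Longrightarrow> {n} \<in> schreier_sets"
  by (simp add: schreier_sets_iff)

lemma empty_schreier: "{} \<in> schreier_sets"
  by (simp add: schreier_sets_iff)

lemma exists_initial_segment:
  fixes F :: "nat set"
  assumes "finite F" "k \<le> card F"
  shows "\<exists>A\<subseteq>F. card A = k \<and> (\<forall>a\<in>A. \<forall>b\<in>F - A. a < b)"
  using assms(2)
proof (induction k)
  case 0
  then show ?case by (intro exI[of _ "{}"]) auto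
next
  case (Suc k)
  then obtain A where A: "A \<subseteq> F" "card A = k" "\<forall>a\<in>A. \<forall>b\<in>F - A. a < b" by auto
  have "F - A \<noteq> {}"
    using A Suc.prems assms(1) by (metis Diff_eq_empty_iff card_mono finite_subset not_less_eq_eq)
  then have m: "Min (F - A) \<in> F - A" "\<forall>b\<in>F - A. Min (F - A) \<le> b"
    using assms(1) by (auto intro!: Min_in simp del: Diff_iff)
  have "card (insert (Min (F - A)) A) = Suc k"
    using m A assms(1) by (subst card_insert_disjoint) (auto intro: finite_subset)
  then show ?case
    using m A by (intro exI[of _ "insert (Min (F - A)) A"]) (auto simp: nat_less_le)
qed

text \<open>
  The larger half of a set with \<open>h\<close> elements lies above \<open>h div 2\<close> positive integers and has at most \<open>h div 2 + 1\<close> elements.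
\<close>

lemma exists_schreier_half:
  assumes "finite H" "H \<subseteq> {1..}"
  shows "\<exists>F\<subseteq>H. F \<in> schreier_sets \<and> card H \<le> 2 * card F"
proof -
  obtain A where A: "A \<subseteq> H" "card A = card H div 2" "\<forall>a\<in>A. \<forall>b\<in>H - A. a < b"
    using exists_initial_segment[OF assms(1), of "card H div 2"] by auto
  have c: "card (H - A) = card H - card H div 2"
    using A assms by (simp add: card_Diff_subset finite_subset)
  have "card (H - A) \<le> b" if "b \<in> H - A" for b
  proof -
    have "A \<subseteq> {1..<b}" using A that assms by force
    then have "card A \<le> b - 1" using card_mono[of "{1..<b}" A] by simp
    moreover have "1 \<le> b" using that assms by auto
    ultimately show ?thesis using c A by linarith
  qed
  then show ?thesis
    using c assms by (intro exI[of _ "H - A"]) (auto simp: schreier_sets_iff)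
qed

definition covered :: "nat \<Rightarrow> nat set \<Rightarrow> bool" where
  "covered t F \<longleftrightarrow> (\<exists>H. F = (\<Union>i<t. H i) \<and> (\<forall>i<t. H i \<in> schreier_sets))"

text \<open>
  A succession of maximal Schreier sets: that the size equals the minimum is expressed by saying that it is an
  element and a lower bound.
\<close>

definition stack :: "nat \<Rightarrow> (nat \<Rightarrow> nat set) \<Rightarrow> bool" where
  "stack t G \<longleftrightarrow>
     (\<forall>i<t. finite (G i) \<and> 0 < card (G i) \<and> card (G i) \<in> G i \<and> (\<forall>a\<in>G i. card (G i) \<le> a)) \<and>
     (\<forall>i. Suc i < t \<longrightarrow> (\<forall>a\<in>G i. \<forall>b\<in>G (Suc i). a < b))"

lemma stack_mono: "stack t G \<Longrightarrow> u \<le> t \<Longrightarrow> stack u G"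
  unfolding stack_def by (meson less_le_trans)

lemma stackD:
  assumes "stack t G" "i < t"
  shows "finite (G i)" "0 < card (G i)" "card (G i) \<in> G i" "\<And>a. a \<in> G i \<Longrightarrow> card (G i) \<le> a"
    "G i \<noteq> {}" "G i \<in> schreier_sets"
proof -
  have *: "finite (G i)" "0 < card (G i)" "card (G i) \<in> G i" "\<forall>a\<in>G i. card (G i) \<le> a"
    using assms unfolding stack_def by blast+
  show "finite (G i)" "0 < card (G i)" "card (G i) \<in> G i" "\<And>a. a \<in> G i \<Longrightarrow> card (G i) \<le> a"
    using * by auto
  show "G i \<noteq> {}" using * by auto
  have "1 \<le> a" if "a \<in> G i" for a
    using *(2) *(4)[rule_format, OF that] by linarith
  then show "G i \<in> schreier_sets"
    unfolding schreier_sets_iff using * by auto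
qed

lemma stack_less:
  assumes "stack t G" "i < j" "j < t" "a \<in> G i" "b \<in> G j"
  shows "a < b"
  using assms(2,3,5)
proof (induction j arbitrary: b)
  case (Suc j)
  have step: "\<forall>a\<in>G j. \<forall>b\<in>G (Suc j). a < b"
    using assms(1) Suc.prems unfolding stack_def by auto
  show ?case
  proof (cases "i = j")
    case True
    then show ?thesis using step Suc.prems assms(4) by auto
  next
    case False
    have c: "card (G j) \<in> G j" using stackD(3)[OF assms(1)] Suc.prems by auto
    have "a < card (G j)" using Suc False c by auto
    then show ?thesis using step c Suc.prems by (meson less_trans)
  qed
qed simp

lemma stack_disjoint:
  assumes "stack t G" "i < t" "j < t" "i \<noteq> j"
  shows "G i \<inter> G j = {}"
  using stack_less[OF assms(1)] assms(2-4) by (metis disjoint_iff less_irrefl nat_neq_iff)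

text \<open>
  A set that starts at its size \<open>c\<close> ends no earlier than \<open>2 * c - 1\<close>, so the sizes of the sets of a stack at least double from one
  to the next.
\<close>

lemma stack_growth:
  assumes "stack t G" "i < j" "j < t" "a \<in> G i"
  shows "a * 2 ^ (j - i) \<le> 2 * card (G j)"
  using assms(2,3)
proof (induction j)
  case (Suc j)
  have c: "card (G (Suc j)) \<in> G (Suc j)" using stackD(3)[OF assms(1)] Suc.prems by auto
  show ?case
  proof (cases "i = j")
    case True
    then show ?thesis using stack_less[OF assms(1) _ _ assms(4) c] Suc.prems by auto
  next
    case False
    then have IH: "a * 2 ^ (j - i) \<le> 2 * card (G j)" using Suc by auto
    have "G j \<subseteq> {card (G j)..<card (G (Suc j))}"
      using stackD(4)[OF assms(1), of j] stack_less[OF assms(1) _ _ _ c, of j] Suc.prems by auto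
    then have "card (G j) \<le> card (G (Suc j)) - card (G j)"
      using card_mono[of "{card (G j)..<card (G (Suc j))}" "G j"] by simp
    moreover have "0 < card (G j)" using stackD(2)[OF assms(1), of j] Suc.prems by simp
    ultimately have "2 * card (G j) \<le> card (G (Suc j))" by linarith
    then show ?thesis
      using IH False Suc.prems by (simp add: Suc_diff_le)
  qed
qed simp

text \<open>
  The greedy algorithm: remove the first \<open>Min F\<close> elements of \<open>F\<close> as long as there are that many. Either it
  runs for \<open>t\<close> steps and produces a stack, or it stops early with a covering.
\<close>

lemma covered_or_stack:
  assumes "finite F" "F \<subseteq> {1..}"
  shows "covered t F \<or> (\<exists>G. stack t G \<and> (\<forall>i<t. G i \<subseteq> F))"
  using assms
proof (induction t arbitrary: F)
  case 0
  then show ?case by (auto simp: stack_def)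
next
  case (Suc t)
  show ?case
  proof (cases "F \<in> schreier_sets")
    case True
    then have "covered (Suc t) F"
      unfolding covered_def by (intro exI[of _ "\<lambda>_. F"]) auto
    then show ?thesis ..
  next
    case False
    then have ne: "F \<noteq> {}"
      using empty_schreier by auto
    then have m: "Min F \<in> F" "\<And>a. a \<in> F \<Longrightarrow> Min F \<le> a" using Suc.prems by auto
    obtain a where "a \<in> F" "a < card F"
      using False Suc.prems unfolding schreier_sets_iff by (meson not_le)
    then have big: "Min F < card F" using m(2)[of a] by simp
    obtain A where A: "A \<subseteq> F" "card A = Min F" "\<forall>a\<in>A. \<forall>b\<in>F - A. a < b"
      using exists_initial_segment[of F "Min F"] big Suc.prems by auto
    have "A \<noteq> {}" using A m Suc.prems by force
    then have mA: "Min F \<in> A" using A m by (metis DiffI all_not_in_conv not_less subset_iff)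
    have finA: "finite A" using A Suc.prems by (auto intro: finite_subset)
    have AS: "A \<in> schreier_sets"
      using A m Suc.prems finA by (auto simp: schreier_sets_iff)
    have "covered t (F - A) \<or> (\<exists>G. stack t G \<and> (\<forall>i<t. G i \<subseteq> F - A))"
      using Suc.IH[of "F - A"] Suc.prems by auto
    then show ?thesis
    proof
      assume "covered t (F - A)"
      then obtain H where H: "F - A = (\<Union>i<t. H i)" "\<forall>i<t. H i \<in> schreier_sets"
        unfolding covered_def by auto
      have "covered (Suc t) F"
        unfolding covered_def
      proof (intro exI[of _ "H(t := A)"] conjI)
        have "(\<Union>i<Suc t. (H(t := A)) i) = (\<Union>i<t. H i) \<union> A"
          by (auto simp: less_Suc_eq)
        then show "F = (\<Union>i<Suc t. (H(t := A)) i)" using H A by auto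
      qed (use H AS in \<open>auto simp: less_Suc_eq\<close>)
      then show ?thesis ..
    next
      assume "\<exists>G. stack t G \<and> (\<forall>i<t. G i \<subseteq> F - A)"
      then obtain G where G: "stack t G" "\<forall>i<t. G i \<subseteq> F - A" by auto
      have "stack (Suc t) (case_nat A G)"
        using G A m mA finA Suc.prems unfolding stack_def
        by (auto simp: less_Suc_eq_0_disj card_gt_0_iff split: nat.splits) (force+)
      moreover have "\<forall>i<Suc t. case_nat A G i \<subseteq> F"
        using G A by (auto split: nat.splits)
      ultimately show ?thesis by blast
    qed
  qed
qed

lemma infinite_stack:
  fixes N :: "nat set"
  assumes "infinite N"
  shows "\<exists>G. (\<forall>t. stack t G) \<and> (\<forall>i. G i \<subseteq> N \<inter> {b<..})"
proof -
  have ex: "\<exists>A. A \<subseteq> N \<inter> {c<..} \<and> finite A \<and> 0 < card A \<and> card A \<in> A \<and> (\<forall>a\<in>A. card A \<le> a)" for c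
  proof -
    have "infinite (N \<inter> {c<..})"
      using assms by (metis Diff_Diff_Int finite_Diff2 finite_atMost Compl_atMost Diff_eq double_complement)
    then obtain m where m: "m \<in> N" "c < m"
      by (metis Int_iff all_not_in_conv finite.emptyI greaterThan_iff)
    have "infinite (N \<inter> {m<..})"
      using assms by (metis Diff_Diff_Int finite_Diff2 finite_atMost Compl_atMost Diff_eq double_complement)
    then obtain H where H: "H \<subseteq> N \<inter> {m<..}" "finite H" "card H = m - 1"
      using infinite_arbitrarily_large by metis
    have "card (insert m H) = m"
      using H m by (subst card_insert_disjoint) auto
    then show ?thesis
      using H m by (intro exI[of _ "insert m H"]) auto
  qed
  define P where "P A \<longleftrightarrow> A \<subseteq> N \<inter> {b<..} \<and> finite A \<and> 0 < card A \<and> card A \<in> A \<and> (\<forall>a\<in>A. card A \<le> a)" for A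
  have "\<exists>G. \<forall>n. P (G n) \<and> (\<forall>a\<in>G n. \<forall>b\<in>G (Suc n). a < b)"
  proof (rule dependent_nat_choice)
    show "\<exists>A. P A" using ex unfolding P_def by blast
    show "\<exists>B. P B \<and> (\<forall>a\<in>A. \<forall>b\<in>B. a < b)" if "P A" for A n
    proof -
      obtain B where B: "B \<subseteq> N \<inter> {max b (Max A)<..}" "finite B" "0 < card B" "card B \<in> B" "\<forall>a\<in>B. card B \<le> a"
        using ex by blast
      moreover have "\<forall>a\<in>A. a \<le> Max A" using that unfolding P_def by auto
      ultimately show ?thesis
        unfolding P_def by (intro exI[of _ B]) fastforce
    qed
  qed
  then obtain G where "\<forall>n. P (G n) \<and> (\<forall>a\<in>G n. \<forall>b\<in>G (Suc n). a < b)" by blast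
  then show ?thesis
    unfolding P_def stack_def by (intro exI[of _ G]) auto
qed


section \<open>A common description of the Schreier and Baernstein norms\<close>

text \<open>
  The families of sets whose mass the norms measure: for the Baernstein norms finitely many successive Schreier
  sets, for the Schreier norms (\<open>single\<close>) at most one. Empty sets and arbitrary finite index sets are admitted, so that
  preimages and subfamilies of families are families again.
\<close>

definition family :: "bool \<Rightarrow> nat set \<Rightarrow> (nat \<Rightarrow> nat set) \<Rightarrow> bool" where
  "family single I F \<longleftrightarrow> finite I \<and> (single \<longrightarrow> card I \<le> 1) \<and> (\<forall>i\<in>I. F i \<in> schreier_sets) \<and>
     (\<forall>i\<in>I. \<forall>j\<in>I. i < j \<longrightarrow> (\<forall>a\<in>F i. \<forall>b\<in>F j. a < b))"

definition mass :: "real \<Rightarrow> real \<Rightarrow> (nat \<Rightarrow> 'k::real_normed_vector) \<Rightarrow> nat set \<Rightarrow> (nat \<Rightarrow> nat set) \<Rightarrow> real" where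
  "mass r s x I F = (\<Sum>i\<in>I. (\<Sum>n\<in>F i. norm (x n) powr r) powr s)"

text \<open>
  A Banach space whose norm to the power \<open>r * s\<close> is the largest mass of a family. The Schreier space with exponent
  \<open>p\<close> has \<open>r = p\<close>, \<open>s = 1\<close> and at most one set, the Baernstein space with exponent \<open>p\<close> has
  \<open>r = 1\<close>, \<open>s = p\<close> and any number of sets. In both cases several sets are governed by an exponent (\<open>r * s\<close> or \<open>\<infinity>\<close>)
  that exceeds the exponent \<open>r\<close> for a single set; this is the last assumption on the parameters.
\<close>

locale schreier_space = banach_space_over smul
  for smul :: "'k::{real_normed_field,euclidean_space} \<Rightarrow> 'e::banach \<Rightarrow> 'e" +
  fixes \<iota> :: "(nat \<Rightarrow> 'k) \<Rightarrow> 'e" and r s :: real and single :: bool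
  assumes r: "1 \<le> r" and s: "1 \<le> s" and single_or: "single \<or> 1 < s"
    and \<iota>_add: "x \<in> c00 \<Longrightarrow> y \<in> c00 \<Longrightarrow> \<iota> (\<lambda>n. x n + y n) = \<iota> x + \<iota> y"
    and \<iota>_scale: "x \<in> c00 \<Longrightarrow> \<iota> (\<lambda>n. a * x n) = smul a (\<iota> x)"
    and dense: "closure (\<iota> ` c00) = UNIV"
    and mass_le_norm: "x \<in> c00 \<Longrightarrow> family single I F \<Longrightarrow> mass r s x I F \<le> norm (\<iota> x) powr (r * s)"
    and norm_le_mass: "x \<in> c00 \<Longrightarrow> 0 \<le> c \<Longrightarrow>
      (\<And>I F. family single I F \<Longrightarrow> mass r s x I F \<le> c powr (r * s)) \<Longrightarrow> norm (\<iota> x) \<le> c"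

lemma family_disjoint:
  assumes "family single I F" "i \<in> I" "j \<in> I" "n \<in> F i" "n \<in> F j"
  shows "i = j"
  using assms unfolding family_def by (metis less_irrefl nat_neq_iff)

lemma family_subset: "family single I F \<Longrightarrow> J \<subseteq> I \<Longrightarrow> family single J F"
  unfolding family_def by (meson card_mono finite_subset order_trans subset_iff)

lemma finite_family: "family single I F \<Longrightarrow> finite I" "family single I F \<Longrightarrow> i \<in> I \<Longrightarrow> finite (F i)"
  unfolding family_def schreier_sets_iff by auto

lemma c00_add: "x \<in> c00 \<Longrightarrow> y \<in> c00 \<Longrightarrow> (\<lambda>n. x n + y n :: 'k::monoid_add) \<in> c00"
  unfolding c00_def
  by (auto intro: finite_subset[of _ "{n. x n \<noteq> 0} \<union> {n. y n \<noteq> 0}"])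

lemma c00_mult: "x \<in> c00 \<Longrightarrow> (\<lambda>n. a * x n :: 'k::mult_zero) \<in> c00"
  unfolding c00_def by (auto intro: finite_subset[of _ "{n. x n \<noteq> 0}"])

lemma c00_support: "x \<in> c00 \<Longrightarrow> (\<And>n. x n = 0 \<Longrightarrow> y n = 0) \<Longrightarrow> y \<in> c00"
  unfolding c00_def by (auto intro: finite_subset[of _ "{n. x n \<noteq> 0}"])

lemma c00_zero: "(\<lambda>_. 0) \<in> c00"
  by (simp add: c00_def)

lemma c00_sum:
  "finite A \<Longrightarrow> (\<And>i. i \<in> A \<Longrightarrow> x i \<in> c00) \<Longrightarrow> (\<lambda>n. \<Sum>i\<in>A. x i n :: 'k::comm_monoid_add) \<in> c00"
  by (induction A rule: finite_induct) (auto simp: c00_zero c00_add)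

lemma c00_finite: "finite A \<Longrightarrow> A \<subseteq> {1..} \<Longrightarrow> (\<And>n. n \<notin> A \<Longrightarrow> x n = 0) \<Longrightarrow> x \<in> c00"
  unfolding c00_def by (auto intro: finite_subset[of _ A])

context schreier_space
begin

lemma rs: "1 \<le> r * s" "0 < r * s"
  using r s mult_mono[of 1 r 1 s] by auto

lemma norm_powr_le_mass:
  assumes "x \<in> c00" "0 \<le> K" "\<And>I F. family single I F \<Longrightarrow> mass r s x I F \<le> K"
  shows "norm (\<iota> x) powr (r * s) \<le> K"
proof -
  have e: "(K powr (1 / (r * s))) powr (r * s) = K"
    using assms(2) r s by (simp add: powr_powr)
  then have "norm (\<iota> x) \<le> K powr (1 / (r * s))"
    using assms by (intro norm_le_mass) auto
  then have "norm (\<iota> x) powr (r * s) \<le> (K powr (1 / (r * s))) powr (r * s)"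
    using rs by (intro powr_mono2) auto
  then show ?thesis using e by simp
qed

lemma \<iota>_zero: "\<iota> (\<lambda>_. 0) = 0"
  using \<iota>_scale[OF c00_zero, of 0] by simp

lemma \<iota>_sum:
  "finite A \<Longrightarrow> (\<And>i. i \<in> A \<Longrightarrow> x i \<in> c00) \<Longrightarrow> \<iota> (\<lambda>n. \<Sum>i\<in>A. x i n) = (\<Sum>i\<in>A. \<iota> (x i))"
  by (induction A rule: finite_induct) (auto simp: \<iota>_zero \<iota>_add c00_sum)

lemma \<iota>_diff:
  assumes "x \<in> c00" "y \<in> c00"
  shows "\<iota> (\<lambda>n. x n - y n) = \<iota> x - \<iota> y"
proof -
  have "\<iota> (\<lambda>n. - y n) = - \<iota> y"
    using \<iota>_scale[OF assms(2), of "-1"] by simp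
  then show ?thesis
    using \<iota>_add[OF assms(1) c00_mult[OF assms(2), of "-1"]] by simp
qed

lemma mass_mono:
  assumes "\<And>n. norm (x n) \<le> norm (y n)"
  shows "mass r s x I F \<le> mass r s y I F"
  unfolding mass_def using r s assms
  by (intro sum_mono powr_mono2 sum_nonneg) auto

lemma norm_\<iota>_mono:
  assumes y: "y \<in> c00" and le: "\<And>n. norm (x n) \<le> norm (y n)"
  shows "x \<in> c00" "norm (\<iota> x) \<le> norm (\<iota> y)"
proof -
  have "x n = 0" if "y n = 0" for n using le[of n] that by simp
  then show x: "x \<in> c00" by (rule c00_support[OF y])
  show "norm (\<iota> x) \<le> norm (\<iota> y)"
    by (intro norm_le_mass x norm_ge_zero order_trans[OF mass_mono mass_le_norm[OF y]] le)
qed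

lemma schreier_sum_le_norm:
  assumes "x \<in> c00" "F \<in> schreier_sets"
  shows "(\<Sum>n\<in>F. norm (x n) powr r) \<le> norm (\<iota> x) powr r"
proof -
  have "mass r s x {0} (\<lambda>_. F) \<le> norm (\<iota> x) powr (r * s)"
    using assms by (intro mass_le_norm) (auto simp: family_def)
  then have *: "(\<Sum>n\<in>F. norm (x n) powr r) powr s \<le> (norm (\<iota> x) powr r) powr s"
    by (simp add: mass_def powr_powr)
  show ?thesis
  proof (rule ccontr)
    assume "\<not> ?thesis"
    then have "(norm (\<iota> x) powr r) powr s < (\<Sum>n\<in>F. norm (x n) powr r) powr s"
      using s by (intro powr_less_mono2) auto
    then show False using * by simp
  qed
qed

lemma coordinate_le_norm:
  assumes "x \<in> c00"
  shows "norm (x n) \<le> norm (\<iota> x)"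
proof (cases "n = 0")
  case True
  then show ?thesis using assms by (simp add: c00_def)
next
  case False
  then have "norm (x n) powr r \<le> norm (\<iota> x) powr r"
    using schreier_sum_le_norm[OF assms singleton_schreier[of n]] by simp
  then show ?thesis
    using r powr_less_mono2[of r "norm (\<iota> x)" "norm (x n)"] by (meson not_le le_less_trans less_irrefl norm_ge_zero order_less_le_trans zero_less_one)
qed

definition average :: "nat set \<Rightarrow> nat \<Rightarrow> 'k" where
  "average G n = (if n \<in> G then of_real (real (card G) powr (- 1 / r)) else 0)"

lemma average_c00: "finite G \<Longrightarrow> G \<subseteq> {1..} \<Longrightarrow> average G \<in> c00"
  by (rule c00_finite[of G]) (auto simp: average_def)

lemma norm_average_powr: "norm (average G n) powr r = (if n \<in> G then 1 / real (card G) else 0)"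
proof -
  have "norm (of_real (real (card G) powr (- 1 / r)) :: 'k) powr r = 1 / real (card G)"
    unfolding norm_of_real abs_of_nonneg[OF powr_ge_zero] powr_powr
    using r by (cases "card G = 0") (auto simp: powr_minus_divide)
  then show ?thesis by (simp add: average_def)
qed

text \<open>
  The sets of a family are disjoint, so they carry fractions of the mass of the average with sum at most one, and
  then the \<open>s\<close>-th powers of these fractions have sum at most one.
\<close>

lemma norm_average:
  assumes "finite G" "G \<subseteq> {1..}"
  shows "norm (\<iota> (average G)) \<le> 1"
proof (rule norm_le_mass)
  fix I F assume fam: "family single I F"
  have fin: "finite I" "\<And>i. i \<in> I \<Longrightarrow> finite (F i)" using finite_family[OF fam] by auto
  define c where "c i = (\<Sum>n\<in>F i. norm (average G n) powr r)" for i
  have c: "c i = card (F i \<inter> G) / card G" if "i \<in> I" for i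
    unfolding c_def norm_average_powr using fin(2)[OF that] by (simp add: sum.If_cases)
  have "(\<Sum>i\<in>I. card (F i \<inter> G)) = card (\<Union>i\<in>I. F i \<inter> G)"
    using fin family_disjoint[OF fam] by (intro card_UN_disjoint[symmetric]) auto
  also have "\<dots> \<le> card G" using assms by (intro card_mono) auto
  finally have le: "(\<Sum>i\<in>I. real (card (F i \<inter> G))) \<le> card G"
    by (metis of_nat_le_iff of_nat_sum)
  have "c i powr s \<le> c i" if "i \<in> I" for i
  proof -
    have "card (F i \<inter> G) \<le> card G" using assms by (intro card_mono) auto
    then have "0 \<le> c i" "c i \<le> 1" using c[OF that] by (auto simp: divide_le_eq)
    then show ?thesis using powr_mono'[of 1 s "c i"] s by (cases "c i = 0") auto
  qed
  then have "mass r s (average G) I F \<le> (\<Sum>i\<in>I. c i)"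
    unfolding mass_def c_def by (intro sum_mono) auto
  also have "\<dots> = (\<Sum>i\<in>I. real (card (F i \<inter> G))) / card G"
    using c by (simp add: sum_divide_distrib)
  also have "\<dots> \<le> 1" using le by (simp add: divide_le_eq)
  finally show "mass r s (average G) I F \<le> 1 powr (r * s)" by simp
qed (use assms average_c00 in auto)


subsection \<open>Sums of blocks\<close>

text \<open>
  A Schreier set that meets the block \<open>x l\<close> first, in a point \<open>n\<close>, has at most \<open>n\<close> elements. Beyond that
  block it therefore carries only a geometrically small part of each \<open>x j\<close>. The first parts of the sets
  of a family add up to the norms of the blocks; the remaining parts are harmless, because at most one set
  that meets \<open>x l\<close> first can reach further, so they are shifts of the coefficients with
  geometric weights.
\<close>

lemma block_sum:
  fixes x :: "nat \<Rightarrow> nat \<Rightarrow> 'k" and a :: "nat \<Rightarrow> 'k"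
  assumes x: "\<And>i. i < q \<Longrightarrow> x i \<in> c00"
    and succ: "\<And>i j n m. i < j \<Longrightarrow> j < q \<Longrightarrow> x i n \<noteq> 0 \<Longrightarrow> x j m \<noteq> 0 \<Longrightarrow> n < m"
    and decay: "\<And>i j n m. i < j \<Longrightarrow> j < q \<Longrightarrow> x i n \<noteq> 0 \<Longrightarrow>
      norm (x j m) powr r * (real n * 2 ^ (j - i)) \<le> 2"
    and B: "\<And>i. i < q \<Longrightarrow> norm (\<iota> (x i)) \<le> B"
    and D: "\<And>I. I \<subseteq> {..<q} \<Longrightarrow> (single \<longrightarrow> card I \<le> 1) \<Longrightarrow> (\<Sum>i\<in>I. norm (a i) powr (r * s)) \<le> D"
  shows "norm (\<iota> (\<lambda>n. \<Sum>i<q. a i * x i n)) powr (r * s) \<le> 2 powr s * (B powr (r * s) + 2 powr s) * D"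
proof -
  define z where "z n = (\<Sum>i<q. a i * x i n)" for n
  have z: "z \<in> c00" unfolding z_def by (intro c00_sum c00_mult x) auto
  have D0: "0 \<le> D" using D[of "{}"] by simp
  have "mass r s z I F \<le> 2 powr s * (B powr (r * s) + 2 powr s) * D" if fam: "family single I F" for I F
  proof -
    have fin: "finite I" "\<And>f. f \<in> I \<Longrightarrow> finite (F f)" using finite_family[OF fam] by auto
    define S where "S f i = (\<Sum>n\<in>F f. norm (x i n) powr r)" for f i
    define T where "T f = (\<Sum>n\<in>F f. norm (z n) powr r)" for f
    \<comment> \<open>\<open>L f\<close> is the set of blocks that the set \<open>F f\<close> meets, \<open>l f\<close> is the first of them\<close>
    define L where "L f = {i. i < q \<and> S f i \<noteq> 0}" for f
    define l where "l f = Min (L f)" for f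
    have S0: "0 \<le> S f i" for f i unfolding S_def by (intro sum_nonneg) auto
    have finL: "finite (L f)" for f unfolding L_def by simp
    have L_ex: "\<exists>n\<in>F f. x i n \<noteq> 0" if "i \<in> L f" for f i
    proof (rule ccontr)
      assume "\<not> ?thesis"
      then have "S f i = 0" unfolding S_def by simp
      then show False using that unfolding L_def by simp
    qed
    have z_powr: "norm (z n) powr r = (\<Sum>i<q. norm (a i) powr r * norm (x i n) powr r)" for n
    proof (cases "\<exists>i<q. x i n \<noteq> 0")
      case True
      then obtain i where i: "i < q" "x i n \<noteq> 0" by auto
      have other: "x j n = 0" if "j < q" "j \<noteq> i" for j
        using succ[of i j n n] succ[of j i n n] that i by (metis less_irrefl nat_neq_iff)
      have "z n = (\<Sum>j\<in>{i}. a j * x j n)"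
        unfolding z_def using other i by (intro sum.mono_neutral_right) auto
      moreover have "(\<Sum>i<q. norm (a i) powr r * norm (x i n) powr r) = (\<Sum>j\<in>{i}. norm (a j) powr r * norm (x j n) powr r)"
        using other i by (intro sum.mono_neutral_right) auto
      ultimately show ?thesis by (simp add: norm_mult powr_mult)
    qed (simp add: z_def)
    have T_eq: "T f = (\<Sum>i<q. norm (a i) powr r * S f i)" for f
      unfolding T_def z_powr S_def sum_distrib_left by (rule sum.swap)
    define I1 where "I1 = {f \<in> I. L f \<noteq> {}}"
    \<comment> \<open>the sets that reach beyond their first block\<close>
    define I2 where "I2 = {f \<in> I1. \<exists>i\<in>L f. l f < i}"
    have I12: "I2 \<subseteq> I1" "I1 \<subseteq> I" "finite I1" "finite I2"
      unfolding I1_def I2_def using fin by auto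
    have l_in: "l f \<in> L f" if "f \<in> I1" for f
      using that finL Min_in unfolding l_def I1_def by auto
    have l_q: "l f < q" if "f \<in> I1" for f using l_in[OF that] unfolding L_def by auto
    have tail: "S f j \<le> 2 * (1/2) ^ (j - l f)" if f: "f \<in> I1" and j: "l f < j" "j < q" for f j
    proof -
      obtain n where n: "n \<in> F f" "x (l f) n \<noteq> 0" using L_ex[OF l_in[OF f]] by auto
      have "F f \<in> schreier_sets" using fam f I12 unfolding family_def by auto
      then have cn: "card (F f) \<le> n" and n1: "1 \<le> n" using n unfolding schreier_sets_iff by auto
      have "norm (x j m) powr r \<le> 2 * (1/2) ^ (j - l f) / real n" for m
        using decay[OF j n(2), of m] n1 by (simp add: field_simps)
      then have "S f j \<le> real (card (F f)) * (2 * (1/2) ^ (j - l f) / real n)"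
        unfolding S_def by (intro sum_bounded_above) auto
      also have "\<dots> \<le> real n * (2 * (1/2) ^ (j - l f) / real n)"
        using cn by (intro mult_right_mono) auto
      finally show ?thesis using n1 by simp
    qed
    \<comment> \<open>coefficients extended by zero, so that they can be shifted\<close>
    define b where "b j = (if j < q then norm (a j) powr r else 0)" for j
    have b0: "0 \<le> b j" for j unfolding b_def by simp
    define A where "A f = norm (a (l f)) powr r * S f (l f)" for f
    define R where "R f = 2 * (\<Sum>d=1..q. (1/2) ^ d * b (l f + d))" for f
    have R0: "0 \<le> R f" for f unfolding R_def using b0 by (intro mult_nonneg_nonneg sum_nonneg) auto
    have A0: "0 \<le> A f" for f unfolding A_def using S0 by simp
    have T_split: "T f \<le> A f + (if f \<in> I2 then R f else 0)" if f: "f \<in> I1" for f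
    proof -
      have "T f = (\<Sum>i\<in>L f. norm (a i) powr r * S f i)"
        unfolding T_eq by (intro sum.mono_neutral_right) (auto simp: L_def)
      also have "\<dots> = A f + (\<Sum>i\<in>L f - {l f}. norm (a i) powr r * S f i)"
        unfolding A_def using l_in[OF f] finL by (simp add: sum.remove)
      finally have eq: "T f = A f + (\<Sum>i\<in>L f - {l f}. norm (a i) powr r * S f i)" .
      have gt: "l f < i \<and> i < q" if "i \<in> L f - {l f}" for i
        using that finL unfolding l_def L_def by (metis (no_types, lifting) DiffE Min_le finL L_def le_neq_implies_less mem_Collect_eq singletonI)
      show ?thesis
      proof (cases "f \<in> I2")
        case False
        then have "L f - {l f} = {}" using gt f unfolding I2_def by blast
        then show ?thesis using eq False by (simp only: sum.empty if_False)
      next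
        case True
        have "(\<Sum>i\<in>L f - {l f}. norm (a i) powr r * S f i) \<le> (\<Sum>i\<in>L f - {l f}. b i * (2 * (1/2) ^ (i - l f)))"
          using gt tail[OF f] unfolding b_def by (intro sum_mono) (auto intro!: mult_left_mono)
        also have "\<dots> = (\<Sum>d\<in>(\<lambda>i. i - l f) ` (L f - {l f}). 2 * ((1/2) ^ d * b (l f + d)))"
          using gt by (subst sum.reindex) (auto intro!: inj_onI sum.cong simp: less_imp_le, metis DiffI le_add_diff_inverse less_imp_le_nat singletonD)
        also have "\<dots> \<le> (\<Sum>d=1..q. 2 * ((1/2) ^ d * b (l f + d)))"
        proof (intro sum_mono2)
          show "(\<lambda>i. i - l f) ` (L f - {l f}) \<subseteq> {1..q}"
          proof
            fix d assume "d \<in> (\<lambda>i. i - l f) ` (L f - {l f})"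
            then obtain i where "i \<in> L f - {l f}" "d = i - l f" by blast
            then show "d \<in> {1..q}" using gt[of i] by auto
          qed
        qed (use b0 in auto)
        finally show ?thesis using eq True by (simp add: R_def sum_distrib_left)
      qed
    qed
    have A_sum: "(\<Sum>f\<in>I1. A f powr s) \<le> B powr (r * s) * D"
    proof -
      have "(\<Sum>f\<in>I1. A f powr s) = (\<Sum>k\<in>l ` I1. \<Sum>f\<in>{f \<in> I1. l f = k}. A f powr s)"
        using I12 by (intro sum.group[symmetric]) auto
      also have "\<dots> \<le> (\<Sum>k\<in>l ` I1. B powr (r * s) * norm (a k) powr (r * s))"
      proof (rule sum_mono)
        fix k assume k: "k \<in> l ` I1"
        then have kq: "k < q" using l_q by auto
        have eq: "(\<Sum>f\<in>{f \<in> I1. l f = k}. A f powr s) = norm (a k) powr (r * s) * mass r s (x k) {f \<in> I1. l f = k} F"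
          unfolding A_def mass_def S_def sum_distrib_left[of _ _ "{f \<in> I1. l f = k}"]
          by (intro sum.cong) (auto simp: powr_mult powr_powr sum_nonneg)
        have "mass r s (x k) {f \<in> I1. l f = k} F \<le> norm (\<iota> (x k)) powr (r * s)"
          using I12 by (intro mass_le_norm x kq family_subset[OF fam]) auto
        also have "\<dots> \<le> B powr (r * s)" using B[OF kq] rs by (intro powr_mono2) auto
        finally have "norm (a k) powr (r * s) * mass r s (x k) {f \<in> I1. l f = k} F
            \<le> norm (a k) powr (r * s) * B powr (r * s)"
          by (rule mult_left_mono) simp
        then show "(\<Sum>f\<in>{f \<in> I1. l f = k}. A f powr s) \<le> B powr (r * s) * norm (a k) powr (r * s)"
          unfolding eq by (simp only: mult.commute)
      qed
      also have "\<dots> \<le> B powr (r * s) * D"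
        unfolding sum_distrib_left[symmetric]
      proof (intro mult_left_mono D impI)
        show "card (l ` I1) \<le> 1" if single
          using card_image_le[of I1 l] card_mono[of I I1] I12 fin that fam unfolding family_def by linarith
      qed (use l_q in auto)
      finally show ?thesis .
    qed
    \<comment> \<open>of two sets that meet the same block first, the earlier one ends in this block\<close>
    have inj: "inj_on l I2"
    proof (rule inj_onI, rule ccontr)
      have no: False if f: "f \<in> I2" and g: "g \<in> I2" and lt: "f < g" and eq: "l f = l g" for f g
      proof -
        obtain i where i: "i \<in> L f" "l f < i" using f unfolding I2_def by auto
        obtain n where n: "n \<in> F f" "x i n \<noteq> 0" using L_ex[OF i(1)] by auto
        obtain m where m: "m \<in> F g" "x (l g) m \<noteq> 0" using L_ex[OF l_in] g I12 by blast
        have "m < n" using succ[of "l g" i m n] i n m eq unfolding L_def by auto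
        moreover have "n < m" using fam f g lt n m I12 unfolding family_def by blast
        ultimately show False by simp
      qed
      fix f g assume "f \<in> I2" "g \<in> I2" "l f = l g" "f \<noteq> g"
      then show False using no[of f g] no[of g f] by (metis nat_neq_iff)
    qed
    have R_sum: "(\<Sum>f\<in>I2. R f powr s) \<le> 2 powr s * D"
    proof -
      have w: "(\<Sum>d=1..q. (1/2::real) ^ d) \<le> 1"
      proof -
        have "(\<Sum>d=1..q. (1/2::real) ^ d) = 1 - (1/2) ^ q" by (induction q) auto
        then show ?thesis by simp
      qed
      have "R f powr s \<le> 2 powr s * (\<Sum>d=1..q. (1/2) ^ d * b (l f + d) powr s)" for f
      proof -
        have "R f powr s = 2 powr s * (\<Sum>d=1..q. (1/2) ^ d * b (l f + d)) powr s"
          unfolding R_def using b0 by (subst powr_mult) (auto intro!: sum_nonneg)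
        also have "\<dots> \<le> 2 powr s * (\<Sum>d=1..q. (1/2) ^ d * b (l f + d) powr s)"
          using w b0 s by (intro mult_left_mono powr_weighted_sum_le) auto
        finally show ?thesis .
      qed
      then have "(\<Sum>f\<in>I2. R f powr s) \<le> (\<Sum>f\<in>I2. 2 powr s * (\<Sum>d=1..q. (1/2) ^ d * b (l f + d) powr s))"
        by (intro sum_mono) auto
      also have "\<dots> = 2 powr s * (\<Sum>d=1..q. (1/2) ^ d * (\<Sum>f\<in>I2. b (l f + d) powr s))"
        unfolding sum_distrib_left[symmetric] by (subst sum.swap) (simp add: sum_distrib_left)
      also have "\<dots> \<le> 2 powr s * (\<Sum>d=1..q. (1/2) ^ d * D)"
      proof (intro mult_left_mono sum_mono)
        fix d
        define J where "J = {j \<in> (\<lambda>f. l f + d) ` I2. j < q}"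
        have "(\<Sum>f\<in>I2. b (l f + d) powr s) = (\<Sum>j\<in>(\<lambda>f. l f + d) ` I2. b j powr s)"
          using inj by (subst sum.reindex) (auto simp: inj_on_def)
        also have "\<dots> = (\<Sum>j\<in>J. norm (a j) powr (r * s))"
          unfolding J_def b_def using I12
          by (intro sum.mono_neutral_cong_right) (auto simp: powr_powr)
        also have "\<dots> \<le> D"
        proof (rule D)
          have "card J \<le> card ((\<lambda>f. l f + d) ` I2)" unfolding J_def using I12 by (intro card_mono) auto
          also have "\<dots> \<le> card I2" using I12 by (intro card_image_le) auto
          also have "\<dots> \<le> card I" using I12 fin by (intro card_mono) auto
          finally show "single \<longrightarrow> card J \<le> 1" using fam unfolding family_def by auto
        qed (auto simp: J_def)
        finally show "(\<Sum>f\<in>I2. b (l f + d) powr s) \<le> D" .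
      qed auto
      also have "\<dots> \<le> 2 powr s * D"
        unfolding sum_distrib_right[symmetric] using w D0 by (intro mult_left_mono mult_left_le_one_le sum_nonneg) auto
      finally show ?thesis .
    qed
    have "mass r s z I F = (\<Sum>f\<in>I. T f powr s)" unfolding mass_def T_def by simp
    also have "\<dots> = (\<Sum>f\<in>I1. T f powr s)"
    proof (rule sum.mono_neutral_right)
      show "\<forall>f\<in>I - I1. T f powr s = 0"
      proof
        fix f assume "f \<in> I - I1"
        then have "L f = {}" unfolding I1_def by auto
        then have "T f = 0" unfolding T_eq L_def by (intro sum.neutral) auto
        then show "T f powr s = 0" by simp
      qed
    qed (use fin I12 in auto)
    also have "\<dots> \<le> (\<Sum>f\<in>I1. 2 powr s * (A f powr s + (if f \<in> I2 then R f powr s else 0)))"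
    proof (rule sum_mono)
      fix f assume f: "f \<in> I1"
      have "T f powr s \<le> (A f + (if f \<in> I2 then R f else 0)) powr s"
        using T_split[OF f] s by (intro powr_mono2) (auto simp: T_def intro: sum_nonneg)
      also have "\<dots> \<le> 2 powr s * (A f powr s + (if f \<in> I2 then R f else 0) powr s)"
        using A0 R0 s by (intro powr_add_le) auto
      finally show "T f powr s \<le> 2 powr s * (A f powr s + (if f \<in> I2 then R f powr s else 0))"
        by (simp split: if_splits)
    qed
    also have "\<dots> = 2 powr s * ((\<Sum>f\<in>I1. A f powr s) + (\<Sum>f\<in>I2. R f powr s))"
      using I12 by (simp add: sum_distrib_left[symmetric] sum.distrib sum.If_cases Int_absorb1)
    also have "\<dots> \<le> 2 powr s * (B powr (r * s) * D + 2 powr s * D)"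
      using A_sum R_sum by (intro mult_left_mono add_mono) auto
    finally show ?thesis by (simp add: algebra_simps)
  qed
  then show ?thesis
    using norm_powr_le_mass[OF z] D0 unfolding z_def by simp
qed

end


lemma sum_UN_le:
  fixes f :: "'a \<Rightarrow> real"
  assumes "finite K" "\<And>k. k \<in> K \<Longrightarrow> finite (H k)" "\<And>a. 0 \<le> f a"
  shows "(\<Sum>a\<in>(\<Union>k\<in>K. H k). f a) \<le> (\<Sum>k\<in>K. \<Sum>a\<in>H k. f a)"
  using assms(1,2)
proof (induction K rule: finite_induct)
  case (insert k K)
  then have "(\<Sum>a\<in>H k \<union> (\<Union>k\<in>K. H k). f a) \<le> (\<Sum>a\<in>H k. f a) + (\<Sum>a\<in>(\<Union>k\<in>K. H k). f a)"
    using assms(3) by (subst sum_Un) (auto simp: sum_nonneg)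
  then show ?case using insert by simp
qed simp

lemma familyD:
  assumes "family single I F"
  shows "i \<in> I \<Longrightarrow> F i \<in> schreier_sets"
    "i \<in> I \<Longrightarrow> j \<in> I \<Longrightarrow> i < j \<Longrightarrow> \<forall>a\<in>F i. \<forall>b\<in>F j. a < b"
  using assms unfolding family_def by blast+

context schreier_space
begin

text \<open>
  The power \<open>growth t\<close> describes the \<open>r\<close>-th power of the norm of a sum of \<open>t\<close> quickly spreading blocks;
  the point is that it is of smaller order than \<open>t\<close>, which is what \<open>t\<close> unit vectors
  with indices in a Schreier set would give.
\<close>

definition growth :: "nat \<Rightarrow> real" where
  "growth t = (if single then 1 else real t powr (1 / s))"

lemma growth_sublinear: "\<exists>t0. \<forall>t\<ge>t0. C1 + C2 * growth t < real t"
proof (cases single)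
  case True
  obtain t0 :: nat where "C1 + C2 < real t0" using reals_Archimedean2 by blast
  then show ?thesis using True unfolding growth_def by (intro exI[of _ t0]) auto
next
  case False
  then have s1: "1 < s" using single_or by auto
  define a where "a = 1 - 1 / s"
  have a: "0 < a" using s1 unfolding a_def by simp
  define K where "K = max 1 (2 * \<bar>C2\<bar>)"
  obtain t0 :: nat where t0: "max (2 * \<bar>C1\<bar> + 1) (K powr (1 / a)) < real t0" using reals_Archimedean2 by blast
  have "C1 + C2 * growth t < real t" if "t0 \<le> t" for t
  proof -
    have t: "2 * \<bar>C1\<bar> + 1 < real t" "K powr (1 / a) < real t" using t0 that by auto
    have tpos: "0 < real t" using t by auto
    have "K = (K powr (1 / a)) powr a" using a unfolding K_def by (simp add: powr_powr)
    also have "\<dots> \<le> real t powr a" using t a by (intro powr_mono2) auto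
    finally have "K * real t powr (1 / s) \<le> real t powr a * real t powr (1 / s)" by (intro mult_right_mono) auto
    also have "\<dots> = real t" unfolding powr_add[symmetric] a_def using tpos by simp
    finally have "K * growth t \<le> real t" unfolding growth_def using False by simp
    moreover have "2 * (C2 * growth t) \<le> K * growth t"
      unfolding K_def growth_def using False mult_right_mono[of "2 * C2" "max 1 (2 * \<bar>C2\<bar>)" "real t powr (1 / s)"] by (auto simp: mult.assoc)
    ultimately show ?thesis using t by linarith
  qed
  then show ?thesis by blast
qed

text \<open>
  The \<open>s\<close>-th root of the constant in \<open>block_sum\<close>.
\<close>

definition block_const :: "real \<Rightarrow> real" where
  "block_const B = (2 powr s * (B powr (r * s) + 2 powr s)) powr (1 / s)"

lemma block_const_nonneg: "0 \<le> block_const B"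
  by (simp add: block_const_def)

lemma block_sum_growth:
  fixes x :: "nat \<Rightarrow> nat \<Rightarrow> 'k"
  assumes x: "\<And>i. i < q \<Longrightarrow> x i \<in> c00"
    and succ: "\<And>i j n m. i < j \<Longrightarrow> j < q \<Longrightarrow> x i n \<noteq> 0 \<Longrightarrow> x j m \<noteq> 0 \<Longrightarrow> n < m"
    and decay: "\<And>i j n m. i < j \<Longrightarrow> j < q \<Longrightarrow> x i n \<noteq> 0 \<Longrightarrow>
      norm (x j m) powr r * (real n * 2 ^ (j - i)) \<le> 2"
    and B: "\<And>i. i < q \<Longrightarrow> norm (\<iota> (x i)) \<le> B"
  shows "norm (\<iota> (\<lambda>n. \<Sum>i<q. x i n)) powr r \<le> block_const B * growth q"
proof -
  define D :: real where "D = (if single then 1 else real q)"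
  let ?C = "2 powr s * (B powr (r * s) + 2 powr s)"
  let ?v = "norm (\<iota> (\<lambda>n. \<Sum>i<q. x i n))"
  have "norm (\<iota> (\<lambda>n. \<Sum>i<q. 1 * x i n)) powr (r * s) \<le> ?C * D"
  proof (rule block_sum[OF x succ decay B])
    fix I assume I: "I \<subseteq> {..<q}" "single \<longrightarrow> card I \<le> 1"
    have "card I \<le> q" using card_mono[OF _ I(1)] by simp
    then show "(\<Sum>i\<in>I. norm (1::'k) powr (r * s)) \<le> D"
      using I unfolding D_def by auto
  qed
  then have "(?v powr (r * s)) powr (1 / s) \<le> (?C * D) powr (1 / s)"
    using s by (intro powr_mono2) auto
  also have "\<dots> = block_const B * growth q"
    unfolding block_const_def growth_def D_def by (subst powr_mult) (auto simp: )
  finally show ?thesis using s by (simp add: powr_powr)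
qed

text \<open>
  The test vectors of the whole argument: sums of the normalised averages over the sets of a stack. By
  \<open>stack_vector_mass\<close> and \<open>stack_vector_norm\<close> the sum of the \<open>r\<close>-th powers of the coordinates is \<open>t\<close>, while the norm
  is of smaller order.
\<close>

definition stack_vector :: "nat \<Rightarrow> (nat \<Rightarrow> nat set) \<Rightarrow> nat \<Rightarrow> 'k" where
  "stack_vector t G n = (\<Sum>i<t. average (G i) n)"

lemma stack_average_decay:
  assumes G: "stack t G" and ij: "i < j" "j < t" and n: "n \<in> G i"
  shows "norm (average (G j) m) powr r * (real n * 2 ^ (j - i)) \<le> 2"
proof -
  have "real n * 2 ^ (j - i) \<le> 2 * real (card (G j))"
    using of_nat_mono[OF stack_growth[OF G ij n], where 'a = real] by simp
  moreover have "0 < card (G j)" using stackD(2)[OF G ij(2)] .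
  ultimately show ?thesis unfolding norm_average_powr by (simp add: field_simps)
qed

lemma stack_schreier: "stack t G \<Longrightarrow> i < t \<Longrightarrow> finite (G i) \<and> G i \<subseteq> {1..}"
  using stackD(6)[of t G i] unfolding schreier_sets_iff by simp

lemma average_in: "average G n \<noteq> 0 \<Longrightarrow> n \<in> G"
  by (auto simp: average_def split: if_splits)

lemma stack_vector_norm:
  assumes G: "stack t G"
  shows "stack_vector t G \<in> c00" "norm (\<iota> (stack_vector t G)) powr r \<le> block_const 1 * growth t"
proof -
  have c: "average (G i) \<in> c00" if "i < t" for i
    using stack_schreier[OF G that] average_c00 by auto
  show "stack_vector t G \<in> c00"
    using c00_sum[of "{..<t}" "\<lambda>i. average (G i)"] c unfolding stack_vector_def[abs_def] by simp
  show "norm (\<iota> (stack_vector t G)) powr r \<le> block_const 1 * growth t"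
    unfolding stack_vector_def[abs_def]
  proof (rule block_sum_growth)
    show "n < m" if "i < j" "j < t" "average (G i) n \<noteq> 0" "average (G j) m \<noteq> 0" for i j n m
      using stack_less[OF G that(1,2) average_in[OF that(3)] average_in[OF that(4)]] .
    show "norm (average (G j) m) powr r * (real n * 2 ^ (j - i)) \<le> 2"
      if "i < j" "j < t" "average (G i) n \<noteq> 0" for i j n m
      using stack_average_decay[OF G that(1,2) average_in[OF that(3)]] .
    show "norm (\<iota> (average (G i))) \<le> 1" if "i < t" for i
      using stack_schreier[OF G that] norm_average by auto
  qed (rule c)
qed

lemma stack_vector_in:
  assumes G: "stack t G" and i: "i < t" "n \<in> G i"
  shows "stack_vector t G n = of_real (real (card (G i)) powr (- 1 / r))"
    "norm (stack_vector t G n) powr r = 1 / card (G i)"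
proof -
  have "average (G j) n = 0" if "j < t" "j \<noteq> i" for j
    using stack_disjoint[OF G that(1) i(1) that(2)] i by (auto simp: average_def)
  then have e: "stack_vector t G n = (\<Sum>j\<in>{i}. average (G j) n)"
    unfolding stack_vector_def using i by (intro sum.mono_neutral_right) auto
  then show "stack_vector t G n = of_real (real (card (G i)) powr (- 1 / r))"
    using i by (simp add: average_def)
  show "norm (stack_vector t G n) powr r = 1 / card (G i)"
    using e i by (simp add: norm_average_powr)
qed

lemma stack_vector_notin: "n \<notin> (\<Union>i<t. G i) \<Longrightarrow> stack_vector t G n = 0"
  unfolding stack_vector_def by (intro sum.neutral) (auto simp: average_def)

lemma stack_sum:
  fixes f :: "nat \<Rightarrow> 'z::comm_monoid_add"
  assumes G: "stack t G"
  shows "(\<Sum>n\<in>(\<Union>i<t. G i). f n) = (\<Sum>i<t. \<Sum>n\<in>G i. f n)"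
  using stackD(1)[OF G] stack_disjoint[OF G] by (intro sum.UNION_disjoint) auto

lemma stack_vector_mass:
  assumes G: "stack t G"
  shows "(\<Sum>n\<in>(\<Union>i<t. G i). norm (stack_vector t G n) powr r) = real t"
proof -
  have "(\<Sum>n\<in>(\<Union>i<t. G i). norm (stack_vector t G n) powr r) = (\<Sum>i<t. \<Sum>n\<in>G i. 1 / real (card (G i)))"
    unfolding stack_sum[OF G] by (intro sum.cong refl) (simp add: stack_vector_in(2)[OF G])
  also have "\<dots> = (\<Sum>i<t. 1)"
    using stackD(2)[OF G] by (intro sum.cong) auto
  finally show ?thesis by simp
qed


subsection \<open>Moving the support\<close>

definition relocate :: "nat set \<Rightarrow> (nat \<Rightarrow> nat) \<Rightarrow> (nat \<Rightarrow> 'k) \<Rightarrow> nat \<Rightarrow> 'k" where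
  "relocate A \<pi> x m = (if m \<in> \<pi> ` A then x (inv_into A \<pi> m) else 0)"

lemma relocate_apply: "inj_on \<pi> A \<Longrightarrow> n \<in> A \<Longrightarrow> relocate A \<pi> x (\<pi> n) = x n"
  by (simp add: relocate_def)

lemma relocate_c00:
  assumes "x \<in> c00" "\<pi> ` A \<subseteq> {1..}"
  shows "relocate A \<pi> x \<in> c00"
proof -
  have "{m. relocate A \<pi> x m \<noteq> 0} \<subseteq> \<pi> ` {n. x n \<noteq> 0}"
  proof
    fix m assume "m \<in> {m. relocate A \<pi> x m \<noteq> 0}"
    then have "m \<in> \<pi> ` A" "x (inv_into A \<pi> m) \<noteq> 0" by (auto simp: relocate_def split: if_splits)
    then show "m \<in> \<pi> ` {n. x n \<noteq> 0}" using f_inv_into_f[of m \<pi> A] by (intro image_eqI[of _ _ "inv_into A \<pi> m"]) auto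
  qed
  then have "finite {m. relocate A \<pi> x m \<noteq> 0}"
    using assms(1) unfolding c00_def by (auto intro: finite_subset)
  moreover have "relocate A \<pi> x 0 = 0" using assms(2) by (auto simp: relocate_def)
  ultimately show ?thesis unfolding c00_def by simp
qed

text \<open>
  If the preimage of every Schreier set is covered by \<open>t\<close> Schreier sets, the successive sets of a family
  pull back to \<open>t\<close> families, and moving the support increases the norm by a bounded factor only.
\<close>

lemma norm_relocate:
  assumes x: "x \<in> c00" and \<pi>: "strict_mono_on A \<pi>" "\<pi> ` A \<subseteq> {1..}"
    and cov: "\<And>F. F \<in> schreier_sets \<Longrightarrow> F \<subseteq> \<pi> ` A \<Longrightarrow> covered t {n \<in> A. \<pi> n \<in> F}"
  shows "norm (\<iota> (relocate A \<pi> x)) powr (r * s) \<le> (real t powr s * real t) * norm (\<iota> x) powr (r * s)"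
proof (rule norm_powr_le_mass)
  show "relocate A \<pi> x \<in> c00" using relocate_c00 x \<pi> by auto
  fix I F assume fam: "family single I F"
  have inj: "inj_on \<pi> A" using \<pi>(1) by (rule strict_mono_on_imp_inj_on)
  have fin: "finite I" "\<And>i. i \<in> I \<Longrightarrow> finite (F i)" using finite_family[OF fam] by auto
  have "\<exists>H. {n \<in> A. \<pi> n \<in> F i} = (\<Union>k<t. H k) \<and> (\<forall>k<t. H k \<in> schreier_sets)" if "i \<in> I" for i
  proof -
    have "F i \<in> schreier_sets" using familyD(1)[OF fam that] .
    then have "F i \<inter> \<pi> ` A \<in> schreier_sets" by (rule schreier_sets_subset) auto
    then have "covered t {n \<in> A. \<pi> n \<in> F i \<inter> \<pi> ` A}" by (intro cov) auto
    moreover have "{n \<in> A. \<pi> n \<in> F i \<inter> \<pi> ` A} = {n \<in> A. \<pi> n \<in> F i}" by auto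
    ultimately show ?thesis unfolding covered_def by simp
  qed
  then have "\<exists>H. \<forall>i\<in>I. {n \<in> A. \<pi> n \<in> F i} = (\<Union>k<t. H i k) \<and> (\<forall>k<t. H i k \<in> schreier_sets)"
    by (intro bchoice ballI)
  then obtain H where H: "\<And>i. i \<in> I \<Longrightarrow> {n \<in> A. \<pi> n \<in> F i} = (\<Union>k<t. H i k)"
    "\<And>i k. i \<in> I \<Longrightarrow> k < t \<Longrightarrow> H i k \<in> schreier_sets" by blast
  have finH: "finite (H i k)" if "i \<in> I" "k < t" for i k
    using H(2)[OF that] unfolding schreier_sets_iff by simp
  have fam_k: "family single I (\<lambda>i. H i k)" if k: "k < t" for k
    unfolding family_def
  proof (intro conjI ballI impI)
    fix i j a b assume ij: "i \<in> I" "j \<in> I" "i < j" and ab: "a \<in> H i k" "b \<in> H j k"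
    have "a \<in> {n \<in> A. \<pi> n \<in> F i}" "b \<in> {n \<in> A. \<pi> n \<in> F j}"
      unfolding H(1)[OF ij(1)] H(1)[OF ij(2)] using ab k by auto
    then have m: "a \<in> A" "\<pi> a \<in> F i" "b \<in> A" "\<pi> b \<in> F j" by auto
    then have lt: "\<pi> a < \<pi> b" using familyD(2)[OF fam ij] by blast
    show "a < b"
    proof (rule ccontr)
      assume "\<not> a < b"
      then have "\<pi> b \<le> \<pi> a"
        using strict_mono_onD[OF \<pi>(1) m(3) m(1)] by (cases "a = b") auto
      then show False using lt by simp
    qed
  next
    show "H i k \<in> schreier_sets" if "i \<in> I" for i using H(2)[OF that k] .
    show "card I \<le> 1" if single using fam that unfolding family_def by blast
    show "finite I" using fin(1) .
  qed
  have step: "(\<Sum>m\<in>F i. norm (relocate A \<pi> x m) powr r) \<le> (\<Sum>k<t. \<Sum>n\<in>H i k. norm (x n) powr r)" if i: "i \<in> I" for i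
  proof -
    let ?E = "{n \<in> A. \<pi> n \<in> F i}"
    have "(\<Sum>m\<in>F i. norm (relocate A \<pi> x m) powr r) = (\<Sum>m\<in>\<pi> ` ?E. norm (relocate A \<pi> x m) powr r)"
      using fin(2)[OF i] by (intro sum.mono_neutral_right) (auto simp: relocate_def)
    also have "\<dots> = (\<Sum>n\<in>?E. norm (x n) powr r)"
      using inj by (subst sum.reindex) (auto simp: inj_on_def relocate_apply[OF inj] intro!: sum.cong)
    also have "\<dots> \<le> (\<Sum>k<t. \<Sum>n\<in>H i k. norm (x n) powr r)"
      unfolding H(1)[OF i] using finH[OF i] by (intro sum_UN_le) auto
    finally show ?thesis .
  qed
  have "mass r s (relocate A \<pi> x) I F \<le> (\<Sum>i\<in>I. (\<Sum>k<t. \<Sum>n\<in>H i k. norm (x n) powr r) powr s)"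
    unfolding mass_def using step s by (intro sum_mono powr_mono2) (auto intro: sum_nonneg)
  also have "\<dots> \<le> (\<Sum>i\<in>I. real t powr s * (\<Sum>k<t. (\<Sum>n\<in>H i k. norm (x n) powr r) powr s))"
    using s by (intro sum_mono order_trans[OF powr_sum_le]) (auto intro: sum_nonneg)
  also have "\<dots> = real t powr s * (\<Sum>k<t. mass r s x I (\<lambda>i. H i k))"
    unfolding mass_def sum_distrib_left[symmetric] by (subst sum.swap) simp
  also have "\<dots> \<le> real t powr s * (\<Sum>k<t. norm (\<iota> x) powr (r * s))"
    using mass_le_norm[OF x fam_k] by (intro mult_left_mono sum_mono) auto
  finally show "mass r s (relocate A \<pi> x) I F \<le> (real t powr s * real t) * norm (\<iota> x) powr (r * s)"
    by (simp add: mult.assoc)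
qed simp

end


section \<open>Operators defined on finitely supported sequences\<close>

context schreier_space
begin

abbreviation (input) e :: "nat \<Rightarrow> 'e" where "e \<equiv> unit_vector \<iota>"

abbreviation dirac :: "nat \<Rightarrow> nat \<Rightarrow> 'k" where "dirac n \<equiv> (\<lambda>k. if k = n then 1 else 0)"

abbreviation operators :: "('e \<Rightarrow>\<^sub>L 'e) set" where
  "operators \<equiv> carrier (operator_algebra smul)"

lemma operators_iff: "T \<in> operators \<longleftrightarrow> (\<forall>a x. T (smul a x) = smul a (T x))"
  by (simp add: operator_algebra_def)

lemma c00_sequence_tendsto: "\<exists>z. (\<forall>k. z k \<in> c00) \<and> (\<lambda>k. \<iota> (z k)) \<longlonglongrightarrow> v"
proof -
  have "v \<in> closure (\<iota> ` c00)" using dense by simp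
  then obtain f where f: "\<forall>n. f n \<in> \<iota> ` c00" "f \<longlonglongrightarrow> v"
    unfolding closure_sequential by auto
  then have "\<forall>n. \<exists>z. z \<in> c00 \<and> f n = \<iota> z" by auto
  then obtain z where z: "\<forall>n. z n \<in> c00 \<and> f n = \<iota> (z n)" by metis
  then have "f = (\<lambda>k. \<iota> (z k))" by auto
  then show ?thesis using z f by auto
qed

lemma dense_induct:
  assumes "closed {v. P v}" "\<And>x. x \<in> c00 \<Longrightarrow> P (\<iota> x)"
  shows "P v"
proof -
  have "closure (\<iota> ` c00) \<subseteq> {v. P v}"
    using assms by (intro closure_minimal) auto
  then show ?thesis using dense by auto
qed

text \<open>
  The value at \<open>v\<close> is the limit of the values along any sequence in \<open>c00\<close> that converges to \<open>v\<close>.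
\<close>

lemma extend_bounded_linear:
  fixes f :: "(nat \<Rightarrow> 'k) \<Rightarrow> 'b::banach"
  assumes add: "\<And>x y. x \<in> c00 \<Longrightarrow> y \<in> c00 \<Longrightarrow> f (\<lambda>n. x n + y n) = f x + f y"
    and scale: "\<And>c x. x \<in> c00 \<Longrightarrow> f (\<lambda>n. of_real c * x n) = c *\<^sub>R f x"
    and bdd: "\<And>x. x \<in> c00 \<Longrightarrow> norm (f x) \<le> C * norm (\<iota> x)"
  shows "\<exists>T :: 'e \<Rightarrow>\<^sub>L 'b. \<forall>x\<in>c00. T (\<iota> x) = f x"
proof -
  have diff: "f (\<lambda>n. x n - y n) = f x - f y" if "x \<in> c00" "y \<in> c00" for x y
    using add[OF that(1) c00_mult[OF that(2), of "of_real (-1)"]] scale[OF that(2), of "-1"] by simp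
  have diff_c00: "(\<lambda>n. x n - y n) \<in> c00" if "x \<in> c00" "y \<in> c00" for x y :: "nat \<Rightarrow> 'k"
    using c00_add[OF that(1) c00_mult[OF that(2), of "-1"]] by simp
  have lip: "norm (f x - f y) \<le> C * norm (\<iota> x - \<iota> y)" if "x \<in> c00" "y \<in> c00" for x y
    using bdd[OF diff_c00[OF that]] diff[OF that] \<iota>_diff[OF that] by simp
  obtain Y where Y: "\<And>v k. Y v k \<in> c00" "\<And>v. (\<lambda>k. \<iota> (Y v k)) \<longlonglongrightarrow> v"
    using c00_sequence_tendsto by metis
  have null: "(\<lambda>k. f (z k) - f (w k)) \<longlonglongrightarrow> 0"
    if z: "\<And>k. z k \<in> c00" "(\<lambda>k. \<iota> (z k)) \<longlonglongrightarrow> v" and w: "\<And>k. w k \<in> c00" "(\<lambda>k. \<iota> (w k)) \<longlonglongrightarrow> v" for z w v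
  proof (rule Lim_null_comparison)
    show "\<forall>\<^sub>F k in sequentially. norm (f (z k) - f (w k)) \<le> C * norm (\<iota> (z k) - \<iota> (w k))"
      using lip z w by simp
    have "(\<lambda>k. C * norm (\<iota> (z k) - \<iota> (w k))) \<longlonglongrightarrow> C * norm (v - v)"
      using z w by (intro tendsto_intros)
    then show "(\<lambda>k. C * norm (\<iota> (z k) - \<iota> (w k))) \<longlonglongrightarrow> 0" by simp
  qed
  have "Cauchy (\<lambda>k. f (Y v k))" for v
  proof (rule metric_CauchyI)
    fix \<epsilon> :: real assume \<epsilon>: "0 < \<epsilon>"
    have "Cauchy (\<lambda>k. \<iota> (Y v k))" using Y(2) by (rule LIMSEQ_imp_Cauchy)
    then obtain M where M: "\<And>m n. M \<le> m \<Longrightarrow> M \<le> n \<Longrightarrow> dist (\<iota> (Y v m)) (\<iota> (Y v n)) < \<epsilon> / (\<bar>C\<bar> + 1)"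
      using \<epsilon> unfolding Cauchy_def by (metis abs_ge_zero add_nonneg_pos divide_pos_pos zero_less_one)
    have "dist (f (Y v m)) (f (Y v n)) < \<epsilon>" if "M \<le> m" "M \<le> n" for m n
    proof -
      have "dist (f (Y v m)) (f (Y v n)) \<le> C * dist (\<iota> (Y v m)) (\<iota> (Y v n))"
        using lip Y by (simp add: dist_norm)
      also have "\<dots> \<le> (\<bar>C\<bar> + 1) * dist (\<iota> (Y v m)) (\<iota> (Y v n))"
        by (intro mult_right_mono) auto
      also have "\<dots> < \<epsilon>" using M[OF that] by (simp add: field_simps)
      finally show ?thesis .
    qed
    then show "\<exists>M. \<forall>m\<ge>M. \<forall>n\<ge>M. dist (f (Y v m)) (f (Y v n)) < \<epsilon>" by blast
  qed
  then have T: "(\<lambda>k. f (Y v k)) \<longlonglongrightarrow> lim (\<lambda>k. f (Y v k))" for v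
    using Cauchy_convergent convergent_LIMSEQ_iff by blast
  define T where "T v = lim (\<lambda>k. f (Y v k))" for v
  note T = T[folded T_def]
  have lim: "(\<lambda>k. f (z k)) \<longlonglongrightarrow> T v" if "\<And>k. z k \<in> c00" "(\<lambda>k. \<iota> (z k)) \<longlonglongrightarrow> v" for z v
    using tendsto_add[OF null[OF that Y] T[of v]] by simp
  have T\<iota>: "T (\<iota> x) = f x" if "x \<in> c00" for x
    using lim[of "\<lambda>_. x" "\<iota> x"] that by (simp add: LIMSEQ_const_iff)
  have "bounded_linear T"
  proof (rule bounded_linear_intro)
    fix v w
    have "(\<lambda>k. f (\<lambda>n. Y v k n + Y w k n)) \<longlonglongrightarrow> T (v + w)"
      using tendsto_add[OF Y(2) Y(2)] by (intro lim c00_add Y) (simp add: \<iota>_add Y)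
    moreover have "(\<lambda>k. f (\<lambda>n. Y v k n + Y w k n)) \<longlonglongrightarrow> T v + T w"
      using tendsto_add[OF T T] by (simp add: add Y)
    ultimately show "T (v + w) = T v + T w" by (rule LIMSEQ_unique)
  next
    fix c v
    have "(\<lambda>k. f (\<lambda>n. of_real c * Y v k n)) \<longlonglongrightarrow> T (c *\<^sub>R v)"
      using tendsto_scaleR[OF tendsto_const Y(2)]
      by (intro lim c00_mult Y) (simp add: \<iota>_scale[OF Y(1)] scale_of_real)
    moreover have "(\<lambda>k. f (\<lambda>n. of_real c * Y v k n)) \<longlonglongrightarrow> c *\<^sub>R T v"
      using tendsto_scaleR[OF tendsto_const T] by (simp add: scale Y)
    ultimately show "T (c *\<^sub>R v) = c *\<^sub>R T v" by (rule LIMSEQ_unique)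
  next
    fix v
    have "norm (T v) \<le> C * norm v"
      by (rule LIMSEQ_le[OF tendsto_norm[OF T] tendsto_mult[OF tendsto_const tendsto_norm[OF Y(2)]]])
        (use bdd Y in auto)
    then show "norm (T v) \<le> norm v * C" by (simp add: mult.commute)
  qed
  then show ?thesis
    using T\<iota> by (intro exI[of _ "Blinfun T"]) (simp add: bounded_linear_Blinfun_apply)
qed

lemma smul_bounded_linear: "bounded_linear (smul a)" "bounded_linear (\<lambda>a. smul a v)"
proof -
  show "bounded_linear (smul a)"
    by (rule bounded_linear_intro[where K = "norm a"])
      (auto simp: scale_right_distrib norm_scale scale_of_real[symmetric] mult.commute)
  have "smul (c *\<^sub>R a) v = c *\<^sub>R smul a v" for c a
    unfolding scale_of_real[symmetric] scale_scale by (simp add: scaleR_conv_of_real)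
  then show "bounded_linear (\<lambda>a. smul a v)"
    by (intro bounded_linear_intro[where K = "norm v"]) (auto simp: scale_left_distrib norm_scale)
qed

lemma extend_operator:
  assumes c00: "\<And>x. x \<in> c00 \<Longrightarrow> f x \<in> c00"
    and add: "\<And>x y n. x \<in> c00 \<Longrightarrow> y \<in> c00 \<Longrightarrow> f (\<lambda>n. x n + y n) n = f x n + f y n"
    and scale: "\<And>a x n. x \<in> c00 \<Longrightarrow> f (\<lambda>n. a * x n) n = a * f x n"
    and bdd: "\<And>x. x \<in> c00 \<Longrightarrow> norm (\<iota> (f x)) \<le> C * norm (\<iota> x)"
  shows "\<exists>T\<in>operators. \<forall>x\<in>c00. T (\<iota> x) = \<iota> (f x)"
proof -
  have fs: "f (\<lambda>n. a * x n) = (\<lambda>n. a * f x n)" if "x \<in> c00" for a x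
    using scale[OF that] by auto
  have fa: "f (\<lambda>n. x n + y n) = (\<lambda>n. f x n + f y n)" if "x \<in> c00" "y \<in> c00" for x y
    using add[OF that] by auto
  have "\<exists>T :: 'e \<Rightarrow>\<^sub>L 'e. \<forall>x\<in>c00. T (\<iota> x) = \<iota> (f x)"
    by (rule extend_bounded_linear[where C = C])
      (simp_all add: fa fs c00 \<iota>_add \<iota>_scale scale_of_real bdd)
  then obtain T :: "'e \<Rightarrow>\<^sub>L 'e" where T: "\<And>x. x \<in> c00 \<Longrightarrow> T (\<iota> x) = \<iota> (f x)" by blast
  have "T (smul a v) = smul a (T v)" for a v
  proof (rule dense_induct[of "\<lambda>v. T (smul a v) = smul a (T v)"])
    show "closed {v. T (smul a v) = smul a (T v)}"
      by (intro closed_Collect_eq continuous_intros bounded_linear.continuous_on[OF smul_bounded_linear(1)])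
    show "T (smul a (\<iota> x)) = smul a (T (\<iota> x))" if "x \<in> c00" for x
      using T[OF c00_mult[OF that, of a]] by (simp add: \<iota>_scale that T fs c00)
  qed
  then show ?thesis using T by (intro bexI[of _ T]) (simp_all add: operators_iff)
qed

subsection \<open>Coordinates\<close>

definition coord :: "nat \<Rightarrow> 'e \<Rightarrow>\<^sub>L 'k" where
  "coord n = (SOME T. \<forall>x\<in>c00. blinfun_apply T (\<iota> x) = x n)"

lemma coord_\<iota>: "x \<in> c00 \<Longrightarrow> coord n (\<iota> x) = x n"
proof -
  have "\<exists>T :: 'e \<Rightarrow>\<^sub>L 'k. \<forall>x\<in>c00. T (\<iota> x) = x n"
    by (rule extend_bounded_linear[where C = 1])
      (simp_all add: coordinate_le_norm scaleR_conv_of_real)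
  then have "\<forall>x\<in>c00. coord n (\<iota> x) = x n" unfolding coord_def by (rule someI_ex)
  then show "x \<in> c00 \<Longrightarrow> coord n (\<iota> x) = x n" by simp
qed

lemma norm_coord_le: "norm (coord n v) \<le> norm v"
  by (rule dense_induct[of "\<lambda>v. norm (coord n v) \<le> norm v"])
    (auto intro!: closed_Collect_le continuous_intros simp: coord_\<iota> coordinate_le_norm)

lemma coord_smul: "coord n (smul a v) = a * coord n v"
  by (rule dense_induct[of "\<lambda>v. coord n (smul a v) = a * coord n v"])
    (auto intro!: closed_Collect_eq continuous_intros bounded_linear.continuous_on[OF smul_bounded_linear(1)]
      simp: \<iota>_scale[symmetric] coord_\<iota> c00_mult)

lemma dirac_c00: "1 \<le> n \<Longrightarrow> dirac n \<in> c00"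
  by (rule c00_finite[of "{n}"]) auto

lemma coord_e: "1 \<le> n \<Longrightarrow> coord k (e n) = (if k = n then 1 else 0)"
  by (simp add: unit_vector_def coord_\<iota> dirac_c00)

lemma coord_0: "coord 0 v = 0"
  by (rule dense_induct[of "\<lambda>v. coord 0 v = 0"])
    (auto intro!: closed_Collect_eq continuous_intros simp: coord_\<iota> c00_def)

lemma norm_e: "1 \<le> n \<Longrightarrow> norm (e n) \<le> 1"
proof -
  assume "1 \<le> n"
  then have "norm (\<iota> (average {n})) \<le> 1" by (intro norm_average) auto
  moreover have "average {n} = dirac n" by (auto simp: average_def fun_eq_iff)
  ultimately show "norm (e n) \<le> 1" by (simp add: unit_vector_def)
qed

lemma \<iota>_finite:
  assumes "finite A" "A \<subseteq> {1..}" "\<And>n. n \<notin> A \<Longrightarrow> x n = 0"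
  shows "\<iota> x = (\<Sum>n\<in>A. smul (x n) (e n))"
proof -
  have "x = (\<lambda>k. \<Sum>n\<in>A. x n * dirac n k)"
    using assms by (auto simp: fun_eq_iff if_distrib cong: if_cong)
  then have "\<iota> x = \<iota> (\<lambda>k. \<Sum>n\<in>A. x n * dirac n k)" by (rule arg_cong)
  also have "\<dots> = (\<Sum>n\<in>A. \<iota> (\<lambda>k. x n * dirac n k))"
    using assms by (intro \<iota>_sum c00_mult dirac_c00) auto
  also have "\<dots> = (\<Sum>n\<in>A. smul (x n) (e n))"
    unfolding unit_vector_def using assms by (intro sum.cong \<iota>_scale dirac_c00) auto
  finally show ?thesis .
qed

lemma \<iota>_c00_sum:
  assumes "x \<in> c00"
  shows "\<iota> x = (\<Sum>n | x n \<noteq> 0. smul (x n) (e n))"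
  using assms by (intro \<iota>_finite) (auto simp: c00_def Suc_le_eq intro: gr0I)

lemma operator_eqI:
  assumes "S \<in> operators" "T \<in> operators" "\<And>n. 1 \<le> n \<Longrightarrow> S (e n) = T (e n)"
  shows "S = T"
proof (rule blinfun_eqI)
  fix v show "S v = T v"
  proof (rule dense_induct[of "\<lambda>v. S v = T v"])
    show "closed {v. S v = T v}" by (intro closed_Collect_eq continuous_intros)
    fix x :: "nat \<Rightarrow> 'k" assume x: "x \<in> c00"
    have "1 \<le> n" if "x n \<noteq> 0" for n using x that by (auto simp: c00_def Suc_le_eq intro: gr0I)
    then show "S (\<iota> x) = T (\<iota> x)"
      using assms unfolding \<iota>_c00_sum[OF x] by (simp add: blinfun.sum_right operators_iff)
  qed
qed


subsection \<open>Basis projections\<close>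

definition restr :: "nat set \<Rightarrow> (nat \<Rightarrow> 'k) \<Rightarrow> nat \<Rightarrow> 'k" where
  "restr M x n = (if n \<in> M then x n else 0)"

definition proj :: "nat set \<Rightarrow> 'e \<Rightarrow>\<^sub>L 'e" where
  "proj M = (SOME T. T \<in> operators \<and> (\<forall>x\<in>c00. blinfun_apply T (\<iota> x) = \<iota> (restr M x)))"

lemma restr_norm:
  assumes "x \<in> c00"
  shows "restr M x \<in> c00" "norm (\<iota> (restr M x)) \<le> norm (\<iota> x)"
  by (rule norm_\<iota>_mono[OF assms], simp add: restr_def)+

lemma proj_operator: "proj M \<in> operators"
  and proj_\<iota>: "x \<in> c00 \<Longrightarrow> proj M (\<iota> x) = \<iota> (restr M x)"
proof -
  have "\<exists>T\<in>operators. \<forall>x\<in>c00. T (\<iota> x) = \<iota> (restr M x)"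
    by (rule extend_operator[where C = 1]) (use restr_norm in \<open>auto simp: restr_def\<close>)
  then have "\<exists>T. T \<in> operators \<and> (\<forall>x\<in>c00. T (\<iota> x) = \<iota> (restr M x))" by blast
  then have "proj M \<in> operators \<and> (\<forall>x\<in>c00. proj M (\<iota> x) = \<iota> (restr M x))"
    unfolding proj_def by (rule someI_ex)
  then show "proj M \<in> operators" "x \<in> c00 \<Longrightarrow> proj M (\<iota> x) = \<iota> (restr M x)" by auto
qed

lemma norm_proj_le: "norm (proj M v) \<le> norm v"
  by (rule dense_induct[of "\<lambda>v. norm (proj M v) \<le> norm v"])
    (auto intro!: closed_Collect_le continuous_intros simp: proj_\<iota> restr_norm)

lemma proj_e: "1 \<le> n \<Longrightarrow> proj M (e n) = (if n \<in> M then e n else 0)"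
proof -
  assume n: "1 \<le> n"
  have "restr M (dirac n) = (if n \<in> M then dirac n else (\<lambda>_. 0))" by (auto simp: restr_def fun_eq_iff)
  then show ?thesis using n by (simp add: unit_vector_def proj_\<iota> dirac_c00 \<iota>_zero)
qed

lemma coord_proj: "coord n (proj M v) = (if n \<in> M then coord n v else 0)"
proof (rule dense_induct[of "\<lambda>v. coord n (proj M v) = (if n \<in> M then coord n v else 0)"])
  show "closed {v. coord n (proj M v) = (if n \<in> M then coord n v else 0)}"
    by (cases "n \<in> M") (auto intro!: closed_Collect_eq continuous_intros)
qed (simp add: proj_\<iota> coord_\<iota> restr_norm restr_def)

lemma proj_finite:
  assumes "finite F" "F \<subseteq> {1..}"
  shows "proj F v = \<iota> (\<lambda>n. if n \<in> F then coord n v else 0)"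
proof -
  have "proj F v = (\<Sum>n\<in>F. smul (coord n v) (e n))"
  proof (rule dense_induct[of "\<lambda>v. proj F v = (\<Sum>n\<in>F. smul (coord n v) (e n))"])
    show "closed {v. proj F v = (\<Sum>n\<in>F. smul (coord n v) (e n))}"
      by (intro closed_Collect_eq continuous_intros bounded_linear.continuous_on[OF smul_bounded_linear(2)])
    show "proj F (\<iota> x) = (\<Sum>n\<in>F. smul (coord n (\<iota> x)) (e n))" if "x \<in> c00" for x
      using \<iota>_finite[OF assms, of "restr F x"] that
      by (simp add: proj_\<iota> coord_\<iota> restr_def)
  qed
  also have "\<dots> = \<iota> (\<lambda>n. if n \<in> F then coord n v else 0)"
    by (subst \<iota>_finite[OF assms]) auto
  finally show ?thesis .
qed

lemma operator_id: "id_blinfun \<in> operators"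
  and operator_compose: "S \<in> operators \<Longrightarrow> T \<in> operators \<Longrightarrow> S o\<^sub>L T \<in> operators"
  and operator_add: "S \<in> operators \<Longrightarrow> T \<in> operators \<Longrightarrow> S + T \<in> operators"
  and operator_zero: "0 \<in> operators"
  and operator_uminus: "T \<in> operators \<Longrightarrow> - T \<in> operators"
  by (auto simp: operators_iff blinfun.add_left blinfun.minus_left scale_right_distrib scale_minus_right)

lemma proj_compose: "proj M o\<^sub>L proj N = proj (M \<inter> N)"
  by (rule operator_eqI)
    (simp_all add: operator_compose proj_operator proj_e blinfun.zero_right)

lemma proj_Un: "M \<inter> N = {} \<Longrightarrow> proj (M \<union> N) = proj M + proj N"
  by (rule operator_eqI)
    (auto simp: operator_add proj_operator proj_e blinfun.add_left)

lemma proj_UNIV: "proj {1..} = id_blinfun"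
  by (rule operator_eqI) (simp_all add: operator_id proj_operator proj_e)

text \<open>
  Sequences in \<open>c00\<close> are fixed by the projections onto large sets, and the projections have norm at most one.
\<close>

lemma proj_approx:
  assumes "0 < \<epsilon>"
  shows "\<exists>A. finite A \<and> A \<subseteq> {1..} \<and> (\<forall>B. A \<subseteq> B \<longrightarrow> norm (v - proj B v) < \<epsilon>)"
proof -
  obtain x where x: "x \<in> c00" "norm (v - \<iota> x) < \<epsilon> / 2"
  proof -
    have "v \<in> closure (\<iota> ` c00)" using dense by simp
    then have "\<exists>y\<in>\<iota> ` c00. dist y v < \<epsilon> / 2"
      using assms unfolding closure_approachable by (meson half_gt_zero)
    then show thesis using that by (auto simp: dist_norm norm_minus_commute)
  qed
  define A where "A = {n. x n \<noteq> 0}"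
  have A: "finite A" "A \<subseteq> {1..}" using x(1) unfolding A_def c00_def by (auto simp: Suc_le_eq intro: gr0I)
  have "norm (v - proj B v) < \<epsilon>" if "A \<subseteq> B" for B
  proof -
    have "restr B x = x" using that by (auto simp: restr_def A_def fun_eq_iff)
    then have "v - proj B v = (v - \<iota> x) - proj B (v - \<iota> x)"
      using x(1) by (simp add: blinfun.diff_right proj_\<iota>)
    then have "norm (v - proj B v) \<le> norm (v - \<iota> x) + norm (proj B (v - \<iota> x))"
      by (metis norm_triangle_ineq4)
    also have "\<dots> \<le> norm (v - \<iota> x) + norm (v - \<iota> x)" using norm_proj_le by simp
    finally show ?thesis using x(2) by simp
  qed
  then show ?thesis using A by blast
qed

lemma schreier_coord_le_norm:
  assumes "F \<in> schreier_sets"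
  shows "(\<Sum>n\<in>F. norm (coord n v) powr r) \<le> norm v powr r"
proof -
  have F: "finite F" "F \<subseteq> {1..}" using assms by (auto simp: schreier_sets_iff)
  let ?x = "\<lambda>n. if n \<in> F then coord n v else 0"
  have x: "?x \<in> c00" by (rule c00_finite[OF F]) simp
  have "(\<Sum>n\<in>F. norm (coord n v) powr r) = (\<Sum>n\<in>F. norm (?x n) powr r)" by simp
  also have "\<dots> \<le> norm (\<iota> ?x) powr r" using schreier_sum_le_norm[OF x assms] .
  also have "\<dots> \<le> norm v powr r"
    using norm_proj_le[of F v] r unfolding proj_finite[OF F] by (intro powr_mono2) auto
  finally show ?thesis .
qed

text \<open>
  The basis is unconditional: the partial sum over \<open>F\<close> differs from \<open>proj M v\<close> by a projection of the remainder of \<open>v\<close> outside \<open>F\<close>.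
\<close>

lemma has_sum_proj:
  assumes M: "M \<subseteq> {1..}"
  shows "((\<lambda>n. smul (coord n v) (e n)) has_sum proj M v) M"
  unfolding has_sum_def tendsto_iff eventually_finite_subsets_at_top
proof (intro allI impI)
  fix \<epsilon> :: real assume "0 < \<epsilon>"
  then obtain A where A: "finite A" "A \<subseteq> {1..}" "\<And>B. A \<subseteq> B \<Longrightarrow> norm (v - proj B v) < \<epsilon>"
    using proj_approx by metis
  have "dist (\<Sum>n\<in>F. smul (coord n v) (e n)) (proj M v) < \<epsilon>" if F: "finite F" "A \<inter> M \<subseteq> F" "F \<subseteq> M" for F
  proof -
    have F1: "F \<subseteq> {1..}" using F M by auto
    have "(\<Sum>n\<in>F. smul (coord n v) (e n)) = proj F v"
      unfolding proj_finite[OF F(1) F1] by (subst \<iota>_finite[OF F(1) F1]) auto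
    moreover have "proj M v - proj F v = proj M (v - proj (F \<union> A) v)"
    proof -
      have "proj M (proj (F \<union> A) v) = proj (M \<inter> (F \<union> A)) v"
        using proj_compose[of M "F \<union> A"] by (metis blinfun_apply_blinfun_compose)
      moreover have "M \<inter> (F \<union> A) = F" using F by auto
      ultimately show ?thesis by (simp add: blinfun.diff_right)
    qed
    ultimately have "dist (\<Sum>n\<in>F. smul (coord n v) (e n)) (proj M v) \<le> norm (v - proj (F \<union> A) v)"
      using norm_proj_le by (metis dist_norm norm_minus_commute)
    also have "\<dots> < \<epsilon>" by (rule A(3)) auto
    finally show ?thesis .
  qed
  then show "\<exists>X. finite X \<and> X \<subseteq> M \<and> (\<forall>Y. finite Y \<and> X \<subseteq> Y \<and> Y \<subseteq> M \<longrightarrow>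
      dist (\<Sum>n\<in>Y. smul (coord n v) (e n)) (proj M v) < \<epsilon>)"
    using A(1) by (intro exI[of _ "A \<inter> M"]) auto
qed

lemma coords_eq_coord: "coords smul \<iota> v n = coord n v"
proof -
  have "((\<lambda>n. smul (coord n v) (e n)) has_sum v) {1..}"
    using has_sum_proj[of "{1..}" v] unfolding proj_UNIV by simp
  then have "((\<lambda>n. smul (coord n v) (e n)) has_sum v) UNIV"
    by (rule has_sum_cong_neutral[THEN iffD1, rotated -1]) (auto simp: coord_0 Suc_le_eq)
  then have sums: "(\<lambda>n. smul (coord n v) (e n)) sums v" by (rule has_sum_imp_sums)
  have unique: "c = (\<lambda>n. coord n v)" if c: "c 0 = 0" "(\<lambda>n. smul (c n) (e n)) sums v" for c
  proof
    fix k
    have "(\<lambda>n. coord k (smul (c n) (e n))) sums coord k v"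
      using c(2) by (rule bounded_linear.sums[OF blinfun.bounded_linear_right])
    moreover have "coord k (smul (c n) (e n)) = (if n = k then c k else 0)" for n
      using c(1) coord_e[of n k] by (cases "n = 0") (auto simp: coord_smul blinfun.zero_right coord_0)
    ultimately show "c k = coord k v"
      using sums_single[of k c] by (simp add: sums_unique2 cong: if_cong)
  qed
  have "coords smul \<iota> v = (\<lambda>n. coord n v)"
    unfolding coords_def using sums unique by (intro the_equality) (auto simp: coord_0)
  then show ?thesis by simp
qed

lemma basis_projection_eq_proj:
  assumes "M \<subseteq> {1..}"
  shows "basis_projection smul \<iota> M = proj M"
proof -
  have "(\<lambda>v. \<Sum>\<^sub>\<infinity>n\<in>M. smul (coords smul \<iota> v n) (e n)) = blinfun_apply (proj M)"
    using has_sum_proj[OF assms] by (auto simp: coords_eq_coord infsumI)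
  then show ?thesis
    unfolding basis_projection_def by (simp add: blinfun_apply_inverse)
qed

end


section \<open>Ideals of operators\<close>

context schreier_space
begin

text \<open>
  Ideals of the operator algebra, written with the operations of operators. Negatives come for free from the
  multiplication by \<open>- id_blinfun\<close>, see \<open>ideal_iff_opideal\<close>.
\<close>

definition opideal :: "('e \<Rightarrow>\<^sub>L 'e) set \<Rightarrow> bool" where
  "opideal I \<longleftrightarrow> I \<subseteq> operators \<and> 0 \<in> I \<and> (\<forall>S\<in>I. \<forall>T\<in>I. S + T \<in> I) \<and>
     (\<forall>T\<in>I. \<forall>U\<in>operators. U o\<^sub>L T \<in> I \<and> T o\<^sub>L U \<in> I)"

lemma opidealD:
  assumes "opideal I"
  shows "T \<in> I \<Longrightarrow> T \<in> operators" "0 \<in> I" "S \<in> I \<Longrightarrow> T \<in> I \<Longrightarrow> S + T \<in> I"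
    "T \<in> I \<Longrightarrow> U \<in> operators \<Longrightarrow> U o\<^sub>L T \<in> I" "T \<in> I \<Longrightarrow> U \<in> operators \<Longrightarrow> T o\<^sub>L U \<in> I"
  using assms unfolding opideal_def by auto

lemma ideal_iff_opideal: "ideal I (operator_algebra smul) \<longleftrightarrow> opideal I"
proof
  interpret R: ring "operator_algebra smul"
    by (rule ring_operator_algebra) (rule banach_space_over_axioms)
  show "opideal I" if "ideal I (operator_algebra smul)"
  proof -
    interpret ideal I "operator_algebra smul" by fact
    show ?thesis
      unfolding opideal_def
      using a_subset zero_closed a_closed I_l_closed I_r_closed by (auto simp: operator_algebra_def)
  qed
  show "ideal I (operator_algebra smul)" if I: "opideal I"
  proof (rule idealI)
    show "ring (operator_algebra smul)" by (rule R.ring_axioms)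
    show "subgroup I (add_monoid (operator_algebra smul))"
    proof (rule subgroup.intro)
      fix x assume x: "x \<in> I"
      have "(- id_blinfun) o\<^sub>L x \<in> I"
        using opidealD(4)[OF I x] operator_uminus[OF operator_id] by blast
      moreover have "(- id_blinfun) o\<^sub>L x = - x"
        by (rule blinfun_eqI) (simp add: blinfun.minus_left)
      ultimately have mx: "- x \<in> I" by simp
      have "\<ominus>\<^bsub>operator_algebra smul\<^esub> x = - x"
        using x mx opidealD(1)[OF I] by (intro R.minus_equality) (auto simp: operator_algebra_def)
      then show "inv\<^bsub>add_monoid (operator_algebra smul)\<^esub> x \<in> I"
        using mx by (simp add: a_inv_def)
    qed (use opidealD[OF I] in \<open>auto simp: operator_algebra_def\<close>)
  qed (use opidealD[OF I] in \<open>auto simp: operator_algebra_def\<close>)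
qed

lemma generated_ideal_compose:
  assumes "U \<in> operators" "V \<in> operators"
  shows "U o\<^sub>L T o\<^sub>L V \<in> generated_ideal smul T"
  unfolding generated_ideal_def using assms
  by (intro CollectI exI[of _ "1::nat"] exI[of _ "\<lambda>_. U"] exI[of _ "\<lambda>_. V"]) auto

lemma generated_idealE:
  assumes "A \<in> generated_ideal smul T"
  obtains k :: nat and U V where "1 \<le> k" "A = (\<Sum>j=1..k. U j o\<^sub>L T o\<^sub>L V j)"
    "\<forall>j\<in>{1..k}. U j \<in> operators \<and> V j \<in> operators"
proof -
  have "\<exists>(k::nat) U V. A = (\<Sum>j=1..k. U j o\<^sub>L T o\<^sub>L V j) \<and> 1 \<le> k \<and>
      (\<forall>j\<in>{1..k}. U j \<in> operators \<and> V j \<in> operators)"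
    using assms unfolding generated_ideal_def mem_Collect_eq .
  then show thesis using that by blast
qed

lemma generated_ideal_add:
  assumes "A \<in> generated_ideal smul T" "B \<in> generated_ideal smul T"
  shows "A + B \<in> generated_ideal smul T"
proof -
  obtain k :: nat and U V where A: "1 \<le> k" "A = (\<Sum>j=1..k. U j o\<^sub>L T o\<^sub>L V j)"
    "\<forall>j\<in>{1..k}. U j \<in> operators \<and> V j \<in> operators"
    using assms(1) by (rule generated_idealE) (rule that)
  obtain l :: nat and U' V' where B: "1 \<le> l" "B = (\<Sum>j=1..l. U' j o\<^sub>L T o\<^sub>L V' j)"
    "\<forall>j\<in>{1..l}. U' j \<in> operators \<and> V' j \<in> operators"
    using assms(2) by (rule generated_idealE) (rule that)
  define W where "W j = (if j \<le> k then U j else U' (j - k))" for j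
  define X where "X j = (if j \<le> k then V j else V' (j - k))" for j
  have "(\<Sum>j=1..k+l. W j o\<^sub>L T o\<^sub>L X j) = (\<Sum>j=1..k. W j o\<^sub>L T o\<^sub>L X j) + (\<Sum>j=k+1..k+l. W j o\<^sub>L T o\<^sub>L X j)"
    by (rule sum.ub_add_nat) simp
  also have "(\<Sum>j=k+1..k+l. W j o\<^sub>L T o\<^sub>L X j) = (\<Sum>j=1..l. W (j+k) o\<^sub>L T o\<^sub>L X (j+k))"
    using sum.shift_bounds_cl_nat_ivl[of "\<lambda>j. W j o\<^sub>L T o\<^sub>L X j" 1 k l] by (simp add: add.commute)
  also have "\<dots> = B"
    unfolding B(2) by (intro sum.cong) (auto simp: W_def X_def)
  also have "(\<Sum>j=1..k. W j o\<^sub>L T o\<^sub>L X j) = A"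
    unfolding A(2) by (intro sum.cong) (auto simp: W_def X_def)
  finally have eq: "A + B = (\<Sum>j=1..k+l. W j o\<^sub>L T o\<^sub>L X j)" by simp
  have mem: "W j \<in> operators \<and> X j \<in> operators" if "j \<in> {1..k+l}" for j
  proof (cases "j \<le> k")
    case False
    then have "j - k \<in> {1..l}" using that by auto
    then show ?thesis using B(3) False unfolding W_def X_def by simp
  qed (use A(3) that in \<open>simp add: W_def X_def\<close>)
  show ?thesis
    unfolding generated_ideal_def using A(1) eq mem
    by (intro CollectI exI[of _ "k+l"] exI[of _ W] exI[of _ X]) auto
qed

lemma generated_ideal_induct [consumes 1, case_names compose add]:
  assumes A: "A \<in> generated_ideal smul T"
    and comp: "\<And>U V. U \<in> operators \<Longrightarrow> V \<in> operators \<Longrightarrow> P (U o\<^sub>L T o\<^sub>L V)"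
    and add: "\<And>A B. P A \<Longrightarrow> P B \<Longrightarrow> P (A + B)"
  shows "P A"
proof -
  obtain k :: nat and U V where A: "1 \<le> k" "A = (\<Sum>j=1..k. U j o\<^sub>L T o\<^sub>L V j)"
    "\<forall>j\<in>{1..k}. U j \<in> operators \<and> V j \<in> operators"
    using A by (rule generated_idealE) (rule that)
  have "P (\<Sum>j=1..m. U j o\<^sub>L T o\<^sub>L V j)" if "1 \<le> m" "m \<le> k" for m
    using that
  proof (induction m rule: dec_induct)
    case base
    then show ?case using bspec[OF A(3), of 1] by (auto intro: comp)
  next
    case (step m)
    then have "P (\<Sum>j=1..m. U j o\<^sub>L T o\<^sub>L V j)" "P (U (Suc m) o\<^sub>L T o\<^sub>L V (Suc m))"
      using bspec[OF A(3), of "Suc m"] by (auto intro: comp)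
    then show ?case using add by simp
  qed
  then show ?thesis using A by simp
qed

lemma opideal_generated:
  assumes T: "T \<in> operators"
  shows "opideal (generated_ideal smul T)"
  unfolding opideal_def
proof (intro conjI ballI subsetI)
  show "A \<in> operators" if "A \<in> generated_ideal smul T" for A
    using that by (induction rule: generated_ideal_induct) (auto intro: operator_compose operator_add T)
  show "0 \<in> generated_ideal smul T"
    using generated_ideal_compose[OF operator_zero operator_zero, of T] by simp
  fix A U assume A: "A \<in> generated_ideal smul T" and U: "U \<in> operators"
  show "U o\<^sub>L A \<in> generated_ideal smul T"
    using A
  proof (induction rule: generated_ideal_induct)
    case (compose V W)
    have "U o\<^sub>L (V o\<^sub>L T o\<^sub>L W) = (U o\<^sub>L V) o\<^sub>L T o\<^sub>L W" by (rule blinfun_eqI) simp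
    then show ?case using compose U by (simp add: generated_ideal_compose operator_compose)
  next
    case (add A B)
    have "U o\<^sub>L (A + B) = (U o\<^sub>L A) + (U o\<^sub>L B)"
      by (rule blinfun_eqI) (simp add: blinfun.add_left blinfun.add_right)
    then show ?case using add by (simp add: generated_ideal_add)
  qed
  show "A o\<^sub>L U \<in> generated_ideal smul T"
    using A
  proof (induction rule: generated_ideal_induct)
    case (compose V W)
    have "(V o\<^sub>L T o\<^sub>L W) o\<^sub>L U = V o\<^sub>L T o\<^sub>L (W o\<^sub>L U)" by (rule blinfun_eqI) simp
    then show ?case using compose U by (simp add: generated_ideal_compose operator_compose)
  next
    case (add A B)
    have "(A + B) o\<^sub>L U = (A o\<^sub>L U) + (B o\<^sub>L U)"
      by (rule blinfun_eqI) (simp add: blinfun.add_left)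
    then show ?case using add by (simp add: generated_ideal_add)
  qed
qed (auto intro: generated_ideal_add)

lemma generated_ideal_self: "T \<in> generated_ideal smul T"
proof -
  have "id_blinfun o\<^sub>L T o\<^sub>L id_blinfun = T" by (rule blinfun_eqI) simp
  then show ?thesis using generated_ideal_compose[OF operator_id operator_id, of T] by simp
qed

lemma generated_ideal_least:
  assumes "opideal I" "T \<in> I"
  shows "generated_ideal smul T \<subseteq> I"
proof
  fix A assume "A \<in> generated_ideal smul T"
  then show "A \<in> I"
    by (induction rule: generated_ideal_induct) (use assms opidealD in auto)
qed

lemma closed_operators: "closed operators"
proof -
  have "operators = {T. \<forall>a x. blinfun_apply T (smul a x) = smul a (T x)}"
    by (auto simp: operators_iff)
  also have "closed \<dots>"
    by (intro closed_Collect_all closed_Collect_eq continuous_intros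
        bounded_linear.continuous_on[OF smul_bounded_linear(1)])
  finally show ?thesis .
qed

lemma opideal_closure:
  assumes I: "opideal I"
  shows "opideal (closure I)"
  unfolding opideal_def
proof (intro conjI ballI)
  show "closure I \<subseteq> operators"
    using opidealD(1)[OF I] closed_operators by (intro closure_minimal) auto
  show "0 \<in> closure I" using opidealD(2)[OF I] closure_subset by blast
  fix S assume "S \<in> closure I"
  then obtain s where s: "\<And>n. s n \<in> I" "s \<longlonglongrightarrow> S" unfolding closure_sequential by auto
  show "S + T \<in> closure I" if T: "T \<in> closure I" for T
  proof -
    obtain t where t: "\<And>n. t n \<in> I" "t \<longlonglongrightarrow> T" using T unfolding closure_sequential by auto
    have "(\<lambda>n. s n + t n) \<longlonglongrightarrow> S + T" using s t by (intro tendsto_intros)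
    then show ?thesis
      unfolding closure_sequential
      by (intro exI[of _ "\<lambda>n. s n + t n"]) (simp add: opidealD(3)[OF I s(1) t(1)])
  qed
  fix U assume U: "U \<in> operators"
  have "(\<lambda>n. U o\<^sub>L s n) \<longlonglongrightarrow> (U o\<^sub>L S)" "(\<lambda>n. s n o\<^sub>L U) \<longlonglongrightarrow> (S o\<^sub>L U)"
    using s by (auto intro!: bounded_bilinear.tendsto[OF bounded_bilinear_blinfun_compose])
  then show "U o\<^sub>L S \<in> closure I" "S o\<^sub>L U \<in> closure I"
    unfolding closure_sequential
    by (intro exI[of _ "\<lambda>n. U o\<^sub>L s n"] exI[of _ "\<lambda>n. s n o\<^sub>L U"];
        simp add: opidealD(4,5)[OF I s(1) U])+
qed

definition spatial :: "nat set \<Rightarrow> ('e \<Rightarrow>\<^sub>L 'e) set" where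
  "spatial M = closure (generated_ideal smul (proj M))"

lemma spatial_ideals_eq: "spatial_ideals smul \<iota> = {spatial M | M. M \<noteq> {} \<and> M \<subseteq> {1..}}"
  unfolding spatial_ideals_def spatial_def
  by (intro Collect_cong ex_cong1) (auto simp: basis_projection_eq_proj)

lemma spatial_opideal: "opideal (spatial M)"
  unfolding spatial_def by (intro opideal_closure opideal_generated proj_operator)

lemma closed_spatial: "closed (spatial M)"
  by (simp add: spatial_def)

lemma proj_in_spatial: "proj M \<in> spatial M"
  unfolding spatial_def using generated_ideal_self closure_subset by blast

lemma spatial_least:
  assumes "opideal I" "closed I" "proj M \<in> I"
  shows "spatial M \<subseteq> I"
  unfolding spatial_def using assms by (intro closure_minimal generated_ideal_least)

lemma spatial_subset_iff: "spatial M \<subseteq> spatial N \<longleftrightarrow> proj M \<in> spatial N"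
  using proj_in_spatial spatial_least[OF spatial_opideal closed_spatial] by blast

lemma matrix_unit: "\<exists>T\<in>operators. \<forall>v. T v = smul (coord m v) w"
proof -
  have "bounded_linear (\<lambda>v. smul (coord m v) w)"
    using bounded_linear_compose[OF smul_bounded_linear(2) blinfun.bounded_linear_right] .
  then show ?thesis
    by (intro bexI[of _ "Blinfun (\<lambda>v. smul (coord m v) w)"])
      (auto simp: operators_iff bounded_linear_Blinfun_apply coord_smul)
qed

lemma proj_empty: "proj {} = 0"
  by (rule operator_eqI) (simp_all add: proj_operator operator_zero proj_e)

text \<open>
  The projections onto single coordinates factor through each other, by matrix units.
\<close>

lemma proj_finite_in_opideal:
  assumes I: "opideal I" "proj N \<in> I" "m \<in> N" "1 \<le> m" and F: "finite F" "F \<subseteq> {1..}"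
  shows "proj F \<in> I"
  using F
proof (induction F rule: finite_induct)
  case empty
  then show ?case using opidealD(2)[OF I(1)] by (simp add: proj_empty)
next
  case (insert n F)
  obtain U where U: "U \<in> operators" "\<And>v. U v = smul (coord n v) (e m)" using matrix_unit by blast
  obtain V where V: "V \<in> operators" "\<And>v. V v = smul (coord m v) (e n)" using matrix_unit by blast
  have "proj {n} = V o\<^sub>L (proj N o\<^sub>L U)"
  proof (rule operator_eqI)
    fix k :: nat assume "1 \<le> k"
    then show "proj {n} (e k) = (V o\<^sub>L (proj N o\<^sub>L U)) (e k)"
      using assms insert.prems by (simp add: proj_e U V coord_e blinfun.zero_right coord_smul coord_proj)
  qed (simp_all add: proj_operator U V operator_compose)
  also have "\<dots> \<in> I" using opidealD(4,5)[OF I(1)] I(2) U V by blast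
  finally have "proj {n} \<in> I" .
  moreover have "proj (insert n F) = proj {n} + proj F"
    using proj_Un[of "{n}" F] insert.hyps by simp
  ultimately show ?case using insert opidealD(3)[OF I(1)] by simp
qed

lemma proj_in_opideal_mod_finite:
  assumes I: "opideal I" "proj N \<in> I" and N: "N \<noteq> {}" "N \<subseteq> {1..}"
    and M: "M \<subseteq> {1..}" "finite (M - N)"
  shows "proj M \<in> I"
proof -
  obtain m where m: "m \<in> N" "1 \<le> m" using N by auto
  have "proj (M - N) \<in> I" using proj_finite_in_opideal[OF I m M(2)] M by auto
  moreover have "proj (M \<inter> N) \<in> I"
    using opidealD(4)[OF I(1,2) proj_operator[of M]] by (simp add: proj_compose)
  moreover have "proj M = proj (M \<inter> N) + proj (M - N)"
    using proj_Un[of "M \<inter> N" "M - N"] by (simp add: Int_Diff_Un Int_Diff_disjoint)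
  ultimately show ?thesis using opidealD(3)[OF I(1)] by simp
qed

lemma spatial_mono_mod_finite:
  assumes "N \<noteq> {}" "N \<subseteq> {1..}" "M \<subseteq> {1..}" "finite (M - N)"
  shows "spatial M \<subseteq> spatial N"
  unfolding spatial_subset_iff
  using proj_in_opideal_mod_finite[OF spatial_opideal proj_in_spatial assms] .

lemma spatial_UNIV: "spatial {1..} = operators"
proof
  show "spatial {1..} \<subseteq> operators" using opidealD(1)[OF spatial_opideal] by blast
  show "operators \<subseteq> spatial {1..}"
  proof
    fix T assume "T \<in> operators"
    then have "T o\<^sub>L proj {1..} \<in> spatial {1..}"
      using opidealD(4)[OF spatial_opideal proj_in_spatial] by blast
    moreover have "T o\<^sub>L proj {1..} = T" unfolding proj_UNIV by (rule blinfun_eqI) simp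
    ultimately show "T \<in> spatial {1..}" by simp
  qed
qed


subsection \<open>Compact operators\<close>

lemma proj_uniform_approx:
  assumes "finite Y" "0 < \<epsilon>"
  shows "\<exists>B. finite B \<and> B \<subseteq> {1..} \<and> (\<forall>y\<in>Y. norm (y - proj B y) < \<epsilon>)"
proof -
  have "\<exists>A. finite A \<and> A \<subseteq> {1..} \<and> (\<forall>B. A \<subseteq> B \<longrightarrow> norm (y - proj B y) < \<epsilon>)" for y
    using proj_approx[OF assms(2)] .
  then obtain A where A: "\<And>y. finite (A y)" "\<And>y. A y \<subseteq> {1..}" "\<And>y B. A y \<subseteq> B \<Longrightarrow> norm (y - proj B y) < \<epsilon>"
    by metis
  then show ?thesis
    using assms(1) by (intro exI[of _ "\<Union>(A ` Y)"] conjI ballI A(3)) auto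
qed

lemma norm_blinfun_le_on_ball:
  assumes "0 \<le> b" "\<And>x. norm x \<le> 1 \<Longrightarrow> norm (blinfun_apply T x) \<le> b"
  shows "norm T \<le> b"
proof (rule norm_blinfun_bound[OF assms(1)])
  fix x
  show "norm (T x) \<le> b * norm x"
  proof (cases "x = 0")
    case False
    then have "norm (T (inverse (norm x) *\<^sub>R x)) \<le> b" by (intro assms) simp
    then show ?thesis using False by (simp add: blinfun.scaleR_right field_simps)
  qed (simp add: blinfun.zero_right)
qed

text \<open>
  On a compact set the projections onto finite sets converge uniformly, so a compact operator is a limit of
  operators with values in the span of finitely many basis vectors.
\<close>

lemma compact_subset_spatial:
  assumes "M \<noteq> {}" "M \<subseteq> {1..}"
  shows "compact_operators smul \<subseteq> spatial M"
proof
  fix T assume "T \<in> compact_operators smul"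
  then have T: "T \<in> operators" and cpt: "compact (closure (T ` cball 0 1))"
    by (auto simp: compact_operators_def)
  have "T \<in> closure (spatial M)"
    unfolding closure_approachable
  proof (intro allI impI)
    fix \<epsilon> :: real assume \<epsilon>: "0 < \<epsilon>"
    then have "0 < \<epsilon> / 4" by simp
    then obtain Y where Y: "finite Y" "closure (T ` cball 0 1) \<subseteq> (\<Union>y\<in>Y. ball y (\<epsilon> / 4))"
      using cpt unfolding compact_eq_totally_bounded by blast
    obtain B where B: "finite B" "B \<subseteq> {1..}" "\<And>y. y \<in> Y \<Longrightarrow> norm (y - proj B y) < \<epsilon> / 4"
      using proj_uniform_approx[OF Y(1) \<open>0 < \<epsilon> / 4\<close>] by blast
    have "norm ((proj B o\<^sub>L T) - T) \<le> 3 * (\<epsilon> / 4)"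
    proof (rule norm_blinfun_le_on_ball)
      fix x :: 'e assume "norm x \<le> 1"
      then have "T x \<in> closure (T ` cball 0 1)" using closure_subset by fastforce
      then obtain y where y: "y \<in> Y" "norm (y - T x) < \<epsilon> / 4"
        using Y(2) by (auto simp: dist_norm)
      have "((proj B o\<^sub>L T) - T) x = - proj B (y - T x) - (y - proj B y) + (y - T x)"
        by (simp add: blinfun.diff_left blinfun.diff_right)
      also have "norm \<dots> \<le> norm (proj B (y - T x)) + norm (y - proj B y) + norm (y - T x)"
        by (smt (verit) norm_minus_cancel norm_triangle_ineq norm_triangle_ineq4)
      also have "\<dots> \<le> 3 * (\<epsilon> / 4)" using y B(3)[OF y(1)] norm_proj_le[of B "y - T x"] by linarith
      finally show "norm (((proj B o\<^sub>L T) - T) x) \<le> 3 * (\<epsilon> / 4)" .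
    qed (use \<epsilon> in simp)
    then have "dist (proj B o\<^sub>L T) T < \<epsilon>" using \<epsilon> by (simp add: dist_norm)
    moreover have "proj B \<in> spatial M"
      using proj_in_opideal_mod_finite[OF spatial_opideal proj_in_spatial assms B(2)] B(1) by simp
    then have "proj B o\<^sub>L T \<in> spatial M" using opidealD(5)[OF spatial_opideal] T by blast
    ultimately show "\<exists>S\<in>spatial M. dist S T < \<epsilon>" by blast
  qed
  then show "T \<in> spatial M" using closed_spatial by simp
qed

lemma spatial_singleton_relatively_compact:
  assumes "A \<in> generated_ideal smul (proj {1})"
  shows "\<exists>C. compact C \<and> A ` cball 0 1 \<subseteq> C"
  using assms
proof (induction rule: generated_ideal_induct)
  case (compose U V)
  define C where "C = (\<lambda>a. smul a (e 1)) ` cball 0 (norm V)"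
  have "compact C" unfolding C_def
    by (intro compact_continuous_image bounded_linear.continuous_on[OF smul_bounded_linear(2)] continuous_intros) simp
  then have "compact (U ` C)" by (intro compact_continuous_image continuous_intros)
  moreover have "(U o\<^sub>L proj {1} o\<^sub>L V) ` cball 0 1 \<subseteq> U ` C"
  proof
    fix w assume "w \<in> (U o\<^sub>L proj {1} o\<^sub>L V) ` cball 0 1"
    then obtain v where v: "norm v \<le> 1" "w = U (proj {1} (V v))" by auto
    have "norm (coord 1 (V v)) \<le> norm (V v)" by (rule norm_coord_le)
    also have "\<dots> \<le> norm V * norm v" by (rule norm_blinfun)
    also have "\<dots> \<le> norm V" using v by (simp add: mult_left_le)
    finally have "coord 1 (V v) \<in> cball 0 (norm V)" by simp
    moreover have "proj {1} (V v) = smul (coord 1 (V v)) (e 1)"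
      using \<iota>_finite[of "{1}" "\<lambda>n. if n \<in> {1} then coord n (V v) else 0"] by (simp add: proj_finite)
    ultimately show "w \<in> U ` C" unfolding v(2) C_def by blast
  qed
  ultimately show ?case by blast
next
  case (add A B)
  then obtain C D where C: "compact C" "A ` cball 0 1 \<subseteq> C" and D: "compact D" "B ` cball 0 1 \<subseteq> D" by blast
  have "(A + B) ` cball 0 1 \<subseteq> {x + y |x y. x \<in> C \<and> y \<in> D}"
  proof (rule image_subsetI)
    fix x :: 'e assume "x \<in> cball 0 1"
    then have "A x \<in> C" "B x \<in> D" using C(2) D(2) by blast+
    then show "(A + B) x \<in> {x + y |x y. x \<in> C \<and> y \<in> D}" by (auto simp: blinfun.add_left)
  qed
  then show ?case using compact_sums[OF C(1) D(1)] by blast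
qed

text \<open>
  Operators that factor through a one-dimensional projection, and their sums, map the unit ball into a compact set, and total
  boundedness of the image of the unit ball passes to limits in norm.
\<close>

lemma spatial_singleton: "spatial {1} = compact_operators smul"
proof
  show "compact_operators smul \<subseteq> spatial {1}" by (rule compact_subset_spatial) auto
  show "spatial {1} \<subseteq> compact_operators smul"
  proof
    fix T assume T: "T \<in> spatial {1}"
    have "compact (closure (T ` cball 0 1))"
      unfolding compact_eq_totally_bounded
    proof (intro conjI allI impI)
      show "complete (closure (T ` cball 0 1))" by (simp add: complete_eq_closed)
      fix \<epsilon> :: real assume \<epsilon>: "0 < \<epsilon>"
      then obtain A where A: "A \<in> generated_ideal smul (proj {1})" "dist A T < \<epsilon> / 4"
        using T unfolding spatial_def closure_approachable by (meson divide_pos_pos zero_less_numeral)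
      obtain C where C: "compact C" "A ` cball 0 1 \<subseteq> C"
        using spatial_singleton_relatively_compact[OF A(1)] by blast
      obtain Y where Y: "finite Y" "C \<subseteq> (\<Union>y\<in>Y. ball y (\<epsilon> / 4))"
        using C(1) \<epsilon> unfolding compact_eq_totally_bounded by (meson divide_pos_pos zero_less_numeral)
      have "T ` cball 0 1 \<subseteq> (\<Union>y\<in>Y. cball y (\<epsilon> / 2))"
      proof
        fix w assume "w \<in> T ` cball 0 1"
        then obtain v where v: "norm v \<le> 1" "w = T v" by auto
        have "A v \<in> C" using C(2) v by auto
        then obtain y where y: "y \<in> Y" "dist y (A v) < \<epsilon> / 4" using Y(2) by auto
        have "dist (A v) (T v) \<le> norm (A - T) * norm v"
          using norm_blinfun[of "A - T" v] by (simp add: dist_norm blinfun.diff_left)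
        also have "\<dots> \<le> norm (A - T)" using v by (simp add: mult_left_le)
        finally have "dist y (T v) \<le> \<epsilon> / 2"
          using y A(2) dist_triangle[of y "T v" "A v"] by (simp add: dist_norm)
        then show "w \<in> (\<Union>y\<in>Y. cball y (\<epsilon> / 2))" using y v by auto
      qed
      moreover have "closed (\<Union>y\<in>Y. cball y (\<epsilon> / 2))" using Y(1) by (intro closed_UN) auto
      ultimately have "closure (T ` cball 0 1) \<subseteq> (\<Union>y\<in>Y. cball y (\<epsilon> / 2))"
        by (rule closure_minimal)
      also have "\<dots> \<subseteq> (\<Union>y\<in>Y. ball y \<epsilon>)" using \<epsilon> by fastforce
      finally show "\<exists>k. finite k \<and> closure (T ` cball 0 1) \<subseteq> (\<Union>x\<in>k. ball x \<epsilon>)" using Y(1) by blast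
    qed
    then show "T \<in> compact_operators smul"
      using opidealD(1)[OF spatial_opideal T] by (simp add: compact_operators_def)
  qed
qed

end


section \<open>When a projection is not in a spatial ideal\<close>

text \<open>
  Far out, \<open>N\<close> contains high stacks whose union \<open>W\<close> is large in comparison with \<open>M\<close>: there are at
  most \<open>c * Min W\<close> elements of \<open>M\<close> below \<open>card W\<close>. So a map from \<open>W\<close> to \<open>M\<close> with bounded
  fibres takes values below \<open>card W\<close> only at boundedly many times \<open>Min W\<close> points, and its other values form a Schreier set.
\<close>

definition gap :: "nat \<Rightarrow> nat set \<Rightarrow> nat set \<Rightarrow> bool" where
  "gap c M N \<longleftrightarrow> (\<forall>b t. \<exists>G. stack t G \<and> (\<forall>i<t. G i \<subseteq> N \<inter> {b<..}) \<and>
     (\<forall>a\<in>(\<Union>i<t. G i). card {m \<in> M. m < card (\<Union>i<t. G i)} \<le> c * a))"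

lemma ex_common_bound:
  fixes P :: "'a \<Rightarrow> nat \<Rightarrow> bool"
  assumes "finite J" "\<And>j. j \<in> J \<Longrightarrow> \<exists>b. \<forall>n>b. P j n"
  shows "\<exists>b. \<forall>n>b. \<forall>j\<in>J. P j n"
  using assms
proof (induction J rule: finite_induct)
  case (insert j J)
  then obtain b b' where "\<forall>n>b. \<forall>j\<in>J. P j n" "\<forall>n>b'. P j n" by (metis insertCI)
  then show ?case by (intro exI[of _ "max b b'"]) auto
qed simp

context schreier_space
begin

lemma norm_stack_vector_le_1:
  assumes G: "stack t G"
  shows "norm (stack_vector t G n) \<le> 1"
proof (cases "n \<in> (\<Union>i<t. G i)")
  case True
  then obtain i where i: "i < t" "n \<in> G i" by auto
  have "norm (stack_vector t G n) = real (card (G i)) powr (- 1 / r)"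
    using stack_vector_in(1)[OF G i] by simp
  also have "\<dots> \<le> 1"
    using stackD(2)[OF G i(1)] r by (simp add: powr_minus_divide ge_one_powr_ge_zero divide_le_eq)
  finally show ?thesis .
qed (simp add: stack_vector_notin)

lemma finite_stack: "stack t G \<Longrightarrow> finite (\<Union>i<t. G i)"
  using stackD(1) by auto

lemma stack_pos: "stack t G \<Longrightarrow> (\<Union>i<t. G i) \<subseteq> {1..}"
  using stack_schreier by auto

text \<open>
  Functionals tend to zero along the basis: otherwise a functional would be at least \<open>\<epsilon> * t\<close> on
  the vector of a stack of height \<open>t\<close>, with suitable phases of the coordinates, and the norm of this vector is of smaller order.
\<close>

lemma functional_unit_vectors_tendsto_0:
  fixes f :: "'e \<Rightarrow>\<^sub>L 'k"
  assumes lin: "\<And>a v. f (smul a v) = a * f v" and \<epsilon>: "0 < \<epsilon>"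
  shows "\<exists>b. \<forall>n>b. norm (f (e n)) < \<epsilon>"
proof (rule ccontr)
  assume "\<not> ?thesis"
  then have "\<forall>b. \<exists>n>b. n \<in> {n. 1 \<le> n \<and> \<epsilon> \<le> norm (f (e n))}"
    by (auto simp: not_less) (metis Suc_leI le_less_trans less_nat_zero_code neq0_conv not_less)
  then have inf: "infinite {n. 1 \<le> n \<and> \<epsilon> \<le> norm (f (e n))}"
    unfolding infinite_nat_iff_unbounded .
  obtain G where G: "\<And>t. stack t G" "\<And>i. G i \<subseteq> {n. 1 \<le> n \<and> \<epsilon> \<le> norm (f (e n))}"
    using infinite_stack[OF inf, of 0] by blast
  have "\<epsilon> * real t \<le> norm f * (1 + block_const 1 * growth t)" for t
  proof -
    define W where "W = (\<Union>i<t. G i)"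
    have W: "finite W" "W \<subseteq> {1..}" using finite_stack[OF G(1)] stack_pos[OF G(1)] unfolding W_def by auto
    define \<theta> where "\<theta> n = (if f (e n) = 0 then 1 else of_real (norm (f (e n))) / f (e n))" for n
    define x where "x n = \<theta> n * stack_vector t G n" for n
    have th: "norm (\<theta> n) = 1" "\<theta> n * f (e n) = of_real (norm (f (e n)))" for n
      by (auto simp: \<theta>_def norm_divide)
    have x: "x \<in> c00" "norm (\<iota> x) \<le> norm (\<iota> (stack_vector t G))"
      by (rule norm_\<iota>_mono[OF stack_vector_norm(1)[OF G(1), of t]], simp add: x_def norm_mult th)+
    have sv: "stack_vector t G n = of_real (norm (stack_vector t G n))" if n: "n \<in> W" for n
    proof -
      obtain i where "i < t" "n \<in> G i" using n unfolding W_def by auto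
      then show ?thesis by (simp add: stack_vector_in(1)[OF G(1)])
    qed
    have xn: "x n * f (e n) = of_real (norm (stack_vector t G n) * norm (f (e n)))" if "n \<in> W" for n
    proof -
      have "x n * f (e n) = stack_vector t G n * (\<theta> n * f (e n))" by (simp add: x_def mult_ac)
      then show ?thesis unfolding th using sv[OF that] by simp
    qed
    have "f (\<iota> x) = (\<Sum>n\<in>W. x n * f (e n))"
      by (subst \<iota>_finite[OF W]) (auto simp: x_def W_def stack_vector_notin blinfun.sum_right lin)
    also have "\<dots> = of_real (\<Sum>n\<in>W. norm (stack_vector t G n) * norm (f (e n)))"
      using xn by simp
    finally have "norm (f (\<iota> x)) = \<bar>\<Sum>n\<in>W. norm (stack_vector t G n) * norm (f (e n))\<bar>"
      by (simp only: norm_of_real)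
    also have "\<dots> = (\<Sum>n\<in>W. norm (stack_vector t G n) * norm (f (e n)))"
      by (intro abs_of_nonneg sum_nonneg) simp
    also have "\<dots> \<ge> (\<Sum>n\<in>W. norm (stack_vector t G n) powr r * \<epsilon>)"
    proof (intro sum_mono mult_mono)
      fix n assume "n \<in> W"
      then show "\<epsilon> \<le> norm (f (e n))" using G(2) unfolding W_def by auto
      show "norm (stack_vector t G n) powr r \<le> norm (stack_vector t G n)"
        using powr_mono'[of 1 r "norm (stack_vector t G n)"] norm_stack_vector_le_1[OF G(1)] r by simp
    qed (use \<epsilon> in auto)
    finally have "real t * \<epsilon> \<le> norm (f (\<iota> x))"
      using stack_vector_mass[OF G(1), of t] unfolding W_def by (simp add: sum_distrib_right[symmetric])
    also have "\<dots> \<le> norm f * norm (\<iota> x)" by (rule norm_blinfun)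
    also have "\<dots> \<le> norm f * (1 + block_const 1 * growth t)"
    proof (rule mult_left_mono)
      have "norm (\<iota> (stack_vector t G)) \<le> 1 + norm (\<iota> (stack_vector t G)) powr r"
        using powr_mono[of 1 r "norm (\<iota> (stack_vector t G))"] r
        by (cases "norm (\<iota> (stack_vector t G)) \<le> 1") (auto intro: add_increasing2)
      then show "norm (\<iota> x) \<le> 1 + block_const 1 * growth t"
        using x(2) stack_vector_norm(2)[OF G(1), of t] by linarith
    qed simp
    finally show ?thesis by (simp add: mult.commute)
  qed
  moreover obtain t where "norm f / \<epsilon> + (norm f * block_const 1 / \<epsilon>) * growth t < real t"
    using growth_sublinear by blast
  then have "norm f * (1 + block_const 1 * growth t) < \<epsilon> * real t"
    using \<epsilon> by (simp add: field_simps)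
  ultimately show False by (meson not_less)
qed

text \<open>
  At least half of the indices of large coordinates form a Schreier set, on which the norm controls the \<open>r\<close>-th powers.
\<close>

lemma large_coordinates:
  assumes \<delta>: "0 < \<delta>"
  shows "finite {n. \<delta> \<le> norm (coord n v)}" "real (card {n. \<delta> \<le> norm (coord n v)}) \<le> 2 * (norm v / \<delta>) powr r"
proof -
  have pos: "1 \<le> n" if "\<delta> \<le> norm (coord n v)" for n
    using that \<delta> coord_0[of v] by (cases "n = 0") auto
  have bd: "real (card H) \<le> 2 * (norm v / \<delta>) powr r" if H: "finite H" "H \<subseteq> {n. \<delta> \<le> norm (coord n v)}" for H
  proof -
    obtain F where F: "F \<subseteq> H" "F \<in> schreier_sets" "card H \<le> 2 * card F"
      using exists_schreier_half[OF H(1)] H(2) pos by (metis atLeast_iff mem_Collect_eq subset_iff)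
    have "real (card F) * \<delta> powr r = (\<Sum>n\<in>F. \<delta> powr r)" by simp
    also have "\<dots> \<le> (\<Sum>n\<in>F. norm (coord n v) powr r)"
      using F(1) H(2) \<delta> r by (intro sum_mono powr_mono2) auto
    also have "\<dots> \<le> norm v powr r" by (rule schreier_coord_le_norm[OF F(2)])
    finally have "real (card F) \<le> (norm v / \<delta>) powr r"
      using \<delta> by (simp add: powr_divide field_simps)
    then show ?thesis using F(3) by linarith
  qed
  show fin: "finite {n. \<delta> \<le> norm (coord n v)}"
  proof (rule ccontr)
    obtain k :: nat where k: "2 * (norm v / \<delta>) powr r < real k" using reals_Archimedean2 by blast
    assume "\<not> ?thesis"
    then obtain H where "finite H" "card H = k" "H \<subseteq> {n. \<delta> \<le> norm (coord n v)}"
      using infinite_arbitrarily_large by blast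
    then show False using bd[of H] k by simp
  qed
  show "real (card {n. \<delta> \<le> norm (coord n v)}) \<le> 2 * (norm v / \<delta>) powr r"
    using bd[OF fin] by simp
qed

lemma norm_operator_e: "1 \<le> n \<Longrightarrow> norm (blinfun_apply V (e n)) \<le> norm V"
  using norm_blinfun[of V "e n"] norm_e[of n] mult_left_mono[of "norm (e n)" 1 "norm V"] by simp

text \<open>
  Bounded vectors with small coordinates cannot be mapped back to the basis. Along a sequence
  of bad indices one could choose the vectors as blocks spreading out so quickly that a sum of \<open>q\<close> of them
  has norm of the order of \<open>growth q\<close>. But by a choice of signs its image has \<open>q\<close> coordinates of modulus at
  least \<open>c / 2\<close> on average, and these may be taken in a Schreier set.
\<close>

lemma small_coordinates_not_mapped_to_basis:
  assumes w: "\<And>n. w n \<in> c00" "\<And>n. norm (\<iota> (w n)) \<le> B"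
    and null: "\<And>m \<epsilon>. 0 < \<epsilon> \<Longrightarrow> \<exists>b. \<forall>n>b. norm (w n m) < \<epsilon>" and c: "0 < c"
  shows "\<exists>\<delta>>0. \<exists>b. \<forall>n>b. norm (coord n (blinfun_apply U (\<iota> (restr {m. norm (w n m) < \<delta>} (w n))))) < c"
proof (rule ccontr)
  assume "\<not> ?thesis"
  then have bad: "\<exists>n>b. c \<le> norm (coord n (U (\<iota> (restr {m. norm (w n m) < \<delta>} (w n)))))" if "0 < \<delta>" for \<delta> b
    using that by (meson not_less)
  define K where "K = norm U powr r * block_const B"
  obtain q where q: "0 + K / (c / 2) powr r * growth q < real q"
    using growth_sublinear[of 0 "K / (c / 2) powr r"] by blast
  define good where "good n y h n' y' h' \<longleftrightarrow> (n::nat) < n' \<and> (h::nat) \<le> h' \<and> y' \<in> c00 \<and> norm (\<iota> y') \<le> B \<and>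
     (\<forall>m. y' m \<noteq> 0 \<longrightarrow> h < m \<and> m \<le> h') \<and> (\<forall>m. norm (y' m) powr r * (real h * 2 ^ q) \<le> 2) \<and>
     c / 2 \<le> norm (coord n' (U (\<iota> y')))" for n and y :: "nat \<Rightarrow> 'k" and h n' y' h'
  have step: "\<exists>n' y' h'. good n y h n' y' h'" for n y h
  proof -
    \<comment> \<open>the bound on the coordinates makes the next block decay as \<open>block_sum\<close> requires for up to \<open>q\<close> blocks\<close>
    define \<delta> :: real where "\<delta> = 1 / (real h * 2 ^ q + 1)"
    have "0 < real h * 2 ^ q + 1" by (intro add_nonneg_pos) auto
    then have \<delta>: "0 < \<delta>" "\<delta> \<le> 1" "\<delta> * (real h * 2 ^ q) \<le> 1"
      unfolding \<delta>_def by (auto simp: divide_le_eq)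
    \<comment> \<open>the first \<open>h\<close> coordinates, met by the earlier blocks, are removed; they contribute at most \<open>c / 2\<close> if less than \<open>\<eta>\<close>\<close>
    define \<eta> where "\<eta> = c / (2 * (norm U + 1) * (real h + 1))"
    have \<eta>: "0 < \<eta>" unfolding \<eta>_def using c by (simp add: add_nonneg_pos)
    obtain b where b: "\<And>n m. b < n \<Longrightarrow> m \<in> {1..h} \<Longrightarrow> norm (w n m) < \<eta>"
      using ex_common_bound[of "{1..h}" "\<lambda>m n. norm (w n m) < \<eta>"] null[OF \<eta>] by (metis finite_atLeastAtMost)
    obtain n' where n': "max n b < n'" "c \<le> norm (coord n' (U (\<iota> (restr {m. norm (w n' m) < \<delta>} (w n')))))"
      using bad[OF \<delta>(1)] by blast
    let ?D = "{m. norm (w n' m) < \<delta>}"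
    define y' where "y' = restr (?D \<inter> {h<..}) (w n')"
    define z where "z = restr (?D \<inter> {..h}) (w n')"
    have yz: "y' \<in> c00" "z \<in> c00" "norm (\<iota> y') \<le> norm (\<iota> (w n'))"
      unfolding y'_def z_def using restr_norm[OF w(1)] by auto
    have "restr ?D (w n') = (\<lambda>m. y' m + z m)"
      by (auto simp: restr_def y'_def z_def fun_eq_iff)
    then have split: "coord n' (U (\<iota> (restr ?D (w n')))) = coord n' (U (\<iota> y')) + coord n' (U (\<iota> z))"
      using \<iota>_add[OF yz(1,2)] by (simp add: blinfun.add_right)
    have "norm (\<iota> z) \<le> real h * \<eta>"
    proof -
      have "z 0 = 0" using yz(2) by (simp add: c00_def)
      then have "\<iota> z = (\<Sum>m\<in>{1..h}. smul (z m) (e m))"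
        by (intro \<iota>_finite) (auto simp: z_def restr_def Suc_le_eq)
      also have "norm \<dots> \<le> (\<Sum>m\<in>{1..h}. norm (smul (z m) (e m)))" by (rule norm_sum)
      also have "\<dots> \<le> (\<Sum>m\<in>{1..h}. \<eta>)"
      proof (rule sum_mono)
        fix m assume m: "m \<in> {1..h}"
        have "norm (smul (z m) (e m)) \<le> norm (z m) * 1"
          unfolding norm_scale using norm_e m by (intro mult_left_mono) auto
        also have "\<dots> \<le> \<eta>" using b[of n' m] m n'(1) \<eta> by (auto simp: z_def restr_def)
        finally show "norm (smul (z m) (e m)) \<le> \<eta>" .
      qed
      finally show ?thesis by simp
    qed
    also have "\<dots> \<le> (real h + 1) * \<eta>" using \<eta> by simp
    finally have "norm U * norm (\<iota> z) \<le> (norm U + 1) * ((real h + 1) * \<eta>)"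
      using \<eta> by (intro mult_mono) auto
    moreover have "norm (coord n' (U (\<iota> z))) \<le> norm U * norm (\<iota> z)"
      using norm_coord_le norm_blinfun by (rule order_trans)
    moreover have "(norm U + 1) * ((real h + 1) * \<eta>) = c / 2"
      unfolding \<eta>_def using add_nonneg_pos[of "norm U" 1] by (simp add: divide_simps)
    ultimately have low: "norm (coord n' (U (\<iota> z))) \<le> c / 2" by linarith
    have hi: "c / 2 \<le> norm (coord n' (U (\<iota> y')))"
      using n'(2) low norm_triangle_ineq[of "coord n' (U (\<iota> y'))" "coord n' (U (\<iota> z))"] unfolding split by linarith
    have dec: "norm (y' m) powr r * (real h * 2 ^ q) \<le> 2" for m
    proof -
      have "norm (y' m) \<le> \<delta>" using \<delta> by (auto simp: y'_def restr_def)
      then have "norm (y' m) powr r \<le> \<delta> powr r" using r by (intro powr_mono2) auto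
      also have "\<dots> \<le> \<delta>" using powr_mono'[of 1 r \<delta>] \<delta> r by simp
      finally have "norm (y' m) powr r * (real h * 2 ^ q) \<le> \<delta> * (real h * 2 ^ q)" by (intro mult_right_mono) auto
      then show ?thesis using \<delta> by linarith
    qed
    have "finite {m. y' m \<noteq> 0}" using yz(1) by (simp add: c00_def)
    then obtain h0 where h0: "\<And>m. y' m \<noteq> 0 \<Longrightarrow> m \<le> h0" by (meson finite_nat_set_iff_bounded_le mem_Collect_eq)
    have "good n y h n' y' (max h h0)"
      unfolding good_def using n'(1) yz w(2)[of n'] hi dec h0
      by (auto simp: y'_def restr_def le_max_iff_disj split: if_splits)
    then show ?thesis by blast
  qed
  define Q where "Q p p' \<longleftrightarrow> good (fst p) (fst (snd p)) (snd (snd p)) (fst p') (fst (snd p')) (snd (snd p'))" for p p'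
  have "\<exists>g. \<forall>i. (i = 0 \<longrightarrow> g i = (q, \<lambda>_. 0, 0)) \<and> Q (g i) (g (Suc i))"
  proof (rule dependent_nat_choice)
    show "\<exists>p. 0 = (0::nat) \<longrightarrow> p = (q, \<lambda>_. 0, 0)" by blast
    fix p :: "nat \<times> (nat \<Rightarrow> 'k) \<times> nat" and i :: nat
    obtain n' y' h' where "good (fst p) (fst (snd p)) (snd (snd p)) n' y' h'" using step by blast
    then show "\<exists>p'. (Suc i = 0 \<longrightarrow> p' = (q, \<lambda>_. 0, 0)) \<and> Q p p'"
      unfolding Q_def by (intro exI[of _ "(n', y', h')"]) simp
  qed
  then obtain g where g: "g 0 = (q, \<lambda>_. 0, 0)" "\<And>i. Q (g i) (g (Suc i))" by blast
  define n where "n i = fst (g i)" for i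
  define y where "y i = fst (snd (g i))" for i
  define h where "h i = snd (snd (g i))" for i
  have good: "good (n i) (y i) (h i) (n (Suc i)) (y (Suc i)) (h (Suc i))" for i
    using g(2)[of i] unfolding n_def y_def h_def Q_def .
  have n0: "n 0 = q" using g(1) by (simp add: n_def)
  have n_mono: "strict_mono n" using good unfolding strict_mono_Suc_iff good_def by blast
  have h_mono: "mono h" using good unfolding mono_iff_le_Suc good_def by blast
  have supp: "h i < m \<and> m \<le> h (Suc i)" if "y (Suc i) m \<noteq> 0" for i m
    using good[of i] that unfolding good_def by blast
  have yc: "y (Suc i) \<in> c00" "norm (\<iota> (y (Suc i))) \<le> B" "c / 2 \<le> norm (coord (n (Suc i)) (U (\<iota> (y (Suc i)))))" for i
    using good[of i] unfolding good_def by blast+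
  define t where "t i j = coord (n (Suc i)) (U (\<iota> (y (Suc j))))" for i j
  obtain \<epsilon> :: "nat \<Rightarrow> real" where \<epsilon>: "\<And>j. \<bar>\<epsilon> j\<bar> = 1"
    "(\<Sum>i\<in>{..<q}. norm (t i i) powr r) \<le> (\<Sum>i\<in>{..<q}. norm (\<Sum>j\<in>{..<q}. \<epsilon> j *\<^sub>R t i j) powr r)"
    using exists_signs[of "{..<q}" "{..<q}" "\<lambda>i. i" r t] r by auto
  define x where "x j m = of_real (\<epsilon> j) * y (Suc j) m" for j m
  have x: "x j \<in> c00" "norm (\<iota> (x j)) \<le> B" for j
  proof -
    have "norm (x j m) \<le> norm (y (Suc j) m)" for m by (simp add: x_def norm_mult \<epsilon>)
    then show "x j \<in> c00" "norm (\<iota> (x j)) \<le> B"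
      using norm_\<iota>_mono[OF yc(1), of "x j" j] yc(2)[of j] by auto
  qed
  have xs: "h j < m \<and> m \<le> h (Suc j)" if "x j m \<noteq> 0" for j m
  proof (rule supp)
    show "y (Suc j) m \<noteq> 0" using that unfolding x_def by auto
  qed
  define v where "v = \<iota> (\<lambda>m. \<Sum>j<q. x j m)"
  have "norm v powr r \<le> block_const B * growth q"
    unfolding v_def
  proof (rule block_sum_growth)
    fix i j a m assume ij: "i < j" "j < q" and a: "x i a \<noteq> 0"
    have hij: "h (Suc i) \<le> h j" using monoD[OF h_mono, of "Suc i" j] ij by simp
    show "a < m" if "x j m \<noteq> 0" using xs[OF a] xs[OF that] hij by linarith
    have ah: "a \<le> h j" using xs[OF a] hij by linarith
    have p: "(2::real) ^ (j - i) \<le> 2 ^ q" using ij by (intro power_increasing) auto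
    have "norm (x j m) powr r * (real a * 2 ^ (j - i)) \<le> norm (y (Suc j) m) powr r * (real (h j) * 2 ^ q)"
      using ah p \<epsilon> by (intro mult_mono) (auto simp: x_def norm_mult)
    also have "\<dots> \<le> 2" using good[of j] unfolding good_def by blast
    finally show "norm (x j m) powr r * (real a * 2 ^ (j - i)) \<le> 2" .
  qed (use x in auto)
  then have "norm U powr r * norm v powr r \<le> K * growth q"
    unfolding K_def by (simp add: mult.assoc mult_left_mono)
  moreover have "real q * (c / 2) powr r \<le> norm U powr r * norm v powr r"
  proof -
    have tv: "(\<Sum>j\<in>{..<q}. \<epsilon> j *\<^sub>R t i j) = coord (n (Suc i)) (U v)" for i
    proof -
      have "v = (\<Sum>j<q. \<iota> (x j))" unfolding v_def using x by (intro \<iota>_sum) auto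
      also have "\<dots> = (\<Sum>j<q. \<epsilon> j *\<^sub>R \<iota> (y (Suc j)))"
        unfolding x_def by (intro sum.cong refl) (simp add: \<iota>_scale[OF yc(1)] scale_of_real)
      finally show ?thesis unfolding t_def by (simp add: blinfun.sum_right blinfun.scaleR_right)
    qed
    let ?F = "(\<lambda>i. n (Suc i)) ` {..<q}"
    have inj: "inj_on (\<lambda>i. n (Suc i)) {..<q}" using n_mono by (auto simp: inj_on_def strict_mono_eq)
    have "q < n (Suc i)" for i using n0 strict_monoD[OF n_mono, of 0 "Suc i"] by simp
    then have "q \<le> n (Suc i) \<and> 1 \<le> n (Suc i)" for i by (metis One_nat_def Suc_leI bot_nat_0.not_eq_extremum less_imp_le_nat not_less0)
    then have F: "?F \<in> schreier_sets"
      unfolding schreier_sets_iff card_image[OF inj] by auto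
    have "real q * (c / 2) powr r = (\<Sum>i<q. (c / 2) powr r)" by simp
    also have "\<dots> \<le> (\<Sum>i\<in>{..<q}. norm (t i i) powr r)"
      using c r yc(3) unfolding t_def by (intro sum_mono powr_mono2) auto
    also have "\<dots> \<le> (\<Sum>i\<in>{..<q}. norm (coord (n (Suc i)) (U v)) powr r)" using \<epsilon>(2) unfolding tv .
    also have "\<dots> = (\<Sum>k\<in>?F. norm (coord k (U v)) powr r)" using inj by (simp add: sum.reindex)
    also have "\<dots> \<le> norm (U v) powr r" by (rule schreier_coord_le_norm[OF F])
    also have "\<dots> \<le> (norm U * norm v) powr r" using r by (intro powr_mono2 norm_blinfun) auto
    finally show ?thesis by (simp add: powr_mult)
  qed
  ultimately have "real q * (c / 2) powr r \<le> K * growth q" by linarith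
  moreover have "0 < (c / 2) powr r" using c by simp
  ultimately have "real q \<le> K / (c / 2) powr r * growth q" by (simp add: field_simps)
  then show False using q by simp
qed

text \<open>
  Hence a diagonal coefficient that is bounded below is caused by one basis vector \<open>e m\<close> that both operators
  see with a coefficient bounded below: there are boundedly many large coordinates, and the
  small ones contribute little.
\<close>

lemma diagonal_through_single_coordinate:
  assumes U: "U \<in> operators" and V: "V \<in> operators" and M: "M \<subseteq> {1..}" and c: "0 < c"
  shows "\<exists>\<delta>>0. \<exists>b. \<forall>n>b. c \<le> norm (coord n (U (proj M (V (e n))))) \<longrightarrow>
    (\<exists>m\<in>M. \<delta> \<le> norm (coord m (V (e n))) \<and> \<delta> \<le> norm (coord n (U (e m))))"
proof -
  define \<eta> where "\<eta> = c / (2 * (norm U + 1))"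
  have \<eta>: "0 < \<eta>" "norm U * \<eta> \<le> c / 2"
    unfolding \<eta>_def using c add_nonneg_pos[of "norm U" 1] by (auto simp: divide_simps mult_less_0_iff)
  have "\<exists>A. finite A \<and> A \<subseteq> {1..} \<and> norm (proj M (V (e n)) - proj A (proj M (V (e n)))) < \<eta>" for n
    using proj_approx[OF \<eta>(1), of "proj M (V (e n))"] by blast
  then obtain A where A: "\<And>n. finite (A n)" "\<And>n. A n \<subseteq> {1..}"
    "\<And>n. norm (proj M (V (e n)) - proj (A n) (proj M (V (e n)))) < \<eta>" by metis
  define w where "w n m = (if m \<in> A n \<inter> M \<and> 1 \<le> n then coord m (V (e n)) else 0)" for n m
  have fin: "finite (A n \<inter> M)" "A n \<inter> M \<subseteq> {1..}" for n using A M by auto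
  have w_c00: "w n \<in> c00" for n
    by (rule c00_finite[OF fin[of n]]) (auto simp: w_def)
  have w_eq: "\<iota> (w n) = proj (A n) (proj M (V (e n)))" if "1 \<le> n" for n
  proof -
    have "proj (A n) (proj M (V (e n))) = proj (A n \<inter> M) (V (e n))"
      using proj_compose[of "A n" M] by (metis blinfun_apply_blinfun_compose)
    also have "\<dots> = \<iota> (w n)"
      unfolding proj_finite[OF fin] w_def using that by (intro arg_cong[where f = \<iota>]) auto
    finally show ?thesis ..
  qed
  have w_norm: "norm (\<iota> (w n)) \<le> norm V" for n
  proof (cases "1 \<le> n")
    case True
    have "norm (\<iota> (w n)) \<le> norm (V (e n))"
      unfolding w_eq[OF True] by (meson norm_proj_le order_trans)
    then show ?thesis using norm_operator_e[OF True, of V] by simp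
  next
    case False
    then have "w n = (\<lambda>_. 0)" by (auto simp: w_def fun_eq_iff)
    then show ?thesis by (simp add: \<iota>_zero)
  qed
  have null: "\<exists>b. \<forall>n>b. norm (w n m) < \<epsilon>" if \<epsilon>: "0 < \<epsilon>" for m \<epsilon>
  proof -
    obtain b where b: "\<forall>n>b. norm ((coord m o\<^sub>L V) (e n)) < \<epsilon>"
      using functional_unit_vectors_tendsto_0[of "coord m o\<^sub>L V", OF _ \<epsilon>] V
      by (auto simp: operators_iff coord_smul)
    then show ?thesis using \<epsilon> by (intro exI[of _ b]) (auto simp: w_def)
  qed
  obtain \<delta> b where \<delta>: "0 < \<delta>" and
    small: "\<And>n. b < n \<Longrightarrow> norm (coord n (U (\<iota> (restr {m. norm (w n m) < \<delta>} (w n))))) < c / 4"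
    using small_coordinates_not_mapped_to_basis[of w "norm V" "c / 4" U, OF w_c00 w_norm null] c by auto
  define \<kappa> where "\<kappa> = 2 * (norm V / \<delta>) powr r"
  have \<kappa>: "0 \<le> \<kappa>" unfolding \<kappa>_def by simp
  define \<delta>' where "\<delta>' = c / (8 * (\<kappa> * norm V + 1))"
  have \<delta>': "0 < \<delta>'" "\<kappa> * norm V * \<delta>' \<le> c / 8"
    unfolding \<delta>'_def using c \<kappa> add_nonneg_pos[of "\<kappa> * norm V" 1] by (auto simp: divide_simps mult_less_0_iff)
  have "\<exists>m\<in>M. min \<delta> \<delta>' \<le> norm (coord m (V (e n))) \<and> min \<delta> \<delta>' \<le> norm (coord n (U (e m)))"
    if n: "b < n" and le: "c \<le> norm (coord n (U (proj M (V (e n)))))" for n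
  proof -
    have n1: "1 \<le> n" using n by simp
    let ?z = "proj M (V (e n))"
    have "norm (coord n (U (?z - \<iota> (w n)))) \<le> norm (U (?z - \<iota> (w n)))" by (rule norm_coord_le)
    also have "\<dots> \<le> norm U * norm (?z - \<iota> (w n))" by (rule norm_blinfun)
    also have "\<dots> \<le> norm U * \<eta>" using A(3)[of n] unfolding w_eq[OF n1] by (intro mult_left_mono) auto
    finally have tail: "norm (coord n (U (?z - \<iota> (w n)))) \<le> c / 2" using \<eta>(2) by linarith
    define H where "H = {m. \<delta> \<le> norm (w n m)}"
    let ?s = "restr {m. norm (w n m) < \<delta>} (w n)" and ?h = "restr H (w n)"
    have "w n = (\<lambda>m. ?s m + ?h m)" by (auto simp: restr_def H_def fun_eq_iff)
    then have "\<iota> (w n) = \<iota> ?s + \<iota> ?h" using \<iota>_add[OF restr_norm(1)[OF w_c00] restr_norm(1)[OF w_c00], of "{m. norm (w n m) < \<delta>}" n H n] by simp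
    then have z_eq: "coord n (U ?z) = coord n (U (?z - \<iota> (w n))) + coord n (U (\<iota> ?s)) + coord n (U (\<iota> ?h))"
      by (simp add: blinfun.add_right[symmetric] blinfun.diff_right)
    have "norm (coord n (U ?z)) \<le> norm (coord n (U (?z - \<iota> (w n)))) + norm (coord n (U (\<iota> ?s))) + norm (coord n (U (\<iota> ?h)))"
      unfolding z_eq by (intro order_trans[OF norm_triangle_ineq] add_right_mono norm_triangle_ineq)
    then have big: "c / 4 \<le> norm (coord n (U (\<iota> ?h)))" using le tail small[OF n] by linarith
    have HA: "H \<subseteq> A n \<inter> M" using \<delta> by (auto simp: H_def w_def)
    have Hfin: "finite H" "H \<subseteq> {1..}" using HA fin[of n] finite_subset[OF HA] by auto
    have "H \<subseteq> {m. \<delta> \<le> norm (coord m (V (e n)))}" using HA n1 by (auto simp: H_def w_def)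
    then have "real (card H) \<le> real (card {m. \<delta> \<le> norm (coord m (V (e n)))})"
      using large_coordinates(1)[OF \<delta>] by (simp add: card_mono)
    also have "\<dots> \<le> 2 * (norm (V (e n)) / \<delta>) powr r" by (rule large_coordinates(2)[OF \<delta>])
    also have "\<dots> \<le> \<kappa>" unfolding \<kappa>_def using norm_operator_e[OF n1, of V] \<delta> r
      by (intro mult_left_mono powr_mono2 divide_right_mono) auto
    finally have cardH: "real (card H) \<le> \<kappa>" .
    have "\<exists>m\<in>H. \<delta>' \<le> norm (coord n (U (e m)))"
    proof (rule ccontr)
      assume neg: "\<not> ?thesis"
      have "\<iota> ?h = (\<Sum>m\<in>H. smul (w n m) (e m))"
        by (subst \<iota>_finite[OF Hfin]) (auto simp: restr_def)
      then have "coord n (U (\<iota> ?h)) = (\<Sum>m\<in>H. w n m * coord n (U (e m)))"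
        using U by (simp add: blinfun.sum_right operators_iff coord_smul)
      then have "norm (coord n (U (\<iota> ?h))) \<le> (\<Sum>m\<in>H. norm (w n m * coord n (U (e m))))"
        by (simp add: norm_sum)
      also have "\<dots> \<le> (\<Sum>m\<in>H. norm V * \<delta>')"
      proof (rule sum_mono)
        fix m assume m: "m \<in> H"
        have "norm (w n m) \<le> norm V" using coordinate_le_norm[OF w_c00] w_norm by (meson order_trans)
        then show "norm (w n m * coord n (U (e m))) \<le> norm V * \<delta>'"
          unfolding norm_mult using neg m by (intro mult_mono) auto
      qed
      also have "\<dots> = real (card H) * (norm V * \<delta>')" by simp
      also have "\<dots> \<le> \<kappa> * (norm V * \<delta>')" using cardH \<delta>' by (intro mult_right_mono) auto
      finally show False using big \<delta>'(2) c by (simp add: mult.assoc)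
    qed
    then obtain m where m: "m \<in> H" "\<delta>' \<le> norm (coord n (U (e m)))" by blast
    have "m \<in> M" using m HA by auto
    moreover have "\<delta> \<le> norm (coord m (V (e n)))"
      using m(1) \<open>H \<subseteq> {m. \<delta> \<le> norm (coord m (V (e n)))}\<close> by blast
    ultimately show ?thesis using m(2) by (intro bexI[of _ m]) auto
  qed
  then show ?thesis using \<delta> \<delta>' by (intro exI[of _ "min \<delta> \<delta>'"] conjI exI[of _ b]) auto
qed

end


lemma finite_maximizer:
  fixes f :: "'a \<Rightarrow> real"
  assumes "finite S" "S \<noteq> {}"
  shows "\<exists>n\<in>S. \<forall>k\<in>S. f k \<le> f n"
proof -
  have "Max (f ` S) \<in> f ` S" using assms by (intro Max_in) auto
  then obtain n where "n \<in> S" "f n = Max (f ` S)" by auto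
  then show ?thesis using assms by (metis Max_ge finite_imageI imageI)
qed

lemma gapE:
  assumes "gap c M N"
  obtains G where "stack t G" "\<And>i. i < t \<Longrightarrow> G i \<subseteq> N \<inter> {b<..}"
    "\<And>a. a \<in> (\<Union>i<t. G i) \<Longrightarrow> card {m \<in> M. m < card (\<Union>i<t. G i)} \<le> c * a"
proof -
  from assms[unfolded gap_def, rule_format, of t b] obtain G where G: "stack t G"
    "\<forall>i<t. G i \<subseteq> N \<inter> {b<..}"
    "\<forall>a\<in>(\<Union>i<t. G i). card {m \<in> M. m < card (\<Union>i<t. G i)} \<le> c * a" by (elim exE conjE)
  show thesis by (rule that[OF G(1) G(2)[rule_format] bspec[OF G(3)]])
qed

context schreier_space
begin

lemma growth_nonneg: "0 \<le> growth t"
  by (simp add: growth_def)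

text \<open>
  Let \<open>\<sigma> n\<close> be an index through which the \<open>n\<close>-th diagonal coefficient passes. Only boundedly many \<open>n\<close>
  share the same value. The values below \<open>card W\<close> belong to few \<open>n\<close> by the hypothesis on \<open>M\<close>, and each \<open>n\<close> has mass at most
  the reciprocal of the minimum of \<open>W\<close>. The other values form a Schreier set, so the norm of the image of the
  vector of the stack, with suitable signs, controls the mass of the other \<open>n\<close>.
\<close>

lemma stack_mass_through_coordinates:
  assumes U: "U \<in> operators" and V: "V \<in> operators" and \<delta>: "0 < \<delta>"
    and G: "stack t G" and M: "M \<subseteq> {1..}"
    and W: "W = (\<Union>i<t. G i)" and H: "H \<subseteq> W"
    and \<sigma>: "\<And>n. n \<in> H \<Longrightarrow> \<sigma> n \<in> M \<and> \<delta> \<le> norm (coord (\<sigma> n) (V (e n))) \<and> \<delta> \<le> norm (coord n (U (e (\<sigma> n))))"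
    and few: "\<And>a. a \<in> W \<Longrightarrow> card {m \<in> M. m < card W} \<le> 2 * a"
  shows "(\<Sum>n\<in>H. norm (stack_vector t G n) powr r)
    \<le> 2 * (2 * (norm U / \<delta>) powr r) + 2 * (norm U / \<delta>) powr r * (norm V / \<delta>) powr r * block_const 1 * growth t"
proof (cases "t = 0")
  case True
  then show ?thesis using W H growth_nonneg block_const_nonneg by simp
next
  case False
  define \<kappa> where "\<kappa> = 2 * (norm U / \<delta>) powr r"
  have \<kappa>0: "0 \<le> \<kappa>" unfolding \<kappa>_def by simp
  define f where "f n = norm (stack_vector t G n) powr r" for n
  have f0: "0 \<le> f n" for n by (simp add: f_def)
  have finW: "finite W" and W1: "W \<subseteq> {1..}" using finite_stack[OF G] stack_pos[OF G] W by auto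
  have finH: "finite H" using H finW finite_subset by auto
  define fib where "fib m = {n. \<delta> \<le> norm (coord n (U (e m)))}" for m
  have fib: "finite (fib m)" "real (card (fib m)) \<le> \<kappa>" if "1 \<le> m" for m
  proof -
    show "finite (fib m)" unfolding fib_def by (rule large_coordinates(1)[OF \<delta>])
    have "real (card (fib m)) \<le> 2 * (norm (U (e m)) / \<delta>) powr r"
      unfolding fib_def by (rule large_coordinates(2)[OF \<delta>])
    also have "\<dots> \<le> \<kappa>" unfolding \<kappa>_def using norm_operator_e[OF that, of U] \<delta> r
      by (intro mult_left_mono powr_mono2 divide_right_mono) auto
    finally show "real (card (fib m)) \<le> \<kappa>" .
  qed
  define Lo where "Lo = {n \<in> H. \<sigma> n < card W}"
  define Hi where "Hi = {n \<in> H. card W \<le> \<sigma> n}"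
  have split: "H = Lo \<union> Hi" "Lo \<inter> Hi = {}" unfolding Lo_def Hi_def by auto
  have fin: "finite Lo" "finite Hi" using finH unfolding Lo_def Hi_def by auto
  have "(\<Sum>n\<in>Lo. f n) \<le> 2 * \<kappa>"
  proof -
    define g where "g = card (G 0)"
    have t0: "0 < t" using False by simp
    have g: "0 < g" "g \<in> W" using stackD(2,3)[OF G t0] W t0 unfolding g_def by auto
    have fle: "f n \<le> 1 / g" if "n \<in> Lo" for n
    proof -
      have "n \<in> (\<Union>i<t. G i)" using that H unfolding Lo_def W by blast
      then obtain i where i: "i < t" "n \<in> G i" by blast
      have "g \<le> card (G i)"
        using stack_less[OF G _ i(1) stackD(3)[OF G t0] stackD(3)[OF G i(1)]] unfolding g_def by (cases "i = 0") auto
      then show ?thesis unfolding f_def stack_vector_in(2)[OF G i] using g(1) by (simp add: frac_le)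
    qed
    define Ml where "Ml = {m \<in> M. m < card W}"
    have Ml: "finite Ml" "Ml \<subseteq> {1..}" unfolding Ml_def using M by auto
    have "Lo \<subseteq> (\<Union>m\<in>Ml. fib m)" using \<sigma> unfolding Lo_def Ml_def fib_def by auto
    then have "card Lo \<le> card (\<Union>m\<in>Ml. fib m)" using Ml fib by (intro card_mono) auto
    also have "\<dots> \<le> (\<Sum>m\<in>Ml. card (fib m))" using Ml by (intro card_UN_le) auto
    finally have "real (card Lo) \<le> (\<Sum>m\<in>Ml. real (card (fib m)))" using of_nat_mono by fastforce
    also have "\<dots> \<le> (\<Sum>m\<in>Ml. \<kappa>)" using fib Ml by (intro sum_mono) auto
    also have "\<dots> = real (card Ml) * \<kappa>" by simp
    also have "\<dots> \<le> real (2 * g) * \<kappa>"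
      using few[OF g(2)] \<kappa>0 unfolding Ml_def by (intro mult_right_mono) auto
    finally have cardLo: "real (card Lo) \<le> real (2 * g) * \<kappa>" .
    have "(\<Sum>n\<in>Lo. f n) \<le> (\<Sum>n\<in>Lo. 1 / g)" using fle by (intro sum_mono) auto
    also have "\<dots> = real (card Lo) / g" by simp
    also have "\<dots> \<le> real (2 * g) * \<kappa> / g" using cardLo by (intro divide_right_mono) auto
    also have "\<dots> = 2 * \<kappa>" using g(1) by simp
    finally show ?thesis .
  qed
  moreover have "(\<Sum>n\<in>Hi. f n) \<le> \<kappa> * (norm V / \<delta>) powr r * block_const 1 * growth t"
  proof -
    define S where "S = \<sigma> ` Hi"
    have finS: "finite S" unfolding S_def using fin by simp
    have SM: "S \<subseteq> M" unfolding S_def Hi_def using \<sigma> by auto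
    have "card S \<le> card W"
      unfolding S_def using card_image_le[OF fin(2), of \<sigma>] card_mono[OF finW, of Hi] H unfolding Hi_def by force
    then have S: "S \<in> schreier_sets"
      unfolding schreier_sets_iff using finS SM M unfolding S_def Hi_def by auto
    have "\<exists>n\<in>{n \<in> Hi. \<sigma> n = m}. \<forall>k\<in>{n \<in> Hi. \<sigma> n = m}. f k \<le> f n" if "m \<in> S" for m
      using that fin unfolding S_def by (intro finite_maximizer) auto
    then have "\<forall>m\<in>S. \<exists>n. n \<in> Hi \<and> \<sigma> n = m \<and> (\<forall>k\<in>Hi. \<sigma> k = m \<longrightarrow> f k \<le> f n)" by blast
    then obtain \<rho> where \<rho>: "\<And>m. m \<in> S \<Longrightarrow> \<rho> m \<in> Hi" "\<And>m. m \<in> S \<Longrightarrow> \<sigma> (\<rho> m) = m"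
      "\<And>m k. m \<in> S \<Longrightarrow> k \<in> Hi \<Longrightarrow> \<sigma> k = m \<Longrightarrow> f k \<le> f (\<rho> m)" by metis
    have "(\<Sum>n\<in>Hi. f n) = (\<Sum>m\<in>S. \<Sum>n\<in>{n \<in> Hi. \<sigma> n = m}. f n)"
      unfolding S_def using fin(2) by (rule sum.image_gen)
    also have "\<dots> \<le> (\<Sum>m\<in>S. \<kappa> * f (\<rho> m))"
    proof (rule sum_mono)
      fix m assume m: "m \<in> S"
      have m1: "1 \<le> m" using m SM M by auto
      have "{n \<in> Hi. \<sigma> n = m} \<subseteq> fib m" using \<sigma> unfolding Hi_def fib_def by auto
      then have "card {n \<in> Hi. \<sigma> n = m} \<le> card (fib m)" using fib(1)[OF m1] by (intro card_mono)
      then have c: "real (card {n \<in> Hi. \<sigma> n = m}) \<le> \<kappa>" using fib(2)[OF m1] by linarith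
      have "(\<Sum>n\<in>{n \<in> Hi. \<sigma> n = m}. f n) \<le> (\<Sum>n\<in>{n \<in> Hi. \<sigma> n = m}. f (\<rho> m))"
        using \<rho>(3)[OF m] by (intro sum_mono) auto
      also have "\<dots> = real (card {n \<in> Hi. \<sigma> n = m}) * f (\<rho> m)" by simp
      also have "\<dots> \<le> \<kappa> * f (\<rho> m)" using c f0 by (intro mult_right_mono)
      finally show "(\<Sum>n\<in>{n \<in> Hi. \<sigma> n = m}. f n) \<le> \<kappa> * f (\<rho> m)" .
    qed
    also have "\<dots> = \<kappa> * (\<Sum>m\<in>S. f (\<rho> m))" by (simp add: sum_distrib_left)
    finally have 1: "(\<Sum>n\<in>Hi. f n) \<le> \<kappa> * (\<Sum>m\<in>S. f (\<rho> m))" .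
    define c where "c m n = stack_vector t G n * coord m (V (e n))" for m n
    obtain \<epsilon> :: "nat \<Rightarrow> real" where \<epsilon>: "\<And>j. \<bar>\<epsilon> j\<bar> = 1"
      "(\<Sum>m\<in>S. norm (c m (\<rho> m)) powr r) \<le> (\<Sum>m\<in>S. norm (\<Sum>n\<in>Hi. \<epsilon> n *\<^sub>R c m n) powr r)"
      using exists_signs[OF finS fin(2), of \<rho> r c] \<rho>(1) r by auto
    define x where "x n = (if n \<in> Hi then of_real (\<epsilon> n) * stack_vector t G n else 0)" for n
    have xle: "norm (x n) \<le> norm (stack_vector t G n)" for n by (simp add: x_def norm_mult \<epsilon>)
    have x: "x \<in> c00" "norm (\<iota> x) \<le> norm (\<iota> (stack_vector t G))"
      using norm_\<iota>_mono[OF stack_vector_norm(1)[OF G] xle] by auto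
    have HiW: "Hi \<subseteq> {1..}" using H W1 unfolding Hi_def by auto
    have Vx: "coord m (V (\<iota> x)) = (\<Sum>n\<in>Hi. \<epsilon> n *\<^sub>R c m n)" for m
    proof -
      have "\<iota> x = (\<Sum>n\<in>Hi. smul (x n) (e n))"
        by (rule \<iota>_finite[OF fin(2) HiW]) (simp add: x_def)
      then have "coord m (V (\<iota> x)) = (\<Sum>n\<in>Hi. x n * coord m (V (e n)))"
        using V by (simp add: blinfun.sum_right operators_iff coord_smul)
      also have "\<dots> = (\<Sum>n\<in>Hi. \<epsilon> n *\<^sub>R c m n)"
        by (intro sum.cong) (auto simp: x_def c_def scaleR_conv_of_real mult.assoc)
      finally show ?thesis .
    qed
    have "\<delta> powr r * (\<Sum>m\<in>S. f (\<rho> m)) = (\<Sum>m\<in>S. (norm (stack_vector t G (\<rho> m)) * \<delta>) powr r)"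
      unfolding f_def sum_distrib_left using \<delta> by (intro sum.cong) (auto simp: powr_mult)
    also have "\<dots> \<le> (\<Sum>m\<in>S. norm (c m (\<rho> m)) powr r)"
    proof (rule sum_mono)
      fix m assume m: "m \<in> S"
      have "\<rho> m \<in> H" using \<rho>(1)[OF m] unfolding Hi_def by simp
      then have "\<delta> \<le> norm (coord m (V (e (\<rho> m))))" using \<sigma> \<rho>(2)[OF m] by metis
      then show "(norm (stack_vector t G (\<rho> m)) * \<delta>) powr r \<le> norm (c m (\<rho> m)) powr r"
        unfolding c_def norm_mult using \<delta> r by (intro powr_mono2 mult_left_mono) auto
    qed
    also have "\<dots> \<le> (\<Sum>m\<in>S. norm (coord m (V (\<iota> x))) powr r)" using \<epsilon>(2) unfolding Vx .
    also have "\<dots> \<le> norm (V (\<iota> x)) powr r" by (rule schreier_coord_le_norm[OF S])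
    also have "\<dots> \<le> (norm V * norm (\<iota> (stack_vector t G))) powr r"
      using r x(2) by (intro powr_mono2 order_trans[OF norm_blinfun] mult_left_mono) auto
    also have "\<dots> = norm V powr r * norm (\<iota> (stack_vector t G)) powr r" by (simp add: powr_mult)
    also have "\<dots> \<le> norm V powr r * (block_const 1 * growth t)"
      using stack_vector_norm(2)[OF G] by (intro mult_left_mono) auto
    finally have "(\<Sum>m\<in>S. f (\<rho> m)) \<le> (norm V / \<delta>) powr r * (block_const 1 * growth t)"
      using \<delta> by (simp add: powr_divide field_simps)
    then have "\<kappa> * (\<Sum>m\<in>S. f (\<rho> m)) \<le> \<kappa> * ((norm V / \<delta>) powr r * (block_const 1 * growth t))"
      using \<kappa>0 by (rule mult_left_mono)
    then show ?thesis using 1 by (simp add: mult.assoc)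
  qed
  moreover have "(\<Sum>n\<in>H. f n) = (\<Sum>n\<in>Lo. f n) + (\<Sum>n\<in>Hi. f n)"
    unfolding split(1) using fin split(2) by (rule sum.union_disjoint)
  ultimately show ?thesis unfolding f_def \<kappa>_def by simp
qed

text \<open>
  Each index of a high stack is served by one of the finitely many products \<open>U P V\<close>. Each product serves mass at most
  of the order of \<open>growth t\<close>, up to a constant, but the total mass is \<open>t\<close>.
\<close>

theorem gap_imp_proj_notin_spatial:
  assumes M: "M \<subseteq> {1..}" and N: "N \<subseteq> {1..}" and gap: "gap 2 M N"
  shows "proj N \<notin> spatial M"
proof
  assume "proj N \<in> spatial M"
  then obtain T where T: "T \<in> generated_ideal smul (proj M)" "dist T (proj N) < 1 / 2"
    unfolding spatial_def closure_approachable by (meson half_gt_zero zero_less_one)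
  obtain k :: nat and U V where k: "1 \<le> k" "T = (\<Sum>j=1..k. U j o\<^sub>L proj M o\<^sub>L V j)"
    "\<forall>j\<in>{1..k}. U j \<in> operators \<and> V j \<in> operators"
    using T(1) by (rule generated_idealE) (rule that)
  define c where "c = 1 / (2 * real k)"
  have c: "0 < c" "real k * c = 1 / 2" unfolding c_def using k(1) by auto
  have diag: "\<exists>j\<in>{1..k}. c \<le> norm (coord n ((U j) (proj M ((V j) (e n)))))" if n: "n \<in> N" for n
  proof (rule ccontr)
    assume neg: "\<not> ?thesis"
    have n1: "1 \<le> n" using n N by auto
    have "norm (coord n ((proj N - T) (e n))) \<le> norm ((proj N - T) (e n))" by (rule norm_coord_le)
    also have "\<dots> \<le> norm (proj N - T)" by (rule norm_operator_e[OF n1])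
    also have "\<dots> < 1 / 2" using T(2) by (simp add: dist_norm norm_minus_commute)
    finally have "norm (1 - coord n (T (e n))) < 1 / 2"
      using n n1 by (simp add: blinfun.diff_left blinfun.diff_right proj_e coord_e)
    moreover have "norm (1::'k) \<le> norm (1 - coord n (T (e n))) + norm (coord n (T (e n)))"
      using norm_triangle_ineq[of "1 - coord n (T (e n))" "coord n (T (e n))"] by simp
    ultimately have "1 / 2 < norm (coord n (T (e n)))" by simp
    also have "coord n (T (e n)) = (\<Sum>j=1..k. coord n ((U j) (proj M ((V j) (e n)))))"
      unfolding k(2) by (simp add: blinfun.sum_left blinfun.sum_right)
    also have "norm \<dots> \<le> (\<Sum>j=1..k. norm (coord n ((U j) (proj M ((V j) (e n))))))" by (rule norm_sum)
    also have "\<dots> \<le> (\<Sum>j=1..k. c)" using neg by (intro sum_mono) (auto simp: not_le less_imp_le)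
    finally show False using c(2) by simp
  qed
  have "\<forall>j\<in>{1..k}. \<exists>\<delta>>0. \<exists>b. \<forall>n>b. c \<le> norm (coord n ((U j) (proj M ((V j) (e n))))) \<longrightarrow>
    (\<exists>m\<in>M. \<delta> \<le> norm (coord m ((V j) (e n))) \<and> \<delta> \<le> norm (coord n ((U j) (e m))))"
    using k(3) by (intro ballI diagonal_through_single_coordinate M c(1)) auto
  then have "\<exists>\<delta>. \<forall>j\<in>{1..k}. 0 < \<delta> j \<and> (\<exists>b. \<forall>n>b. c \<le> norm (coord n ((U j) (proj M ((V j) (e n))))) \<longrightarrow>
    (\<exists>m\<in>M. \<delta> j \<le> norm (coord m ((V j) (e n))) \<and> \<delta> j \<le> norm (coord n ((U j) (e m)))))"
    by (rule bchoice)
  then obtain \<delta> where \<delta>: "\<And>j. j \<in> {1..k} \<Longrightarrow> 0 < \<delta> j" and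
    "\<forall>j\<in>{1..k}. \<exists>b. \<forall>n>b. c \<le> norm (coord n ((U j) (proj M ((V j) (e n))))) \<longrightarrow>
    (\<exists>m\<in>M. \<delta> j \<le> norm (coord m ((V j) (e n))) \<and> \<delta> j \<le> norm (coord n ((U j) (e m))))" by blast
  from bchoice[OF this(2)] obtain b where
    b: "\<And>j n. j \<in> {1..k} \<Longrightarrow> b j < n \<Longrightarrow> c \<le> norm (coord n ((U j) (proj M ((V j) (e n))))) \<Longrightarrow>
      \<exists>m\<in>M. \<delta> j \<le> norm (coord m ((V j) (e n))) \<and> \<delta> j \<le> norm (coord n ((U j) (e m)))"
    by blast
  define C1 where "C1 j = 2 * (2 * (norm (U j) / \<delta> j) powr r)" for j
  define C2 where "C2 j = 2 * (norm (U j) / \<delta> j) powr r * (norm (V j) / \<delta> j) powr r * block_const 1" for j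
  obtain t where t: "(\<Sum>j=1..k. C1 j) + (\<Sum>j=1..k. C2 j) * growth t < real t"
    using growth_sublinear by blast
  define b0 where "b0 = Max (b ` {1..k})"
  have b0: "b j \<le> b0" if "j \<in> {1..k}" for j unfolding b0_def using that by (intro Max_ge) auto
  obtain G where G: "stack t G" "\<And>i. i < t \<Longrightarrow> G i \<subseteq> N \<inter> {b0<..}"
    "\<And>a. a \<in> (\<Union>i<t. G i) \<Longrightarrow> card {m \<in> M. m < card (\<Union>i<t. G i)} \<le> 2 * a"
    using gap by (rule gapE) (rule that)
  define W where "W = (\<Union>i<t. G i)"
  have WN: "W \<subseteq> N" "\<And>n. n \<in> W \<Longrightarrow> b0 < n" using G(2) unfolding W_def by blast+
  define H where "H j = {n \<in> W. c \<le> norm (coord n ((U j) (proj M ((V j) (e n)))))}" for j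
  have finW: "finite W" unfolding W_def by (rule finite_stack[OF G(1)])
  have "W = (\<Union>j\<in>{1..k}. H j)" unfolding H_def using diag WN(1) by blast
  then have "real t = (\<Sum>n\<in>(\<Union>j\<in>{1..k}. H j). norm (stack_vector t G n) powr r)"
    using stack_vector_mass[OF G(1)] unfolding W_def by simp
  also have "\<dots> \<le> (\<Sum>j=1..k. \<Sum>n\<in>H j. norm (stack_vector t G n) powr r)"
    using finW by (intro sum_UN_le) (auto simp: H_def)
  also have "\<dots> \<le> (\<Sum>j=1..k. C1 j + C2 j * growth t)"
  proof (rule sum_mono)
    fix j assume j: "j \<in> {1..k}"
    have "\<exists>m\<in>M. \<delta> j \<le> norm (coord m ((V j) (e n))) \<and> \<delta> j \<le> norm (coord n ((U j) (e m)))" if n: "n \<in> H j" for n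
    proof (rule b[OF j])
      show "b j < n" using b0[OF j] WN(2)[of n] n unfolding H_def by auto
      show "c \<le> norm (coord n ((U j) (proj M ((V j) (e n)))))" using n unfolding H_def by simp
    qed
    then obtain \<sigma> where \<sigma>: "\<And>n. n \<in> H j \<Longrightarrow> \<sigma> n \<in> M \<and> \<delta> j \<le> norm (coord (\<sigma> n) ((V j) (e n))) \<and>
        \<delta> j \<le> norm (coord n ((U j) (e (\<sigma> n))))" by metis
    show "(\<Sum>n\<in>H j. norm (stack_vector t G n) powr r) \<le> C1 j + C2 j * growth t"
      unfolding C1_def C2_def
      by (rule stack_mass_through_coordinates[OF _ _ \<delta>[OF j] G(1) M W_def _ \<sigma> G(3)[folded W_def]])
        (use k(3) j in \<open>auto simp: H_def\<close>)
  qed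
  also have "\<dots> = (\<Sum>j=1..k. C1 j) + (\<Sum>j=1..k. C2 j) * growth t"
    by (simp add: sum.distrib sum_distrib_right)
  finally show False using t by simp
qed


section \<open>When a projection is in a spatial ideal\<close>

lemma relocate_operator:
  assumes \<pi>: "strict_mono_on A \<pi>" "\<pi> ` A \<subseteq> {1..}"
    and cov: "\<And>F. F \<in> schreier_sets \<Longrightarrow> F \<subseteq> \<pi> ` A \<Longrightarrow> covered t {n \<in> A. \<pi> n \<in> F}"
  shows "\<exists>T\<in>operators. \<forall>n\<ge>1. T (e n) = (if n \<in> A then e (\<pi> n) else 0)"
proof -
  have inj: "inj_on \<pi> A" using \<pi>(1) by (rule strict_mono_on_imp_inj_on)
  have "\<exists>T\<in>operators. \<forall>x\<in>c00. T (\<iota> x) = \<iota> (relocate A \<pi> x)"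
  proof (rule extend_operator)
    fix x :: "nat \<Rightarrow> 'k" assume x: "x \<in> c00"
    show "relocate A \<pi> x \<in> c00" using relocate_c00[OF x \<pi>(2)] .
    let ?C = "real t powr s * real t"
    have "(norm (\<iota> (relocate A \<pi> x)) powr (r * s)) powr (1 / (r * s)) \<le> (?C * norm (\<iota> x) powr (r * s)) powr (1 / (r * s))"
      using norm_relocate[OF x \<pi> cov] rs by (intro powr_mono2) auto
    then show "norm (\<iota> (relocate A \<pi> x)) \<le> ?C powr (1 / (r * s)) * norm (\<iota> x)"
      using r s by (simp add: powr_powr powr_mult)
  qed (auto simp: relocate_def)
  then obtain T where T: "T \<in> operators" "\<And>x. x \<in> c00 \<Longrightarrow> T (\<iota> x) = \<iota> (relocate A \<pi> x)" by blast
  have "T (e n) = (if n \<in> A then e (\<pi> n) else 0)" if "1 \<le> n" for n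
  proof -
    have "relocate A \<pi> (dirac n) = (if n \<in> A then dirac (\<pi> n) else (\<lambda>_. 0))"
      using inj by (auto simp: relocate_def fun_eq_iff inj_on_eq_iff)
    then show ?thesis using T(2)[OF dirac_c00[OF that]] by (simp add: unit_vector_def \<iota>_zero)
  qed
  then show ?thesis using T(1) by blast
qed

text \<open>
  Without a gap, the order isomorphism from \<open>N\<close> onto the subset \<open>M\<close> moves the basis vectors to the
  right, and a long stack in the preimage of a Schreier set \<open>F\<close> would witness a gap: if \<open>a\<close> is in the preimage, then
  \<open>M\<close> has at most \<open>a\<close> elements below the image of \<open>a\<close>, which is at least \<open>card F\<close>.
\<close>

theorem no_gap_imp_proj_in_spatial:
  assumes N: "N \<subseteq> {1..}" "infinite N" and MN: "M \<subseteq> N" and no_gap: "\<not> gap 1 M N"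
  shows "proj N \<in> spatial M"
proof -
  \<comment> \<open>from \<open>b\<close> on there is no stack of height \<open>t\<close> witnessing a gap\<close>
  from no_gap obtain b t where no_stack: "\<nexists>G. stack t G \<and> (\<forall>i<t. G i \<subseteq> N \<inter> {b<..}) \<and>
     (\<forall>a\<in>(\<Union>i<t. G i). card {m \<in> M. m < card (\<Union>i<t. G i)} \<le> 1 * a)"
    unfolding gap_def not_all by (elim exE)
  have bt: "\<exists>a\<in>(\<Union>i<t. G i). a < card {m \<in> M. m < card (\<Union>i<t. G i)}"
    if "stack t G" "\<And>i. i < t \<Longrightarrow> G i \<subseteq> N \<inter> {b<..}" for G
  proof (rule ccontr)
    assume "\<not> ?thesis"
    then have "\<forall>a\<in>(\<Union>i<t. G i). card {m \<in> M. m < card (\<Union>i<t. G i)} \<le> 1 * a"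
      unfolding bex_simps not_less mult_1 .
    then show False using no_stack that by blast
  qed
  have M: "infinite M"
  proof
    assume fin: "finite M"
    obtain G where G: "\<And>t. stack t G" "\<And>i. G i \<subseteq> N \<inter> {max b (card M)<..}"
      using infinite_stack[OF N(2)] by metis
    obtain a where a: "a \<in> (\<Union>i<t. G i)" "a < card {m \<in> M. m < card (\<Union>i<t. G i)}"
      using bt[OF G(1)] G(2) by fastforce
    have "card {m \<in> M. m < card (\<Union>i<t. G i)} \<le> card M" using fin by (intro card_mono) auto
    moreover have "card M < a" using a(1) G(2) by fastforce
    ultimately show False using a(2) by simp
  qed
  define \<sigma> where "\<sigma> n = enumerate M (card {k \<in> N. k < n})" for n
  have \<sigma>M: "\<sigma> n \<in> M" for n unfolding \<sigma>_def using M by (rule enumerate_in_set)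
  have below: "{m \<in> M. m < enumerate M i} = enumerate M ` {..<i}" for i
  proof (intro equalityI subsetI)
    fix m assume m: "m \<in> {m \<in> M. m < enumerate M i}"
    then obtain j where j: "m = enumerate M j" using enumerate_Ex[OF M, of m] by auto
    then have "j < i" using m M enumerate_mono_iff[OF M] by simp
    then show "m \<in> enumerate M ` {..<i}" using j by simp
  qed (use M in \<open>auto simp: enumerate_in_set enumerate_mono\<close>)
  have card_below: "card {m \<in> M. m < \<sigma> n} \<le> n" for n
  proof -
    have "card {m \<in> M. m < \<sigma> n} \<le> card {k \<in> N. k < n}"
      unfolding \<sigma>_def below using card_image_le[of "{..<card {k \<in> N. k < n}}" "enumerate M"] by simp
    also have "\<dots> \<le> card {..<n}" by (intro card_mono) auto
    finally show ?thesis by simp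
  qed
  have \<sigma>_ge: "n \<le> \<sigma> n" for n
  proof (rule ccontr)
    assume "\<not> n \<le> \<sigma> n"
    then have lt: "\<sigma> n < n" by simp
    define i where "i = card {k \<in> N. k < n}"
    have "enumerate M ` {..i} \<subseteq> {k \<in> N. k < n}"
    proof
      fix m assume "m \<in> enumerate M ` {..i}"
      then obtain j where j: "m = enumerate M j" "j \<le> i" by auto
      have "m \<le> \<sigma> n" unfolding \<sigma>_def j(1) i_def[symmetric] using j(2) M by (cases "j = i") (auto intro: less_imp_le enumerate_mono)
      then show "m \<in> {k \<in> N. k < n}" using lt j(1) enumerate_in_set[OF M, of j] MN by auto
    qed
    then have "card (enumerate M ` {..i}) \<le> i" unfolding i_def by (intro card_mono) auto
    moreover have "inj (enumerate M)" using M by (rule inj_enumerate)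
    ultimately show False by (simp add: card_image inj_on_subset)
  qed
  have \<sigma>_mono: "\<sigma> n < \<sigma> m" if "n \<in> N" "n < m" for n m
  proof -
    have "card {k \<in> N. k < n} < card {k \<in> N. k < m}"
      using that by (intro psubset_card_mono) auto
    then show ?thesis unfolding \<sigma>_def using M by (simp add: enumerate_mono)
  qed
  \<comment> \<open>the projections of \<open>N\<close> and \<open>A\<close> differ by an operator of finite rank\<close>
  define A where "A = N \<inter> {b<..}"
  have sm: "strict_mono_on A \<sigma>" by (rule strict_mono_onI) (auto simp: A_def \<sigma>_mono)
  have inj: "inj_on \<sigma> A" using sm by (rule strict_mono_on_imp_inj_on)
  have img: "\<sigma> ` A \<subseteq> {1..}" using \<sigma>M MN N(1) by blast
  have "covered t {n \<in> A. \<sigma> n \<in> F}" if F: "F \<in> schreier_sets" for F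
  proof -
    let ?E = "{n \<in> A. \<sigma> n \<in> F}"
    have finF: "finite F" using F by (simp add: schreier_sets_iff)
    have injE: "inj_on \<sigma> ?E" by (rule inj_on_subset[OF inj]) auto
    have finE: "finite ?E" using finF injE by (auto intro!: inj_on_finite[of \<sigma> ?E F])
    have E1: "?E \<subseteq> {1..}" using N(1) unfolding A_def by auto
    have "\<not> (\<exists>G. stack t G \<and> (\<forall>i<t. G i \<subseteq> ?E))"
    proof
      assume "\<exists>G. stack t G \<and> (\<forall>i<t. G i \<subseteq> ?E)"
      then obtain G where G: "stack t G" "\<And>i. i < t \<Longrightarrow> G i \<subseteq> ?E" by blast
      define W where "W = (\<Union>i<t. G i)"
      have WE: "W \<subseteq> ?E" using G(2) unfolding W_def by blast
      have "\<exists>a\<in>W. a < card {m \<in> M. m < card W}"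
        unfolding W_def using G(2) by (intro bt[OF G(1)]) (auto simp: A_def)
      then obtain a where a: "a \<in> W" "a < card {m \<in> M. m < card W}" by blast
      have "card W \<le> card ?E" using finE WE by (rule card_mono)
      also have "\<dots> \<le> card F" using finF injE by (intro card_inj_on_le) auto
      also have "\<dots> \<le> \<sigma> a" using F a(1) WE unfolding schreier_sets_iff by auto
      finally have "card {m \<in> M. m < card W} \<le> card {m \<in> M. m < \<sigma> a}" by (intro card_mono) auto
      then show False using a(2) card_below[of a] by simp
    qed
    then show ?thesis using covered_or_stack[OF finE E1] by blast
  qed
  then obtain V where V: "V \<in> operators" "\<And>n. 1 \<le> n \<Longrightarrow> V (e n) = (if n \<in> A then e (\<sigma> n) else 0)"
    using relocate_operator[OF sm img] by blast
  define \<tau> where "\<tau> = inv_into A \<sigma>"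
  have \<tau>: "\<tau> (\<sigma> n) = n" if "n \<in> A" for n unfolding \<tau>_def using inj that by simp
  have \<tau>_sm: "strict_mono_on (\<sigma> ` A) \<tau>"
  proof (rule strict_mono_onI)
    fix x y assume "x \<in> \<sigma> ` A" "y \<in> \<sigma> ` A" and lt: "x < y"
    then obtain n m where nm: "n \<in> A" "m \<in> A" "x = \<sigma> n" "y = \<sigma> m" by blast
    have "n < m"
    proof (rule ccontr)
      assume "\<not> n < m"
      then have "\<sigma> m \<le> \<sigma> n" using \<sigma>_mono[of m n] nm(2) unfolding A_def by (cases "m = n") auto
      then show False using lt nm by simp
    qed
    then show "\<tau> x < \<tau> y" using nm \<tau> by simp
  qed
  have \<tau>_img: "\<tau> ` \<sigma> ` A = A" using \<tau> by (auto simp: image_image)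
  have "covered 1 {m \<in> \<sigma> ` A. \<tau> m \<in> F}" if F: "F \<in> schreier_sets" "F \<subseteq> \<tau> ` \<sigma> ` A" for F
  proof -
    have FA: "F \<subseteq> A" using F(2) \<tau>_img by simp
    have eq: "{m \<in> \<sigma> ` A. \<tau> m \<in> F} = \<sigma> ` F" using \<tau> FA by force
    have "card (\<sigma> ` F) = card F" using inj_on_subset[OF inj FA] by (rule card_image)
    then have "\<sigma> ` F \<in> schreier_sets"
      using F(1) FA img \<sigma>_ge unfolding schreier_sets_iff by (auto intro: order_trans)
    then show ?thesis unfolding eq covered_def by (intro exI[of _ "\<lambda>_. \<sigma> ` F"]) auto
  qed
  moreover have "\<tau> ` \<sigma> ` A \<subseteq> {1..}" using \<tau>_img N(1) unfolding A_def by auto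
  ultimately obtain U where U: "U \<in> operators" "\<And>n. 1 \<le> n \<Longrightarrow> U (e n) = (if n \<in> \<sigma> ` A then e (\<tau> n) else 0)"
    using relocate_operator[OF \<tau>_sm, of 1] by blast
  have "proj A = U o\<^sub>L proj M o\<^sub>L V"
  proof (rule operator_eqI)
    fix n :: nat assume n: "1 \<le> n"
    have s1: "1 \<le> \<sigma> n" using n \<sigma>_ge[of n] by simp
    show "proj A (e n) = (U o\<^sub>L proj M o\<^sub>L V) (e n)"
      using n s1 by (auto simp: proj_e V(2) U(2) \<sigma>M \<tau> blinfun.zero_right)
  qed (simp_all add: proj_operator U(1) V(1) operator_compose)
  then have "proj A \<in> spatial M"
    using opidealD(4,5)[OF spatial_opideal] proj_in_spatial U(1) V(1) by simp
  moreover have "N - A \<subseteq> {..b}" unfolding A_def by auto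
  then have "finite (N - A)" by (rule finite_subset) simp
  moreover from this have "A \<noteq> {}" using N(2) by auto
  moreover have "A \<subseteq> {1..}" using N(1) unfolding A_def by auto
  ultimately show ?thesis using proj_in_opideal_mod_finite[OF spatial_opideal, of A M N] N(1) by blast
qed

end


section \<open>Infinite combinatorics\<close>

text \<open>
  The branches of the binary tree: a set is coded by its initial segments, and two different sets share only
  those initial segments that end before the first difference.
\<close>

lemma almost_disjoint_family:
  "\<exists>\<Delta> :: nat set set. \<Delta> \<approx> (UNIV :: real set) \<and> (\<forall>A\<in>\<Delta>. infinite A) \<and>
     (\<forall>A\<in>\<Delta>. \<forall>B\<in>\<Delta>. A \<noteq> B \<longrightarrow> finite (A \<inter> B))"
proof -
  define code where "code X n = prod_encode (n, set_encode (X \<inter> {..<n}))" for X n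
  define br where "br X = range (code X)" for X
  have code_eq: "n = m \<and> X \<inter> {..<n} = Y \<inter> {..<n}" if eq: "code X n = code Y m" for X Y n m
  proof -
    have "n = m" and c: "set_encode (X \<inter> {..<n}) = set_encode (Y \<inter> {..<m})" using eq by (auto simp: code_def)
    moreover have "X \<inter> {..<n} = Y \<inter> {..<m}"
      using arg_cong[OF c, of set_decode] by simp
    ultimately show ?thesis by simp
  qed
  have inf: "infinite (br X)" for X
    unfolding br_def by (rule range_inj_infinite) (auto simp: inj_def dest: code_eq)
  have fin: "finite (br X \<inter> br Y)" if XY: "X \<noteq> Y" for X Y
  proof -
    obtain k where k: "k \<in> X \<longleftrightarrow> k \<notin> Y" using XY by blast
    have "br X \<inter> br Y \<subseteq> code X ` {..k}"
    proof
      fix z assume "z \<in> br X \<inter> br Y"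
      then obtain n m where z: "z = code X n" "z = code Y m" unfolding br_def by blast
      then have "X \<inter> {..<n} = Y \<inter> {..<n}" using code_eq by metis
      then have "\<not> k < n" using k by blast
      then show "z \<in> code X ` {..k}" using z(1) by auto
    qed
    then show ?thesis by (rule finite_subset) simp
  qed
  have inj: "inj br"
  proof (rule injI, rule ccontr)
    fix X Y assume "br X = br Y" "X \<noteq> Y"
    then show False using fin[of X Y] inf[of X] by simp
  qed
  have "range br \<approx> (UNIV :: nat set set)"
    using inj by (meson eqpoll_sym inj_on_image_eqpoll_self)
  then have "range br \<approx> (UNIV :: real set)"
    using nat_sets_eqpoll_reals eqpoll_trans by blast
  then show ?thesis
  proof (intro exI[of _ "range br"] conjI ballI impI)
    fix A B assume "A \<in> range br" "B \<in> range br" "A \<noteq> B"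
    then obtain X Y where "A = br X" "B = br Y" "X \<noteq> Y" by blast
    then show "finite (A \<inter> B)" using fin by simp
  qed (use inf in auto)
qed

text \<open>
  Among sets that are linearly ordered modulo finite sets, finite intersections are infinite. Choose an
  increasing sequence along these intersections and keep every other member, so that
  infinitely many elements of each set are left out.
\<close>

lemma pseudo_intersection:
  fixes B :: "nat \<Rightarrow> nat set"
  assumes inf: "\<And>i. infinite (B i)" and lin: "\<And>i j. finite (B i - B j) \<or> finite (B j - B i)"
  shows "\<exists>C. infinite C \<and> C \<subseteq> B 0 \<and> (\<forall>i. finite (C - B i) \<and> infinite (B i - C))"
proof -
  define D where "D n = (\<Inter>j\<le>n. B j)" for n
  have least: "\<exists>k\<le>n. \<forall>j\<le>n. finite (B k - B j)" for n
  proof (induction n)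
    case (Suc n)
    then obtain k where k: "k \<le> n" "\<And>j. j \<le> n \<Longrightarrow> finite (B k - B j)" by blast
    show ?case
    proof (cases "finite (B k - B (Suc n))")
      case True
      then show ?thesis using k by (intro exI[of _ k]) (auto simp: le_Suc_eq)
    next
      case False
      then have f: "finite (B (Suc n) - B k)" using lin by blast
      have "finite (B (Suc n) - B j)" if "j \<le> Suc n" for j
      proof (cases "j = Suc n")
        case False
        have "B (Suc n) - B j \<subseteq> (B (Suc n) - B k) \<union> (B k - B j)" by auto
        then show ?thesis using f k(2)[of j] that False by (auto intro: finite_subset)
      qed simp
      then show ?thesis by blast
    qed
  qed auto
  have Dinf: "infinite (D n)" for n
  proof -
    obtain k where k: "k \<le> n" "\<And>j. j \<le> n \<Longrightarrow> finite (B k - B j)" using least by blast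
    have "B k - (\<Union>j\<le>n. B k - B j) \<subseteq> D n" unfolding D_def by auto
    moreover have "finite (\<Union>j\<le>n. B k - B j)" using k(2) by (intro finite_UN_I) auto
    then have "infinite (B k - (\<Union>j\<le>n. B k - B j))" by (rule Diff_infinite_finite[OF _ inf])
    ultimately show ?thesis using finite_subset by blast
  qed
  have "\<exists>c. \<forall>n. c n \<in> D n \<and> c n < c (Suc n)"
  proof (rule dependent_nat_choice)
    have "D 0 \<noteq> {}" using Dinf[of 0] by auto
    then show "\<exists>x. x \<in> D 0" by blast
    show "\<exists>y. y \<in> D (Suc n) \<and> x < y" for x n
      using Dinf[of "Suc n"] unfolding infinite_nat_iff_unbounded by blast
  qed
  then obtain c where c: "\<And>n. c n \<in> D n" "\<And>n. c n < c (Suc n)" by blast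
  have sm: "strict_mono c" using c(2) by (rule strict_monoI_Suc)
  have inj: "c i = c j \<longleftrightarrow> i = j" for i j using sm by (simp add: strict_mono_eq)
  have cB: "c n \<in> B i" if "i \<le> n" for i n using c(1)[of n] that unfolding D_def by auto
  define C where "C = range (\<lambda>n. c (2 * n))"
  have "infinite C" unfolding C_def by (rule range_inj_infinite) (auto simp: inj_def inj)
  moreover have "C \<subseteq> B 0" unfolding C_def using cB by auto
  moreover have "finite (C - B i)" for i
  proof (rule finite_subset)
    show "C - B i \<subseteq> c ` {..<i}"
    proof
      fix z assume z: "z \<in> C - B i"
      then obtain n where n: "z = c (2 * n)" unfolding C_def by blast
      then have "\<not> i \<le> 2 * n" using cB z by blast
      then show "z \<in> c ` {..<i}" using n by auto
    qed
  qed simp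
  moreover have "infinite (B i - C)" for i
  proof -
    \<comment> \<open>the terms with odd index were left out\<close>
    have "range (\<lambda>n. c (2 * (n + i) + 1)) \<subseteq> B i - C"
      unfolding C_def using cB[of i] by (auto simp: inj) presburger
    moreover have "infinite (range (\<lambda>n. c (2 * (n + i) + 1)))"
      by (rule range_inj_infinite) (auto simp: inj_def inj)
    ultimately show ?thesis using finite_subset by blast
  qed
  ultimately show ?thesis by blast
qed

text \<open>
  If no member of the chain were above all of \<open>C\<close>, the bound of \<open>C\<close> in \<open>P\<close> would be above the whole chain and could be added to it.
\<close>

lemma maxchain_strict_bound:
  assumes max: "subset.maxchain P \<Gamma>" and C: "C \<subseteq> \<Gamma>"
    and bound: "\<exists>X\<in>P. \<forall>c\<in>C. c \<subset> X"
  shows "\<exists>Y\<in>\<Gamma>. \<forall>c\<in>C. c \<subset> Y"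
proof (rule ccontr)
  assume neg: "\<not> ?thesis"
  have chain: "subset.chain P \<Gamma>" using max by (rule subset.maxchain_imp_chain)
  obtain X where X: "X \<in> P" "\<And>c. c \<in> C \<Longrightarrow> c \<subset> X" using bound by blast
  have below: "Y \<subset> X" if Y: "Y \<in> \<Gamma>" for Y
  proof -
    obtain c where c: "c \<in> C" "\<not> c \<subset> Y" using neg Y by blast
    have "c \<subseteq> Y \<or> Y \<subseteq> c" using chain Y c(1) C unfolding subset_chain_def by blast
    then have "Y \<subseteq> c" using c(2) by blast
    then show ?thesis using X(2)[OF c(1)] by blast
  qed
  then have "X \<notin> \<Gamma>" by blast
  moreover have "subset.chain P (insert X \<Gamma>)"
    using chain X(1) below unfolding subset_chain_def by blast
  ultimately show False
    using max unfolding subset.maxchain_def by blast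
qed

definition layers :: "(nat \<Rightarrow> nat) \<Rightarrow> nat set \<Rightarrow> nat set" where
  "layers b S = (\<Union>i\<in>S. {b i<..b (Suc i)})"

text \<open>
  Between \<open>M\<close> and \<open>N\<close> the natural numbers are divided into intervals so long that each one contains a stack
  witnessing the gap. Adding to \<open>M\<close> the part of \<open>N\<close> in some of the intervals only shifts the
  counting function of \<open>M\<close> at a witness by the end of the preceding interval.
\<close>

lemma gap_layers:
  assumes N: "N \<subseteq> {1..}" and gap: "gap 1 M N"
  shows "\<exists>b :: nat \<Rightarrow> nat. b 0 = 0 \<and> strict_mono b \<and>
    (\<forall>S S'. infinite (S - S') \<longrightarrow> gap 2 (M \<union> N \<inter> layers b S') (M \<union> N \<inter> layers b S))"
proof -
  define Q where "Q i b b' \<longleftrightarrow> b < b' \<and> (\<exists>G. stack i G \<and> (\<forall>j<i. G j \<subseteq> N \<inter> {b<..b'}) \<and>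
     card (\<Union>j<i. G j) \<le> b' \<and> (\<forall>a\<in>(\<Union>j<i. G j). card {m \<in> M. m < card (\<Union>j<i. G j)} \<le> a))" for i b b'
  have "\<exists>b. \<forall>i. (i = 0 \<longrightarrow> b i = 0) \<and> Q i (b i) (b (Suc i))"
  proof (rule dependent_nat_choice)
    fix b i :: nat
    obtain G where G: "stack i G" "\<And>j. j < i \<Longrightarrow> G j \<subseteq> N \<inter> {b<..}"
      "\<And>a. a \<in> (\<Union>j<i. G j) \<Longrightarrow> card {m \<in> M. m < card (\<Union>j<i. G j)} \<le> 1 * a"
      using gap by (rule gapE) (rule that)
    have fin: "finite (\<Union>j<i. G j)" using stackD(1)[OF G(1)] by auto
    obtain h where h: "\<And>n. n \<in> (\<Union>j<i. G j) \<Longrightarrow> n \<le> h"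
      using fin unfolding finite_nat_set_iff_bounded_le by blast
    let ?b' = "Suc (max b (max h (card (\<Union>j<i. G j))))"
    have sub: "G j \<subseteq> N \<inter> {b<..?b'}" if "j < i" for j
    proof
      fix n assume n: "n \<in> G j"
      then have "n \<in> (\<Union>j<i. G j)" using that by blast
      then show "n \<in> N \<inter> {b<..?b'}" using h[of n] G(2)[OF that] n by auto
    qed
    have "Q i b ?b'"
      unfolding Q_def
    proof (intro conjI exI[of _ G] allI impI ballI)
      show "G j \<subseteq> N \<inter> {b<..?b'}" if "j < i" for j using sub[OF that] .
      show "card {m \<in> M. m < card (\<Union>j<i. G j)} \<le> a" if "a \<in> (\<Union>j<i. G j)" for a
        using G(3)[OF that] by simp
    qed (use G(1) in auto)
    then show "\<exists>b'. (Suc i = 0 \<longrightarrow> b' = 0) \<and> Q i b b'" by (intro exI[of _ ?b']) simp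
  qed simp
  then obtain b where b: "b 0 = 0" "\<And>i. Q i (b i) (b (Suc i))" by blast
  have sm: "strict_mono b" using b(2) unfolding Q_def by (intro strict_monoI_Suc) blast
  have "gap 2 (M \<union> N \<inter> layers b S') (M \<union> N \<inter> layers b S)" if SS': "infinite (S - S')" for S S'
    unfolding gap_def
  proof (intro allI)
    fix c t
    obtain i where i: "max c t < i" "i \<in> S - S'"
      using SS' unfolding infinite_nat_iff_unbounded by blast
    obtain G where G: "stack i G" "\<And>j. j < i \<Longrightarrow> G j \<subseteq> N \<inter> {b i<..b (Suc i)}"
      and cardW: "card (\<Union>j<i. G j) \<le> b (Suc i)"
      and few: "\<And>a. a \<in> (\<Union>j<i. G j) \<Longrightarrow> card {m \<in> M. m < card (\<Union>j<i. G j)} \<le> a"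
      using b(2)[of i] unfolding Q_def by (elim conjE exE) (rule that, auto)
    have ti: "t \<le> i" using i(1) by simp
    have bi: "i \<le> b i" using sm by (rule strict_mono_imp_increasing)
    define W where "W = (\<Union>j<i. G j)"
    define X where "X = (\<Union>j<t. G j)"
    have XW: "X \<subseteq> W" unfolding X_def W_def using ti by (intro UN_mono) auto
    have finW: "finite W" unfolding W_def using stackD(1)[OF G(1)] by auto
    have WL: "W \<subseteq> N \<inter> {b i<..b (Suc i)}" unfolding W_def using G(2) by blast
    have cardX: "card X \<le> card W" using finW XW by (rule card_mono)
    have earlier: "{m \<in> N \<inter> layers b S'. m < card X} \<subseteq> {1..b i}"
    proof
      fix m assume m: "m \<in> {m \<in> N \<inter> layers b S'. m < card X}"
      then obtain k where k: "k \<in> S'" "b k < m" "m \<le> b (Suc k)" unfolding layers_def by auto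
      have "m < b (Suc i)" using m cardX cardW unfolding W_def by simp
      then have "k < Suc i" using k(2) sm by (metis less_trans strict_mono_less)
      moreover have "k \<noteq> i" using k(1) i(2) by blast
      ultimately have "Suc k \<le> i" by simp
      then have "b (Suc k) \<le> b i" using sm by (simp add: strict_mono_less_eq)
      then show "m \<in> {1..b i}" using k(2,3) by simp
    qed
    have count: "card {m \<in> M \<union> N \<inter> layers b S'. m < card X} \<le> 2 * a" if a: "a \<in> X" for a
    proof -
      have "{m \<in> M \<union> N \<inter> layers b S'. m < card X} \<subseteq> {m \<in> M. m < card W} \<union> {1..b i}"
        using earlier cardX by auto
      then have "card {m \<in> M \<union> N \<inter> layers b S'. m < card X} \<le> card ({m \<in> M. m < card W} \<union> {1..b i})"
        by (intro card_mono) auto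
      also have "\<dots> \<le> card {m \<in> M. m < card W} + card {1..b i}" by (rule card_Un_le)
      also have "\<dots> \<le> a + a"
      proof (rule add_mono)
        have aW: "a \<in> W" using a XW by blast
        then show "card {m \<in> M. m < card W} \<le> a" using few unfolding W_def by blast
        show "card {1..b i} \<le> a" using aW WL by auto
      qed
      finally show ?thesis by simp
    qed
    have "G j \<subseteq> (M \<union> N \<inter> layers b S) \<inter> {c<..}" if "j < t" for j
    proof -
      have "G j \<subseteq> N \<inter> {b i<..b (Suc i)}" using G(2) that ti by simp
      moreover have "{b i<..b (Suc i)} \<subseteq> layers b S" unfolding layers_def using i(2) by blast
      moreover have "c < b i" using i(1) bi by simp
      ultimately show ?thesis by fastforce
    qed
    then show "\<exists>G. stack t G \<and> (\<forall>i<t. G i \<subseteq> (M \<union> N \<inter> layers b S) \<inter> {c<..}) \<and>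
      (\<forall>a\<in>(\<Union>i<t. G i). card {m \<in> M \<union> N \<inter> layers b S'. m < card (\<Union>i<t. G i)} \<le> 2 * a)"
      using stack_mono[OF G(1) ti] count unfolding X_def by (intro exI[of _ G]) simp
  qed
  then show ?thesis using b(1) sm by blast
qed

lemma layers_Un: "layers b (S \<union> S') = layers b S \<union> layers b S'"
  by (auto simp: layers_def)

lemma layers_UNIV:
  assumes "b 0 = 0" "strict_mono b"
  shows "{1..} \<subseteq> layers b UNIV"
proof
  fix n :: nat assume "n \<in> {1..}"
  then have n: "0 < n" by simp
  have "n \<le> b n" using assms(2) by (rule strict_mono_imp_increasing)
  define k where "k = (LEAST k. n \<le> b k)"
  have k: "n \<le> b k" unfolding k_def using \<open>n \<le> b n\<close> by (rule LeastI)
  have "k \<noteq> 0" using k n assms(1) by (metis not_le)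
  then obtain i where i: "k = Suc i" using not0_implies_Suc by blast
  have "\<not> n \<le> b i" using not_less_Least[of i "\<lambda>k. n \<le> b k"] i unfolding k_def by simp
  then have "n \<in> {b i<..b (Suc i)}" using k i by simp
  then show "n \<in> layers b UNIV" unfolding layers_def by blast
qed

lemma layers_Diff_finite:
  assumes "finite (S - S')"
  shows "finite (layers b S - layers b S')"
proof (rule finite_subset)
  show "layers b S - layers b S' \<subseteq> (\<Union>i\<in>S - S'. {b i<..b (Suc i)})" unfolding layers_def by blast
qed (use assms in auto)

text \<open>
  Far out, every stack in \<open>N\<close> starts above the number of elements of \<open>M\<close>.
\<close>

lemma finite_imp_gap:
  assumes "finite M" "infinite N" "1 \<le> c"
  shows "gap c M N"
  unfolding gap_def
proof (intro allI)
  fix b t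
  obtain G where G: "\<And>t. stack t G" "\<And>i. G i \<subseteq> N \<inter> {max b (card M)<..}"
    using infinite_stack[OF assms(2)] by metis
  have "card {m \<in> M. m < k} \<le> c * a" if "a \<in> (\<Union>i<t. G i)" for a k
  proof -
    have "card {m \<in> M. m < k} \<le> card M" using assms(1) by (intro card_mono) auto
    also have "\<dots> \<le> 1 * a" using that G(2) by fastforce
    also have "\<dots> \<le> c * a" using \<open>1 \<le> c\<close> by (rule mult_le_mono1)
    finally show ?thesis .
  qed
  then show "\<exists>G. stack t G \<and> (\<forall>i<t. G i \<subseteq> N \<inter> {b<..}) \<and>
     (\<forall>a\<in>(\<Union>i<t. G i). card {m \<in> M. m < card (\<Union>i<t. G i)} \<le> c * a)"
    using G by (intro exI[of _ G]) fastforce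
qed


section \<open>Chains of spatial ideals\<close>

context schreier_space
begin

text \<open>
  The set \<open>L S\<close> contains, besides \<open>M\<close>, the part of \<open>N\<close> in the intervals with index in \<open>S\<close>. The intervals are finite, so only
  the differences of index sets modulo finite sets are seen by the ideals; by the choice of the intervals they are indeed seen.
\<close>

lemma spatial_interpolation:
  assumes M: "M \<noteq> {}" "M \<subseteq> N" and N: "N \<subseteq> {1..}" and notin: "proj N \<notin> spatial M"
  shows "\<exists>L :: nat set \<Rightarrow> nat set. L {} = M \<and> L UNIV = N \<and> (\<forall>S S'. L (S \<union> S') = L S \<union> L S') \<and>
    (\<forall>S S'. spatial (L S) \<subseteq> spatial (L S') \<longleftrightarrow> finite (S - S'))"
proof -
  have infN: "infinite N"
  proof
    assume "finite N"
    then have "proj N \<in> spatial M"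
      using proj_in_opideal_mod_finite[OF spatial_opideal proj_in_spatial M(1), of N] M N by auto
    then show False using notin by blast
  qed
  have "gap 1 M N" using no_gap_imp_proj_in_spatial[OF N infN M(2)] notin by blast
  then obtain b where b: "b 0 = 0" "strict_mono b"
    "\<And>S S'. infinite (S - S') \<Longrightarrow> gap 2 (M \<union> N \<inter> layers b S') (M \<union> N \<inter> layers b S)"
    using gap_layers[OF N] by metis
  define L where "L S = M \<union> N \<inter> layers b S" for S
  have LN: "L S \<subseteq> {1..}" "L S \<noteq> {}" for S using M N unfolding L_def by auto
  have "spatial (L S) \<subseteq> spatial (L S') \<longleftrightarrow> finite (S - S')" for S S'
  proof
    assume "spatial (L S) \<subseteq> spatial (L S')"
    then have "proj (L S) \<in> spatial (L S')" unfolding spatial_subset_iff .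
    then show "finite (S - S')"
      using gap_imp_proj_notin_spatial[OF LN(1) LN(1)] b(3)[of S S'] unfolding L_def by blast
  next
    assume "finite (S - S')"
    then have "finite (layers b S - layers b S')" by (rule layers_Diff_finite)
    moreover have "L S - L S' \<subseteq> layers b S - layers b S'" unfolding L_def by blast
    ultimately have "finite (L S - L S')" using finite_subset by blast
    then show "spatial (L S) \<subseteq> spatial (L S')"
      by (rule spatial_mono_mod_finite[OF LN(2) LN(1) LN(1)])
  qed
  moreover have "L UNIV = N" unfolding L_def using layers_UNIV[OF b(1,2)] M N by blast
  moreover have "L {} = M" unfolding L_def layers_def by simp
  moreover have "L (S \<union> S') = L S \<union> L S'" for S S' unfolding L_def layers_Un by blast
  ultimately show ?thesis by - (intro exI[of _ L] conjI allI)
qed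

lemma opideal_sum:
  assumes I: "opideal I" and J: "opideal J"
  shows "opideal {S + T | S T. S \<in> I \<and> T \<in> J}"
  unfolding opideal_def
proof (intro conjI ballI)
  let ?K = "{S + T | S T. S \<in> I \<and> T \<in> J}"
  show "?K \<subseteq> operators" using opidealD(1)[OF I] opidealD(1)[OF J] operator_add by blast
  show "0 \<in> ?K" using opidealD(2)[OF I] opidealD(2)[OF J] by (metis (mono_tags, lifting) add_0 mem_Collect_eq)
  fix A assume "A \<in> ?K"
  then obtain S T where A: "A = S + T" "S \<in> I" "T \<in> J" by blast
  show "A + B \<in> ?K" if BK: "B \<in> ?K" for B
  proof -
    obtain S' T' where B: "B = S' + T'" "S' \<in> I" "T' \<in> J" using BK by blast
    have "A + B = (S + S') + (T + T')" using A B by simp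
    then show ?thesis using opidealD(3)[OF I A(2) B(2)] opidealD(3)[OF J A(3) B(3)] by blast
  qed
  fix U assume U: "U \<in> operators"
  have "U o\<^sub>L A = (U o\<^sub>L S) + (U o\<^sub>L T)" "A o\<^sub>L U = (S o\<^sub>L U) + (T o\<^sub>L U)"
    unfolding A(1) by (rule blinfun_eqI; simp add: blinfun.add_left blinfun.add_right)+
  then show "U o\<^sub>L A \<in> ?K" "A o\<^sub>L U \<in> ?K"
    using opidealD(4,5)[OF I A(2) U] opidealD(4,5)[OF J A(3) U] by blast+
qed

lemma opideal_Union_chain:
  assumes ne: "\<Gamma> \<noteq> {}" and op: "\<And>I. I \<in> \<Gamma> \<Longrightarrow> opideal I"
    and chain: "\<And>I J. I \<in> \<Gamma> \<Longrightarrow> J \<in> \<Gamma> \<Longrightarrow> I \<subseteq> J \<or> J \<subseteq> I"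
  shows "opideal (\<Union>\<Gamma>)"
  unfolding opideal_def
proof (intro conjI ballI)
  show "\<Union>\<Gamma> \<subseteq> operators" using opidealD(1)[OF op] by blast
  show "0 \<in> \<Union>\<Gamma>" using opidealD(2)[OF op] ne by blast
  fix S assume "S \<in> \<Union>\<Gamma>"
  then obtain I where I: "I \<in> \<Gamma>" "S \<in> I" by blast
  show "S + T \<in> \<Union>\<Gamma>" if T: "T \<in> \<Union>\<Gamma>" for T
  proof -
    obtain J where J: "J \<in> \<Gamma>" "T \<in> J" using T by blast
    from chain[OF I(1) J(1)] show ?thesis
    proof
      assume "I \<subseteq> J"
      then have "S + T \<in> J" using I J by (intro opidealD(3)[OF op[OF J(1)]]) auto
      then show ?thesis using J(1) by blast
    next
      assume "J \<subseteq> I"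
      then have "S + T \<in> I" using I J by (intro opidealD(3)[OF op[OF I(1)]]) auto
      then show ?thesis using I(1) by blast
    qed
  qed
  fix U assume "U \<in> operators"
  then show "U o\<^sub>L S \<in> \<Union>\<Gamma>" "S o\<^sub>L U \<in> \<Union>\<Gamma>"
    using opidealD(4,5)[OF op[OF I(1)] I(2)] I(1) by blast+
qed

text \<open>
  For each member \<open>A\<close> of an almost disjoint family take a maximal chain among the ideals that belong to
  the complements of infinite subsets of \<open>A\<close>. The complements of subsets of different members cover all but finitely many
  indices, so ideals from different chains add up to the largest one. A pseudo-intersection shows that no countable
  subset of such a chain is cofinal. Hence the chain is uncountable, its union is closed because a
  convergent sequence lies in one member, and the union is not spatial because a
  generating projection would lie in a member, which would then be the largest.
\<close>

theorem spatial_chains: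
  assumes M: "M \<noteq> {}" "M \<subseteq> N" and N: "N \<subseteq> {1..}" and notin: "proj N \<notin> spatial M"
  shows "\<exists>(\<Delta> :: nat set set) \<Gamma>. \<Delta> \<approx> (UNIV :: real set) \<and>
    (\<forall>A\<in>\<Delta>. uncountable (\<Gamma> A) \<and> chain\<^sub>\<subseteq> (\<Gamma> A) \<and>
      (\<forall>I\<in>\<Gamma> A. I \<in> spatial_ideals smul \<iota> \<and> spatial M \<subset> I \<and> I \<subset> spatial N) \<and>
      opideal (\<Union>(\<Gamma> A)) \<and> closed (\<Union>(\<Gamma> A)) \<and> \<Union>(\<Gamma> A) \<notin> spatial_ideals smul \<iota>) \<and>
    (\<forall>A\<in>\<Delta>. \<forall>B\<in>\<Delta>. A \<noteq> B \<longrightarrow> (\<forall>I\<in>\<Gamma> A. \<forall>J\<in>\<Gamma> B. proj N \<in> {S + T | S T. S \<in> I \<and> T \<in> J}))"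
proof -
  from spatial_interpolation[OF assms] obtain L :: "nat set \<Rightarrow> nat set" where L0: "L {} = M" "L UNIV = N"
    "\<forall>S S'. L (S \<union> S') = L S \<union> L S'"
    "\<forall>S S'. spatial (L S) \<subseteq> spatial (L S') \<longleftrightarrow> finite (S - S')" by (elim exE conjE)
  note L = L0(1,2) L0(3)[rule_format] and sub_iff = L0(4)[rule_format]
  have LN: "L S \<subseteq> {1..}" for S
  proof -
    have "L S \<subseteq> L (S \<union> UNIV)" unfolding L(3) by blast
    then show ?thesis using L(2) N by simp
  qed
  have M_sub: "M \<subseteq> L S" for S
  proof -
    have "L {} \<subseteq> L (S \<union> {})" unfolding L(3) by blast
    then show ?thesis using L(1) by simp
  qed
  have L_ne: "L S \<noteq> {}" for S using M_sub M(1) by blast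
  from almost_disjoint_family obtain \<Delta> :: "nat set set" where \<Delta>0: "\<Delta> \<approx> (UNIV :: real set)"
    "\<forall>A\<in>\<Delta>. infinite A" "\<forall>A\<in>\<Delta>. \<forall>B\<in>\<Delta>. A \<noteq> B \<longrightarrow> finite (A \<inter> B)" by (elim exE conjE)
  note \<Delta> = \<Delta>0(1) \<Delta>0(2,3)[rule_format]
  have co: "infinite (- A)" if A: "A \<in> \<Delta>" for A
  proof -
    have "infinite \<Delta>"
      using eqpoll_finite_iff[OF \<Delta>(1)] infinite_UNIV_char_0[where 'a = real] by simp
    then have "\<not> \<Delta> \<subseteq> {A}" using finite_subset[of \<Delta> "{A}"] by auto
    then obtain B where B: "B \<in> \<Delta>" "A \<noteq> B" by blast
    have "infinite (B - A \<inter> B)" using Diff_infinite_finite[OF \<Delta>(3)[OF A B] \<Delta>(2)[OF B(1)]] .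
    moreover have "B - A \<inter> B \<subseteq> - A" by blast
    ultimately show ?thesis using finite_subset by blast
  qed
  define P where "P A = {spatial (L (- B)) | B. B \<subseteq> A \<and> infinite B}" for A
  define \<Gamma> where "\<Gamma> A = (SOME C. subset.maxchain (P A) C)" for A
  have max: "subset.maxchain (P A) (\<Gamma> A)" for A
    unfolding \<Gamma>_def using subset.Hausdorff by (rule someI_ex)
  have chain: "subset.chain (P A) (\<Gamma> A)" for A using max by (rule subset.maxchain_imp_chain)
  have \<Gamma>P: "\<Gamma> A \<subseteq> P A" and lin: "\<And>I J. I \<in> \<Gamma> A \<Longrightarrow> J \<in> \<Gamma> A \<Longrightarrow> I \<subseteq> J \<or> J \<subseteq> I" for A
    using chain[of A] unfolding subset_chain_def by blast+
  have members: "I \<in> spatial_ideals smul \<iota> \<and> spatial M \<subset> I \<and> I \<subset> spatial N \<and> opideal I \<and> closed I"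
    if A: "A \<in> \<Delta>" and I: "I \<in> \<Gamma> A" for A I
  proof -
    obtain B where B: "B \<subseteq> A" "infinite B" "I = spatial (L (- B))" using I \<Gamma>P unfolding P_def by blast
    have "infinite (- B)" using co[OF A] B(1) by (meson Compl_subset_Compl_iff finite_subset)
    then have "spatial M \<subset> I"
      using sub_iff[of "{}" "- B"] sub_iff[of "- B" "{}"] unfolding L(1) B(3) by auto
    moreover have "I \<subset> spatial N"
      using sub_iff[of UNIV "- B"] sub_iff[of "- B" UNIV] B(2) unfolding L(2) B(3) by (auto simp: Compl_eq_Diff_UNIV[symmetric])
    moreover have "I \<in> spatial_ideals smul \<iota>"
      unfolding spatial_ideals_eq B(3) using LN L_ne by blast
    ultimately show ?thesis unfolding B(3) using spatial_opideal closed_spatial by blast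
  qed
  have bound: "\<exists>Y\<in>\<Gamma> A. \<forall>c\<in>C. c \<subset> Y" if A: "A \<in> \<Delta>" and C: "countable C" "C \<subseteq> \<Gamma> A" for A C
  proof (rule maxchain_strict_bound[OF max C(2)])
    show "\<exists>X\<in>P A. \<forall>c\<in>C. c \<subset> X"
    proof (cases "C = {}")
      case True
      then show ?thesis unfolding P_def using \<Delta>(2)[OF A] by blast
    next
      case False
      have "\<forall>i. \<exists>B. B \<subseteq> A \<and> infinite B \<and> from_nat_into C i = spatial (L (- B))"
      proof
        fix i
        have "from_nat_into C i \<in> P A" using from_nat_into[OF False, of i] C(2) \<Gamma>P[of A] by blast
        then show "\<exists>B. B \<subseteq> A \<and> infinite B \<and> from_nat_into C i = spatial (L (- B))"
          unfolding P_def by blast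
      qed
      from choice[OF this] obtain B where B0: "\<forall>i. B i \<subseteq> A \<and> infinite (B i) \<and>
        from_nat_into C i = spatial (L (- B i))" by (elim exE)
      have B: "B i \<subseteq> A" "infinite (B i)" "from_nat_into C i = spatial (L (- B i))" for i
        using B0[rule_format, of i] by simp_all
      have diff: "- X - - Y = Y - X" for X Y :: "nat set" by blast
      have "finite (B i - B j) \<or> finite (B j - B i)" for i j
      proof -
        have "from_nat_into C i \<in> \<Gamma> A" "from_nat_into C j \<in> \<Gamma> A"
          using from_nat_into[OF False] C(2) by blast+
        then show ?thesis using lin[of "from_nat_into C i" A "from_nat_into C j"]
          unfolding B(3) sub_iff diff by (simp add: disj_commute)
      qed
      from pseudo_intersection[of B, OF B(2) this] obtain D where D0: "infinite D" "D \<subseteq> B 0"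
        "\<forall>i. finite (D - B i) \<and> infinite (B i - D)" by (elim exE conjE)
      have D: "finite (D - B i)" "infinite (B i - D)" for i using D0(3)[rule_format, of i] by simp_all
      have "c \<subset> spatial (L (- D))" if c: "c \<in> C" for c
      proof -
        obtain i where i: "c = from_nat_into C i"
          using from_nat_into_surj[OF C(1) c] by metis
        show ?thesis
          unfolding i B(3) psubset_eq set_eq_subset sub_iff diff using D[of i] by simp
      qed
      moreover have "spatial (L (- D)) \<in> P A" unfolding P_def using D0(1,2) B(1)[of 0] by blast
      ultimately show ?thesis by blast
    qed
  qed
  have "uncountable (\<Gamma> A) \<and> chain\<^sub>\<subseteq> (\<Gamma> A) \<and>
      opideal (\<Union>(\<Gamma> A)) \<and> closed (\<Union>(\<Gamma> A)) \<and> \<Union>(\<Gamma> A) \<notin> spatial_ideals smul \<iota>" if A: "A \<in> \<Delta>" for A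
  proof (intro conjI)
    have ne: "\<Gamma> A \<noteq> {}" using bound[OF A, of "{}"] by auto
    show "uncountable (\<Gamma> A)"
    proof
      assume "countable (\<Gamma> A)"
      then show False using bound[OF A, of "\<Gamma> A"] by blast
    qed
    show "chain\<^sub>\<subseteq> (\<Gamma> A)" unfolding chain_subset_def using lin by blast
    show "opideal (\<Union>(\<Gamma> A))" using ne members[OF A] lin by (intro opideal_Union_chain) blast+
    show "closed (\<Union>(\<Gamma> A))"
      unfolding closed_sequential_limits
    proof (intro allI impI, elim conjE)
      fix x l assume x: "\<forall>n. x n \<in> \<Union>(\<Gamma> A)" and lim: "x \<longlonglongrightarrow> l"
      have "\<forall>n. \<exists>I. I \<in> \<Gamma> A \<and> x n \<in> I" using x by blast
      then obtain I where I: "\<And>n. I n \<in> \<Gamma> A" "\<And>n. x n \<in> I n" by metis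
      obtain Y where Y: "Y \<in> \<Gamma> A" "\<And>n. I n \<subset> Y" using bound[OF A, of "range I"] I(1) by auto
      have "\<And>n. x n \<in> Y" using I(2) Y(2) by blast
      then have "l \<in> Y" using members[OF A Y(1)] lim unfolding closed_sequential_limits by blast
      then show "l \<in> \<Union>(\<Gamma> A)" using Y(1) by blast
    qed
    show "\<Union>(\<Gamma> A) \<notin> spatial_ideals smul \<iota>"
    proof
      assume "\<Union>(\<Gamma> A) \<in> spatial_ideals smul \<iota>"
      then obtain Q where Q: "\<Union>(\<Gamma> A) = spatial Q" unfolding spatial_ideals_eq by blast
      then obtain Z where Z: "Z \<in> \<Gamma> A" "proj Q \<in> Z" using proj_in_spatial by blast
      have "spatial Q \<subseteq> Z" using members[OF A Z(1)] Z(2) by (intro spatial_least) auto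
      moreover obtain Y where "Y \<in> \<Gamma> A" "Z \<subset> Y" using bound[OF A, of "{Z}"] Z(1) by auto
      ultimately show False using Q by blast
    qed
  qed
  moreover have "proj N \<in> {S + T | S T. S \<in> I \<and> T \<in> J}"
    if A: "A \<in> \<Delta>" and A': "A' \<in> \<Delta>" and ne: "A \<noteq> A'" and I: "I \<in> \<Gamma> A" and J: "J \<in> \<Gamma> A'" for A A' I J
  proof -
    obtain B where B: "B \<subseteq> A" "I = spatial (L (- B))" using I \<Gamma>P unfolding P_def by blast
    obtain B' where B': "B' \<subseteq> A'" "J = spatial (L (- B'))" using J \<Gamma>P unfolding P_def by blast
    have "finite (B \<inter> B')" using \<Delta>(3)[OF A A' ne] B(1) B'(1) by (meson Int_mono finite_subset)
    moreover have "UNIV - (- B) - (- B') = B \<inter> B'" by blast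
    ultimately have fin: "finite (UNIV - (- B) - (- B'))" by simp
    have "UNIV = - B \<union> (UNIV - (- B))" by blast
    then have Neq: "N = L (- B) \<union> L (UNIV - (- B))" using L(2,3) by metis
    have "spatial (L (UNIV - (- B))) \<subseteq> spatial (L (- B'))" using sub_iff fin by blast
    then have "proj (L (UNIV - (- B))) \<in> J" unfolding spatial_subset_iff B'(2) .
    then have "proj (L (UNIV - - B) - L (- B)) \<in> J"
    proof -
      have "proj (L (UNIV - - B) - L (- B)) = proj (L (UNIV - - B) - L (- B)) o\<^sub>L proj (L (UNIV - - B))"
        by (simp add: proj_compose Int_absorb2 Diff_subset)
      then show ?thesis
        using opidealD(4)[OF spatial_opideal] proj_operator \<open>proj (L (UNIV - (- B))) \<in> J\<close> unfolding B'(2) by metis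
    qed
    moreover have "proj (L (- B)) \<in> I" unfolding B(2) by (rule proj_in_spatial)
    moreover have "proj N = proj (L (- B)) + proj (L (UNIV - - B) - L (- B))"
    proof -
      have "N = L (- B) \<union> (L (UNIV - - B) - L (- B))" using Neq by blast
      then show ?thesis using proj_Un[of "L (- B)" "L (UNIV - - B) - L (- B)"] by (metis Diff_disjoint)
    qed
    ultimately show ?thesis by blast
  qed
  ultimately show ?thesis
    using \<Delta>(1) members
    by - (rule exI[of _ \<Delta>], rule exI[of _ \<Gamma>], intro conjI ballI impI; (assumption | simp))
qed


section \<open>Maximal ideals\<close>

lemma opideal_eq_operators:
  assumes "opideal I" "id_blinfun \<in> I"
  shows "I = operators"
proof
  show "I \<subseteq> operators" using opidealD(1)[OF assms(1)] by blast
  show "operators \<subseteq> I"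
  proof
    fix T assume "T \<in> operators"
    then have "T o\<^sub>L id_blinfun \<in> I" using opidealD(4)[OF assms] by blast
    moreover have "T o\<^sub>L id_blinfun = T" by (rule blinfun_eqI) simp
    ultimately show "T \<in> I" by simp
  qed
qed

lemma proper_ideal_subset_maximal:
  assumes I: "opideal I" "id_blinfun \<notin> I"
  shows "\<exists>K. maximalideal K (operator_algebra smul) \<and> I \<subseteq> K"
proof -
  define \<A> where "\<A> = {K. opideal K \<and> I \<subseteq> K \<and> id_blinfun \<notin> K}"
  have "\<exists>K\<in>\<A>. \<forall>X\<in>\<A>. K \<subseteq> X \<longrightarrow> X = K"
  proof (rule subset_Zorn_nonempty)
    show "\<A> \<noteq> {}" unfolding \<A>_def using I by blast
    fix C assume C: "C \<noteq> {}" "subset.chain \<A> C"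
    have CA: "K \<in> C \<Longrightarrow> K \<in> \<A>" and lin: "J \<in> C \<Longrightarrow> K \<in> C \<Longrightarrow> J \<subseteq> K \<or> K \<subseteq> J" for J K
      using C(2) unfolding subset_chain_def by blast+
    have "opideal (\<Union>C)"
      using C(1) CA lin by (intro opideal_Union_chain) (auto simp: \<A>_def)
    moreover have "I \<subseteq> \<Union>C" using C(1) CA unfolding \<A>_def by blast
    moreover have "id_blinfun \<notin> \<Union>C" using CA unfolding \<A>_def by blast
    ultimately show "\<Union>C \<in> \<A>" unfolding \<A>_def by blast
  qed
  then obtain K where K0: "K \<in> \<A>" "\<forall>X\<in>\<A>. K \<subseteq> X \<longrightarrow> X = K" by (elim bexE)
  have K: "opideal K" "I \<subseteq> K" "id_blinfun \<notin> K" using K0(1) unfolding \<A>_def by simp_all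
  have max: "X = K" if "opideal X" "I \<subseteq> X" "id_blinfun \<notin> X" "K \<subseteq> X" for X
  proof -
    have "X \<in> \<A>" unfolding \<A>_def using that by simp
    then show ?thesis using K0(2) that(4) by simp
  qed
  have "maximalideal K (operator_algebra smul)"
  proof (rule maximalidealI)
    show "ideal K (operator_algebra smul)" unfolding ideal_iff_opideal by (rule K(1))
    show "operators \<noteq> K" using K(3) operator_id by blast
    fix J assume J: "ideal J (operator_algebra smul)" "K \<subseteq> J"
    have op: "opideal J" using J(1) unfolding ideal_iff_opideal .
    show "J = K \<or> J = operators"
    proof (cases "id_blinfun \<in> J")
      case True
      then show ?thesis using opideal_eq_operators[OF op] by simp
    next
      case False
      then show ?thesis using max[OF op _ False J(2)] K(2) J(2) by simp
    qed
  qed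
  then show ?thesis using K(2) by blast
qed

lemma spatial_ideals_opideal: "I \<in> spatial_ideals smul \<iota> \<Longrightarrow> opideal I"
  unfolding spatial_ideals_eq using spatial_opideal by blast

lemma id_notin_spatial_singleton: "proj {1..} \<notin> spatial {1}"
  by (intro gap_imp_proj_notin_spatial finite_imp_gap) (auto simp: infinite_Ici)

text \<open>
  Ideals between the compact operators and the whole algebra that belong to different members of the almost disjoint family
  have the identity in their sum, so no maximal ideal contains both of them.
\<close>

theorem continuum_many_maximal_ideals:
  "(UNIV :: real set) \<lesssim> {I. maximalideal I (operator_algebra smul)}"
proof -
  have "{1} \<subseteq> {1::nat..}" by simp
  from spatial_chains[OF insert_not_empty this order_refl id_notin_spatial_singleton]
  obtain \<Delta> :: "nat set set" and \<Gamma> where \<Delta>: "\<Delta> \<approx> (UNIV :: real set)"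
    and \<Gamma>: "\<forall>A\<in>\<Delta>. uncountable (\<Gamma> A) \<and> chain\<^sub>\<subseteq> (\<Gamma> A) \<and>
      (\<forall>I\<in>\<Gamma> A. I \<in> spatial_ideals smul \<iota> \<and> spatial {1} \<subset> I \<and> I \<subset> spatial {1..}) \<and>
      opideal (\<Union>(\<Gamma> A)) \<and> closed (\<Union>(\<Gamma> A)) \<and> \<Union>(\<Gamma> A) \<notin> spatial_ideals smul \<iota>"
    and sum: "\<forall>A\<in>\<Delta>. \<forall>B\<in>\<Delta>. A \<noteq> B \<longrightarrow>
      (\<forall>I\<in>\<Gamma> A. \<forall>J\<in>\<Gamma> B. proj {1..} \<in> {S + T | S T. S \<in> I \<and> T \<in> J})"
    by (elim exE conjE) (rule that)
  have "\<exists>K. maximalideal K (operator_algebra smul) \<and> (\<exists>I\<in>\<Gamma> A. I \<subseteq> K)" if A: "A \<in> \<Delta>" for A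
  proof -
    note \<Gamma>A = bspec[OF \<Gamma> A, THEN conjunct1]
      bspec[OF \<Gamma> A, THEN conjunct2, THEN conjunct2, THEN conjunct1]
    have "\<Gamma> A \<noteq> {}" using \<Gamma>A(1) by (metis countable_empty)
    then obtain I where I: "I \<in> \<Gamma> A" by blast
    have IS: "I \<in> spatial_ideals smul \<iota>" "I \<subset> operators"
      using bspec[OF \<Gamma>A(2) I] unfolding spatial_UNIV by blast+
    have op: "opideal I" using spatial_ideals_opideal[OF IS(1)] .
    have "id_blinfun \<notin> I" using opideal_eq_operators[OF op] IS(2) by blast
    from proper_ideal_subset_maximal[OF op this] show ?thesis using I by blast
  qed
  then have "\<forall>A\<in>\<Delta>. \<exists>K. maximalideal K (operator_algebra smul) \<and> (\<exists>I\<in>\<Gamma> A. I \<subseteq> K)" by (rule ballI)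
  from bchoice[OF this] obtain K where
    K0: "\<forall>A\<in>\<Delta>. maximalideal (K A) (operator_algebra smul) \<and> (\<exists>I\<in>\<Gamma> A. I \<subseteq> K A)" by (elim exE)
  have K: "maximalideal (K A) (operator_algebra smul)" "\<exists>I\<in>\<Gamma> A. I \<subseteq> K A" if "A \<in> \<Delta>" for A
    using bspec[OF K0 that] by blast+
  have "inj_on K \<Delta>"
  proof (rule inj_onI, rule ccontr)
    fix A B assume A: "A \<in> \<Delta>" and B: "B \<in> \<Delta>" and eq: "K A = K B" and ne: "A \<noteq> B"
    interpret maximalideal "K A" "operator_algebra smul" by (rule K(1)[OF A])
    have op: "opideal (K A)" using is_ideal unfolding ideal_iff_opideal .
    obtain I J where I: "I \<in> \<Gamma> A" "I \<subseteq> K A" and J: "J \<in> \<Gamma> B" "J \<subseteq> K A"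
      using K(2)[OF A] K(2)[OF B] eq by auto
    have "proj {1..} \<in> {S + T | S T. S \<in> I \<and> T \<in> J}"
      using sum[rule_format, OF A B ne I(1) J(1)] .
    then obtain S T where ST: "proj {1..} = S + T" "S \<in> K A" "T \<in> K A" using I(2) J(2) by blast
    have "id_blinfun \<in> K A" using opidealD(3)[OF op ST(2,3)] unfolding ST(1)[symmetric] proj_UNIV .
    then show False using opideal_eq_operators[OF op] I_notcarr by simp
  qed
  then have "\<Delta> \<lesssim> {I. maximalideal I (operator_algebra smul)}"
    unfolding lepoll_def using K(1) by blast
  then show ?thesis
    using \<Delta> by (meson eqpoll_imp_lepoll eqpoll_sym lepoll_trans)
qed


section \<open>A non-strictly-singular operator in all spatial ideals\<close>

lemma stack_index_less:
  assumes G: "stack t G" and "i < t" "n \<in> G i"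
  shows "i < n"
proof -
  have "i < card (G i)" using \<open>i < t\<close>
  proof (induction i)
    case 0
    then show ?case using stackD(2)[OF G] by simp
  next
    case (Suc i)
    have "card (G i) < card (G (Suc i))"
      using stack_less[OF G _ Suc.prems stackD(3)[OF G] stackD(3)[OF G Suc.prems]] Suc.prems by simp
    then show ?case using Suc by simp
  qed
  also have "\<dots> \<le> n" using stackD(4)[OF G] assms by blast
  finally show ?thesis .
qed

lemma infinite_stack_disjoint:
  assumes "\<And>t. stack t G" "i \<noteq> j"
  shows "G i \<inter> G j = {}"
  by (rule stack_disjoint[OF assms(1), of i "Suc (max i j)"]) (use assms(2) in auto)

text \<open>
  The coefficient of the functional dual to \<open>average G\<close>: the sum of the coordinates in \<open>G\<close> times \<open>coaverage G\<close>
  takes the value one on \<open>average G\<close>.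
\<close>

definition coaverage :: "nat set \<Rightarrow> 'k" where
  "coaverage G = of_real (real (card G) powr (1 / r - 1))"

text \<open>
  The normalised averages over the sets of an infinite stack span a copy of \<open>\<ell>\<^sub>p\<close> or \<open>c\<^sub>0\<close> that is complemented by
  the dual averages: the power mean inequality bounds the dual averages by the mass of a
  family of Schreier sets. Since the same estimate holds for all stacks, the copies belonging to different stacks are
  interchangeable.
\<close>

lemma block_operator:
  assumes G: "\<And>t. stack t G" and G': "\<And>t. stack t G'"
  shows "\<exists>T\<in>operators. (\<forall>i. T (\<iota> (average (G i))) = \<iota> (average (G' i))) \<and>
    (\<forall>i. \<forall>n\<in>G i. T (e n) = smul (coaverage (G i)) (\<iota> (average (G' i)))) \<and>
    (\<forall>n\<ge>1. n \<notin> (\<Union>i. G i) \<longrightarrow> T (e n) = 0)"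
proof -
  \<comment> \<open>the dual averages; the sum over all sets of \<open>G'\<close> is finite at \<open>m\<close>, because the elements of \<open>G' i\<close> exceed \<open>i\<close>\<close>
  define a where "a i x = (\<Sum>n\<in>G i. coaverage (G i) * x n)" for i and x :: "nat \<Rightarrow> 'k"
  define f where "f x m = (\<Sum>i\<le>m. a i x * average (G' i) m)" for x m
  have idx: "i < n" if "n \<in> G i" for i n using stack_index_less[OF G, of i "Suc i"] that by simp
  have idx': "i < n" if "n \<in> G' i" for i n using stack_index_less[OF G', of i "Suc i"] that by simp
  have avg0: "average (G' i) m = 0" if "m \<le> i" for i m
    using idx'[of m i] that by (auto simp: average_def)
  have card_pos: "0 < card (G i)" "finite (G i)" for i using stackD(1,2)[OF G, of i "Suc i"] by auto
  have avg_c00: "average (G i) \<in> c00" "average (G' i) \<in> c00" "norm (\<iota> (average (G' i))) \<le> 1" for i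
    using stack_schreier[OF G, of i "Suc i"] stack_schreier[OF G', of i "Suc i"]
      average_c00 norm_average by auto
  have a_powr: "norm (a i x) powr r \<le> (\<Sum>n\<in>G i. norm (x n) powr r)" for i x
  proof -
    let ?c = "real (card (G i))"
    have c: "0 < ?c" using card_pos by simp
    have "norm (a i x) \<le> (\<Sum>n\<in>G i. norm (coaverage (G i) * x n))" unfolding a_def by (rule norm_sum)
    also have "\<dots> = ?c powr (1 / r) * (\<Sum>n\<in>G i. (1 / ?c) * norm (x n))"
      unfolding sum_distrib_left using c
      by (intro sum.cong) (auto simp: coaverage_def norm_mult norm_divide powr_diff)
    finally have "norm (a i x) powr r \<le> (?c powr (1 / r) * (\<Sum>n\<in>G i. (1 / ?c) * norm (x n))) powr r"
      using r by (intro powr_mono2) auto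
    also have "\<dots> = ?c * (\<Sum>n\<in>G i. (1 / ?c) * norm (x n)) powr r"
      using r c by (subst powr_mult) (auto simp: powr_powr intro!: sum_nonneg)
    also have "\<dots> \<le> ?c * (\<Sum>n\<in>G i. (1 / ?c) * norm (x n) powr r)"
      using card_pos r by (intro mult_left_mono powr_weighted_sum_le) auto
    also have "\<dots> = (\<Sum>n\<in>G i. norm (x n) powr r)"
      unfolding sum_distrib_left using c by (intro sum.cong) auto
    finally show ?thesis .
  qed
  have f_eq: "\<exists>q. f x = (\<lambda>m. \<Sum>i<q. a i x * average (G' i) m)" if x: "x \<in> c00" for x
  proof -
    have "finite {n. x n \<noteq> 0}" using x by (simp add: c00_def)
    then obtain h where "\<forall>n\<in>{n. x n \<noteq> 0}. n \<le> h" unfolding finite_nat_set_iff_bounded_le by blast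
    then have h: "\<And>n. x n \<noteq> 0 \<Longrightarrow> n \<le> h" by blast
    have a0: "a i x = 0" if "h \<le> i" for i
      unfolding a_def
    proof (rule sum.neutral, rule ballI)
      fix n assume "n \<in> G i"
      then have "h < n" using idx that by (meson le_less_trans)
      then have "x n = 0" using h[of n] by (cases "x n = 0") auto
      then show "coaverage (G i) * x n = 0" by simp
    qed
    have "f x m = (\<Sum>i<h. a i x * average (G' i) m)" for m
    proof -
      have "f x m = (\<Sum>i\<le>m + h. a i x * average (G' i) m)"
        unfolding f_def using avg0 by (intro sum.mono_neutral_left) auto
      also have "\<dots> = (\<Sum>i<h. a i x * average (G' i) m)"
        using a0 by (intro sum.mono_neutral_right) auto
      finally show ?thesis .
    qed
    then show ?thesis by blast
  qed
  let ?C = "2 powr s * (1 powr (r * s) + 2 powr s)"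
  have "\<exists>T\<in>operators. \<forall>x\<in>c00. T (\<iota> x) = \<iota> (f x)"
  proof (rule extend_operator)
    fix x :: "nat \<Rightarrow> 'k" assume x: "x \<in> c00"
    obtain q where q: "f x = (\<lambda>m. \<Sum>i<q. a i x * average (G' i) m)" using f_eq[OF x] by blast
    show "f x \<in> c00" unfolding q using avg_c00 by (intro c00_sum c00_mult) auto
    have "norm (\<iota> (f x)) powr (r * s) \<le> ?C * norm (\<iota> x) powr (r * s)"
      unfolding q
    proof (rule block_sum)
      show "average (G' i) \<in> c00" "norm (\<iota> (average (G' i))) \<le> 1" for i using avg_c00 by auto
      show "n < m" if "i < j" "j < q" "average (G' i) n \<noteq> 0" "average (G' j) m \<noteq> 0" for i j n m
        using stack_less[OF G' that(1,2) average_in[OF that(3)] average_in[OF that(4)]] .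
      show "norm (average (G' j) m) powr r * (real n * 2 ^ (j - i)) \<le> 2"
        if "i < j" "j < q" "average (G' i) n \<noteq> 0" for i j n m
        using stack_average_decay[OF G' that(1,2) average_in[OF that(3)]] .
      fix I assume I: "I \<subseteq> {..<q}" "single \<longrightarrow> card I \<le> 1"
      have fam: "family single I G"
        unfolding family_def
      proof (intro conjI ballI impI)
        show "finite I" using I(1) finite_subset by blast
        show "G i \<in> schreier_sets" if "i \<in> I" for i using stackD(6)[OF G, of i "Suc i"] by simp
        show "a < b" if "i \<in> I" "j \<in> I" "i < j" "a \<in> G i" "b \<in> G j" for i j a b
          using stack_less[OF G that(3) lessI that(4,5)] .
      qed (use I(2) in blast)
      have "(\<Sum>i\<in>I. norm (a i x) powr (r * s)) \<le> mass r s x I G"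
        unfolding mass_def powr_powr[symmetric] using a_powr s by (intro sum_mono powr_mono2) auto
      also have "\<dots> \<le> norm (\<iota> x) powr (r * s)" by (rule mass_le_norm[OF x fam])
      finally show "(\<Sum>i\<in>I. norm (a i x) powr (r * s)) \<le> norm (\<iota> x) powr (r * s)" .
    qed
    then have "(norm (\<iota> (f x)) powr (r * s)) powr (1 / (r * s)) \<le> (?C * norm (\<iota> x) powr (r * s)) powr (1 / (r * s))"
      using rs by (intro powr_mono2) auto
    then show "norm (\<iota> (f x)) \<le> ?C powr (1 / (r * s)) * norm (\<iota> x)"
      using r s by (simp add: powr_powr powr_mult)
  next
    show "f (\<lambda>n. x n + y n) n = f x n + f y n" for x y n
      unfolding f_def a_def by (simp add: algebra_simps sum.distrib)
    show "f (\<lambda>n. c * x n) n = c * f x n" for c x n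
      unfolding f_def a_def by (simp add: sum_distrib_left sum_distrib_right mult_ac)
  qed
  then obtain T where T: "T \<in> operators" "\<And>x. x \<in> c00 \<Longrightarrow> T (\<iota> x) = \<iota> (f x)" by blast
  have disj: "n \<notin> G j" if "n \<in> G i" "i \<noteq> j" for i j n
    using infinite_stack_disjoint[OF G that(2)] that(1) by blast
  have single_f: "f x = (\<lambda>m. c * average (G' i) m)" if "\<And>j. a j x = (if j = i then c else 0)" for x i c
  proof
    fix m
    have "f x m = (\<Sum>j\<le>m. if j = i then c * average (G' i) m else 0)"
      unfolding f_def that by (intro sum.cong) auto
    also have "\<dots> = c * average (G' i) m" using avg0[of m i] by simp
    finally show "f x m = c * average (G' i) m" .
  qed
  have "T (\<iota> (average (G i))) = \<iota> (average (G' i))" for i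
  proof -
    have "a j (average (G i)) = (if j = i then 1 else 0)" for j
    proof (cases "j = i")
      case True
      have c: "0 < real (card (G i))" using card_pos by simp
      have "a i (average (G i)) = of_real (real (card (G i)) * (real (card (G i)) powr (1 / r - 1) * real (card (G i)) powr (- 1 / r)))"
        unfolding a_def coaverage_def by (simp add: average_def)
      also have "real (card (G i)) * (real (card (G i)) powr (1 / r - 1) * real (card (G i)) powr (- 1 / r)) = 1"
        unfolding powr_add[symmetric] using c by (simp add: powr_minus)
      finally show ?thesis using True by simp
    next
      case False
      then show ?thesis unfolding a_def using disj[of _ j i] by (auto simp: average_def intro!: sum.neutral)
    qed
    then have "f (average (G i)) = average (G' i)" using single_f[of "average (G i)" i 1] by simp
    then show ?thesis using T(2)[OF avg_c00(1)] by simp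
  qed
  moreover have "T (e n) = smul (coaverage (G i)) (\<iota> (average (G' i)))" if n: "n \<in> G i" for i n
  proof -
    have "a j (dirac n) = (if j = i then coaverage (G i) else 0)" for j
    proof -
      have "a j (dirac n) = (\<Sum>k\<in>G j. if k = n then coaverage (G j) else 0)"
        unfolding a_def by (intro sum.cong) auto
      also have "\<dots> = (if n \<in> G j then coaverage (G j) else 0)" using card_pos(2)[of j] by simp
      finally show ?thesis using n disj[OF n, of j] by auto
    qed
    then have "f (dirac n) = (\<lambda>m. coaverage (G i) * average (G' i) m)" by (rule single_f)
    moreover have "1 \<le> n" using idx[OF n] by simp
    ultimately show ?thesis
      unfolding unit_vector_def using T(2)[OF dirac_c00] \<iota>_scale[OF avg_c00(2)] by simp
  qed
  moreover have "T (e n) = 0" if n: "1 \<le> n" "n \<notin> (\<Union>i. G i)" for n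
  proof -
    have "a j (dirac n) = 0" for j unfolding a_def using n by (intro sum.neutral) auto
    then have "f (dirac n) = (\<lambda>_. 0)" unfolding f_def by auto
    then show ?thesis unfolding unit_vector_def using T(2)[OF dirac_c00[OF n(1)]] \<iota>_zero by simp
  qed
  ultimately show ?thesis using T(1) by blast
qed

text \<open>
  The projection onto the span of the averages over one stack factors, via the averages over a stack in \<open>N\<close>, through
  \<open>proj N\<close>. It is the identity on an infinite-dimensional subspace.
\<close>

theorem nonstrictly_singular_in_all_spatial:
  "\<exists>T. T \<notin> strictly_singular_operators smul \<and>
    (\<forall>N. N \<subseteq> {1..} \<longrightarrow> infinite N \<longrightarrow> T \<in> spatial N)"
proof -
  obtain G where G: "\<And>t. stack t G"
    using infinite_stack[of "UNIV :: nat set" 0] by auto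
  obtain T where T: "T \<in> operators" "\<And>i. T (\<iota> (average (G i))) = \<iota> (average (G i))"
    "\<And>i n. n \<in> G i \<Longrightarrow> T (e n) = smul (coaverage (G i)) (\<iota> (average (G i)))"
    "\<And>n. 1 \<le> n \<Longrightarrow> n \<notin> (\<Union>i. G i) \<Longrightarrow> T (e n) = 0"
    using block_operator[OF G G] by blast
  have "T \<in> spatial N" if N: "N \<subseteq> {1..}" "infinite N" for N
  proof -
    obtain G' where G': "\<And>t. stack t G'" "\<And>i. G' i \<subseteq> N \<inter> {0<..}"
      using infinite_stack[OF N(2)] by blast
    obtain V where V: "V \<in> operators"
      "\<And>i n. n \<in> G i \<Longrightarrow> V (e n) = smul (coaverage (G i)) (\<iota> (average (G' i)))"
      "\<And>n. 1 \<le> n \<Longrightarrow> n \<notin> (\<Union>i. G i) \<Longrightarrow> V (e n) = 0"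
      using block_operator[OF G G'(1)] by blast
    obtain U where U: "U \<in> operators" "\<And>i. U (\<iota> (average (G' i))) = \<iota> (average (G i))"
      using block_operator[OF G'(1) G] by blast
    have PN: "proj N (\<iota> (average (G' i))) = \<iota> (average (G' i))" for i
    proof -
      have "restr N (average (G' i)) = average (G' i)"
        using G'(2)[of i] by (auto simp: restr_def average_def fun_eq_iff)
      moreover have "average (G' i) \<in> c00"
        using stack_schreier[OF G'(1), of i "Suc i"] average_c00 by auto
      ultimately show ?thesis by (simp add: proj_\<iota>)
    qed
    have "T = U o\<^sub>L proj N o\<^sub>L V"
    proof (rule operator_eqI)
      fix n :: nat assume n: "1 \<le> n"
      show "T (e n) = (U o\<^sub>L proj N o\<^sub>L V) (e n)"
      proof (cases "\<exists>i. n \<in> G i")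
        case True
        then obtain i where "n \<in> G i" by blast
        then show ?thesis
          using U(1) proj_operator[of N] by (simp add: T(3) V(2) operators_iff PN U(2))
      qed (use n in \<open>simp add: T(4) V(3) blinfun.zero_right\<close>)
    qed (simp_all add: T(1) U(1) V(1) proj_operator operator_compose)
    then show ?thesis using opidealD(4,5)[OF spatial_opideal] proj_in_spatial U(1) V(1) by simp
  qed
  moreover have "T \<notin> strictly_singular_operators smul"
  proof
    assume ss: "T \<in> strictly_singular_operators smul"
    define u where "u i = \<iota> (average (G i))" for i
    have avg: "average (G i) \<in> c00" for i
      using stack_schreier[OF G, of i "Suc i"] average_c00 by auto
    have ne: "\<exists>n. n \<in> G i" for i using stackD(5)[OF G, of i "Suc i"] by auto
    have coord_u: "coord n (u j) \<noteq> 0 \<longleftrightarrow> i = j" if "n \<in> G i" for n i j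
    proof -
      have "0 < card (G j)" using stackD(2)[OF G, of j "Suc j"] by simp
      moreover have "n \<in> G j \<longleftrightarrow> i = j"
        using infinite_stack_disjoint[OF G, of i j] that by (cases "i = j") auto
      ultimately show ?thesis by (simp add: u_def coord_\<iota>[OF avg] average_def)
    qed
    have inj: "inj u"
    proof (rule injI)
      fix i j assume eq: "u i = u j"
      obtain n where "n \<in> G i" using ne by blast
      then show "i = j" using coord_u[of n i i] coord_u[of n i j] eq by simp
    qed
    have ind: "independent (range u)"
      unfolding dependent_def
    proof
      assume "\<exists>v\<in>range u. v \<in> span (range u - {v})"
      then obtain i where i: "u i \<in> span (range u - {u i})" by blast
      obtain n where n: "n \<in> G i" using ne by blast
      have "span (range u - {u i}) \<subseteq> {v. coord n v = 0}"
      proof (rule span_minimal)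
        show "range u - {u i} \<subseteq> {v. coord n v = 0}"
        proof
          fix v assume "v \<in> range u - {u i}"
          then obtain j where "v = u j" "i \<noteq> j" by blast
          then show "v \<in> {v. coord n v = 0}" using coord_u[OF n, of j] by simp
        qed
        show "subspace {v. coord n v = 0}"
          by (rule subspaceI) (auto simp: blinfun.add_right blinfun.zero_right coord_smul)
      qed
      then show False using i coord_u[OF n, of i] by blast
    qed
    have infdim: "\<not> (\<exists>B. finite B \<and> span B = span (range u))"
    proof
      assume "\<exists>B. finite B \<and> span B = span (range u)"
      then obtain B where B: "finite B" "span B = span (range u)" by blast
      have "finite (range u)"
        using independent_span_bound[OF B(1) ind] span_superset[of "range u"] unfolding B(2) by blast
      then show False using range_inj_infinite[OF inj] by blast
    qed
    have "T v = v" if "v \<in> span (range u)" for v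
      using that
    proof (induction rule: span_induct)
      case base
      show ?case
        by (rule subspaceI) (use T(1) in \<open>auto simp: blinfun.add_right blinfun.zero_right operators_iff\<close>)
    next
      case (step v)
      then show ?case using T(2) unfolding u_def by auto
    qed
    then have "\<exists>c>0. \<forall>v\<in>span (range u). c * norm v \<le> norm (T v)"
      by (intro exI[of _ 1]) simp
    then show False
      using ss infdim subspace_span[of "range u"] unfolding strictly_singular_operators_def by blast
  qed
  ultimately show ?thesis by blast
qed


section \<open>The lattice of spatial ideals\<close>

lemma nontrivial_spatial_ideals_eq:
  "nontrivial_spatial_ideals smul \<iota> = {I \<in> spatial_ideals smul \<iota>. spatial {1} \<subset> I \<and> I \<subset> spatial {1..}}"
  unfolding nontrivial_spatial_ideals_def spatial_singleton spatial_UNIV ..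

lemma spatial_members: "spatial {1} \<in> spatial_ideals smul \<iota>" "spatial {1..} \<in> spatial_ideals smul \<iota>"
  unfolding spatial_ideals_eq by auto

lemma spatial_strict: "spatial {1} \<subset> spatial {1..}"
  using id_notin_spatial_singleton proj_in_spatial spatial_mono_mod_finite[of "{1..}" "{1}"] by auto

theorem spatial_chains_between:
  assumes I: "I \<in> spatial_ideals smul \<iota>" and J: "J \<in> spatial_ideals smul \<iota>" and IJ: "I \<subset> J"
  shows "\<exists>(\<Delta> :: nat set set) (\<Gamma> :: nat set \<Rightarrow> ('e \<Rightarrow>\<^sub>L 'e) set set).
              \<Delta> \<approx> (UNIV :: real set) \<and>
              (\<forall>L\<in>\<Delta>.
                 uncountable (\<Gamma> L) \<and> chain\<^sub>\<subseteq> (\<Gamma> L) \<and>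
                 (\<forall>A\<in>\<Gamma> L. A \<in> spatial_ideals smul \<iota> \<and> I \<subset> A \<and> A \<subset> J) \<and>
                 ideal (\<Union>(\<Gamma> L)) (operator_algebra smul) \<and> closed (\<Union>(\<Gamma> L)) \<and>
                 \<Union>(\<Gamma> L) \<notin> spatial_ideals smul \<iota>) \<and>
              (\<forall>L\<in>\<Delta>. \<forall>M\<in>\<Delta>. L \<noteq> M \<longrightarrow>
                 (\<forall>A\<in>\<Gamma> L. \<forall>B\<in>\<Gamma> M. closure {S + T | S T. S \<in> A \<and> T \<in> B} = J))"
proof -
  obtain M where M: "M \<noteq> {}" "M \<subseteq> {1..}" "I = spatial M" using I unfolding spatial_ideals_eq by blast
  obtain N0 where N0: "N0 \<noteq> {}" "N0 \<subseteq> {1..}" "J = spatial N0" using J unfolding spatial_ideals_eq by blast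
  define N where "N = M \<union> N0"
  have N: "N \<subseteq> {1..}" "N \<noteq> {}" "M \<subseteq> N" unfolding N_def using M N0 by auto
  have "spatial N \<subseteq> spatial N0"
    unfolding spatial_subset_iff
  proof -
    have "proj M \<in> spatial N0" using IJ M(3) N0(3) unfolding spatial_subset_iff[symmetric] by blast
    moreover have "proj (N0 - M) \<in> spatial N0"
    proof -
      have "proj (N0 - M) \<in> spatial (N0 - M)" by (rule proj_in_spatial)
      moreover have "spatial (N0 - M) \<subseteq> spatial N0"
      proof (rule spatial_mono_mod_finite[OF N0(1,2)])
        have "N0 - M - N0 = {}" by blast
        then show "finite (N0 - M - N0)" by (simp only: finite.emptyI)
      qed (use N0(2) in blast)
      ultimately show ?thesis by blast
    qed
    moreover have "proj N = proj M + proj (N0 - M)"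
      unfolding N_def using proj_Un[of M "N0 - M"] by simp
    ultimately show "proj N \<in> spatial N0" using opidealD(3)[OF spatial_opideal] by simp
  qed
  moreover have "spatial N0 \<subseteq> spatial N"
  proof (rule spatial_mono_mod_finite[OF N(2,1) N0(2)])
    have "N0 - N = {}" unfolding N_def by blast
    then show "finite (N0 - N)" by (simp only: finite.emptyI)
  qed
  ultimately have JN: "J = spatial N" using N0(3) by blast
  have notin: "proj N \<notin> spatial M"
    using IJ unfolding JN M(3) spatial_subset_iff[symmetric] by blast
  have closure_eq: "closure {S + T | S T. S \<in> A \<and> T \<in> B} = J"
    if A: "A \<in> spatial_ideals smul \<iota>" "A \<subset> spatial N" and B: "B \<in> spatial_ideals smul \<iota>" "B \<subset> spatial N"
      and mem: "proj N \<in> {S + T | S T. S \<in> A \<and> T \<in> B}" for A B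
  proof
    let ?K = "{S + T | S T. S \<in> A \<and> T \<in> B}"
    have "?K \<subseteq> spatial N" using opidealD(3)[OF spatial_opideal] A(2) B(2) by blast
    then show "closure ?K \<subseteq> J" unfolding JN by (rule closure_minimal[OF _ closed_spatial])
    have "opideal (closure ?K)"
      by (intro opideal_closure opideal_sum spatial_ideals_opideal A(1) B(1))
    then show "J \<subseteq> closure ?K"
      unfolding JN by (rule spatial_least[OF _ closed_closure subsetD[OF closure_subset mem]])
  qed
  from spatial_chains[OF M(1) N(3,1) notin]
  obtain \<Delta> :: "nat set set" and \<Gamma> where \<Delta>: "\<Delta> \<approx> (UNIV :: real set)"
    and \<Gamma>: "\<forall>A\<in>\<Delta>. uncountable (\<Gamma> A) \<and> chain\<^sub>\<subseteq> (\<Gamma> A) \<and>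
      (\<forall>I\<in>\<Gamma> A. I \<in> spatial_ideals smul \<iota> \<and> spatial M \<subset> I \<and> I \<subset> spatial N) \<and>
      opideal (\<Union>(\<Gamma> A)) \<and> closed (\<Union>(\<Gamma> A)) \<and> \<Union>(\<Gamma> A) \<notin> spatial_ideals smul \<iota>"
    and sum: "\<forall>A\<in>\<Delta>. \<forall>B\<in>\<Delta>. A \<noteq> B \<longrightarrow>
      (\<forall>I\<in>\<Gamma> A. \<forall>J\<in>\<Gamma> B. proj N \<in> {S + T | S T. S \<in> I \<and> T \<in> J})"
    by (elim exE conjE) (rule that)
  have members: "A \<in> spatial_ideals smul \<iota>" "I \<subset> A" "A \<subset> J"
    if "L \<in> \<Delta>" "A \<in> \<Gamma> L" for L A
    using bspec[OF bspec[OF \<Gamma> that(1), THEN conjunct2, THEN conjunct2, THEN conjunct1] that(2)]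
    unfolding M(3) JN by simp_all
  show ?thesis
  proof (intro exI[of _ \<Delta>] exI[of _ \<Gamma>] conjI[OF \<Delta>] conjI ballI impI)
    fix L assume L: "L \<in> \<Delta>"
    note \<Gamma>L = bspec[OF \<Gamma> L] and \<Gamma>L' = bspec[OF \<Gamma> L, THEN conjunct2, THEN conjunct2, THEN conjunct2]
    show "uncountable (\<Gamma> L)" by (rule \<Gamma>L[THEN conjunct1])
    show "chain\<^sub>\<subseteq> (\<Gamma> L)" by (rule \<Gamma>L[THEN conjunct2, THEN conjunct1])
    show "ideal (\<Union>(\<Gamma> L)) (operator_algebra smul)"
      unfolding ideal_iff_opideal by (rule \<Gamma>L'[THEN conjunct1])
    show "closed (\<Union>(\<Gamma> L))" by (rule \<Gamma>L'[THEN conjunct2, THEN conjunct1])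
    show "\<Union>(\<Gamma> L) \<notin> spatial_ideals smul \<iota>" by (rule \<Gamma>L'[THEN conjunct2, THEN conjunct2])
  next
    fix L M' A B assume LM: "L \<in> \<Delta>" "M' \<in> \<Delta>" "L \<noteq> M'" and A: "A \<in> \<Gamma> L" and B: "B \<in> \<Gamma> M'"
    show "closure {S + T | S T. S \<in> A \<and> T \<in> B} = J"
      by (rule closure_eq[OF members(1)[OF LM(1) A] members(3)[OF LM(1) A, unfolded JN]
          members(1)[OF LM(2) B] members(3)[OF LM(2) B, unfolded JN] sum[rule_format, OF LM A B]])
  qed (fact members)+
qed

lemma spatial_between:
  assumes "I \<in> spatial_ideals smul \<iota>" "J \<in> spatial_ideals smul \<iota>" "I \<subset> J"
  shows "\<exists>A\<in>spatial_ideals smul \<iota>. I \<subset> A \<and> A \<subset> J"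
proof -
  from spatial_chains_between[OF assms] obtain \<Delta> :: "nat set set" and \<Gamma> where
    \<Delta>: "\<Delta> \<approx> (UNIV :: real set)" and \<Gamma>: "\<forall>L\<in>\<Delta>. uncountable (\<Gamma> L) \<and> chain\<^sub>\<subseteq> (\<Gamma> L) \<and>
      (\<forall>A\<in>\<Gamma> L. A \<in> spatial_ideals smul \<iota> \<and> I \<subset> A \<and> A \<subset> J) \<and>
      ideal (\<Union>(\<Gamma> L)) (operator_algebra smul) \<and> closed (\<Union>(\<Gamma> L)) \<and>
      \<Union>(\<Gamma> L) \<notin> spatial_ideals smul \<iota>" by (elim exE conjE) (rule that)
  have "infinite \<Delta>"
    using eqpoll_finite_iff[OF \<Delta>] infinite_UNIV_char_0[where 'a = real] by simp
  then have "\<Delta> \<noteq> {}" by auto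
  then obtain L where L: "L \<in> \<Delta>" by blast
  note \<Gamma>L = bspec[OF \<Gamma> L, THEN conjunct1] bspec[OF \<Gamma> L, THEN conjunct2, THEN conjunct2, THEN conjunct1]
  have "\<Gamma> L \<noteq> {}" using \<Gamma>L(1) by (metis countable_empty)
  then show ?thesis using \<Gamma>L(2) by blast
qed

text \<open>
  The compact operators and the whole algebra are the spatial ideals of \<open>{1}\<close> and \<open>{1..}\<close>, so all claims are instances of the
  fact that between two spatial ideals there is a third.
\<close>

theorem nontrivial_spatial_ideals_no_extremal:
  "nontrivial_spatial_ideals smul \<iota> \<noteq> {} \<and>
         (\<forall>I\<in>nontrivial_spatial_ideals smul \<iota>.
            \<not> (\<forall>J\<in>nontrivial_spatial_ideals smul \<iota>. J \<subseteq> I \<longrightarrow> J = I) \<and>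
            \<not> (\<forall>J\<in>nontrivial_spatial_ideals smul \<iota>. I \<subseteq> J \<longrightarrow> J = I))"
proof (intro conjI ballI)
  show "nontrivial_spatial_ideals smul \<iota> \<noteq> {}"
    unfolding nontrivial_spatial_ideals_eq using spatial_between[OF spatial_members spatial_strict] by blast
  fix I assume "I \<in> nontrivial_spatial_ideals smul \<iota>"
  then have I: "I \<in> spatial_ideals smul \<iota>" "spatial {1} \<subset> I" "I \<subset> spatial {1..}"
    unfolding nontrivial_spatial_ideals_eq by blast+
  obtain A where A: "A \<in> spatial_ideals smul \<iota>" "spatial {1} \<subset> A" "A \<subset> I"
    using spatial_between[OF spatial_members(1) I(1,2)] by blast
  then have "A \<in> nontrivial_spatial_ideals smul \<iota>"
    unfolding nontrivial_spatial_ideals_eq using I(3) by blast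
  then show "\<not> (\<forall>J\<in>nontrivial_spatial_ideals smul \<iota>. J \<subseteq> I \<longrightarrow> J = I)" using A(3) by blast
  obtain A where A: "A \<in> spatial_ideals smul \<iota>" "I \<subset> A" "A \<subset> spatial {1..}"
    using spatial_between[OF I(1) spatial_members(2) I(3)] by blast
  then have "A \<in> nontrivial_spatial_ideals smul \<iota>"
    unfolding nontrivial_spatial_ideals_eq using I(2) by blast
  then show "\<not> (\<forall>J\<in>nontrivial_spatial_ideals smul \<iota>. I \<subseteq> J \<longrightarrow> J = I)" using A(2) by blast
qed

theorem Inter_nontrivial_not_strictly_singular:
  "\<not> \<Inter>(nontrivial_spatial_ideals smul \<iota>) \<subseteq> strictly_singular_operators smul"
proof -
  obtain T where T: "T \<notin> strictly_singular_operators smul"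
    "\<And>N. N \<subseteq> {1..} \<Longrightarrow> infinite N \<Longrightarrow> T \<in> spatial N"
    using nonstrictly_singular_in_all_spatial by blast
  have "T \<in> I" if "I \<in> nontrivial_spatial_ideals smul \<iota>" for I
  proof -
    have I: "I \<in> spatial_ideals smul \<iota>" "spatial {1} \<subset> I"
      using that unfolding nontrivial_spatial_ideals_eq by blast+
    then obtain N where N: "N \<noteq> {}" "N \<subseteq> {1..}" "I = spatial N" unfolding spatial_ideals_eq by blast
    have "infinite N"
    proof
      assume "finite N"
      then have "spatial N \<subseteq> spatial {1}" using N by (intro spatial_mono_mod_finite) auto
      then show False using I(2) N(3) by blast
    qed
    then show ?thesis using T(2)[OF N(2)] N(3) by blast
  qed
  then show ?thesis using T(1) by blast
qed

end


section \<open>The Schreier and Baernstein spaces\<close>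

lemma c00_support_finite:
  assumes "x \<in> c00"
  shows "finite {n. x n \<noteq> 0}"
  using assms by (simp add: c00_def)

lemma powr_inverse_le_iff:
  fixes a c p :: real
  assumes "0 \<le> a" "0 \<le> c" "1 \<le> p"
  shows "a powr (1 / p) \<le> c \<longleftrightarrow> a \<le> c powr p"
proof
  assume "a powr (1 / p) \<le> c"
  then have "(a powr (1 / p)) powr p \<le> c powr p" using assms by (intro powr_mono2) auto
  then show "a \<le> c powr p" using assms by (simp add: powr_powr)
next
  assume "a \<le> c powr p"
  then have "a powr (1 / p) \<le> (c powr p) powr (1 / p)" using assms by (intro powr_mono2) auto
  then show "a powr (1 / p) \<le> c" using assms by (simp add: powr_powr)
qed

lemma schreier_norm_props:
  fixes x :: "nat \<Rightarrow> 'k::real_normed_vector"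
  assumes p: "1 \<le> p" and x: "x \<in> c00"
  shows "family True I F \<Longrightarrow> mass p 1 x I F \<le> schreier_norm p x powr p"
    and "0 \<le> c \<Longrightarrow> (\<And>I F. family True I F \<Longrightarrow> mass p 1 x I F \<le> c powr p) \<Longrightarrow> schreier_norm p x \<le> c"
proof -
  define A where "A = {(\<Sum>n\<in>F. norm (x n) powr p) powr (1 / p) | F. F \<in> schreier_sets - {{}}}"
  have norm_eq: "schreier_norm p x = Sup A" by (simp add: schreier_norm_def A_def)
  have finS: "finite {n. x n \<noteq> 0}" using x by (rule c00_support_finite)
  have ne: "A \<noteq> {}" unfolding A_def using singleton_schreier[of 1] by blast
  have bdd: "bdd_above A"
  proof (rule bdd_aboveI)
    fix y assume "y \<in> A"
    then obtain F where F: "F \<in> schreier_sets" "y = (\<Sum>n\<in>F. norm (x n) powr p) powr (1 / p)"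
      unfolding A_def by blast
    have finF: "finite F" using F(1) by (simp add: schreier_sets_iff)
    have "(\<Sum>n\<in>F. norm (x n) powr p) = (\<Sum>n\<in>F \<inter> {n. x n \<noteq> 0}. norm (x n) powr p)"
      using finF by (intro sum.mono_neutral_right) auto
    also have "\<dots> \<le> (\<Sum>n | x n \<noteq> 0. norm (x n) powr p)"
      using finS by (intro sum_mono2) auto
    finally show "y \<le> (\<Sum>n | x n \<noteq> 0. norm (x n) powr p) powr (1 / p)"
      unfolding F(2) using p by (intro powr_mono2 sum_nonneg) auto
  qed
  have upper: "(\<Sum>n\<in>F. norm (x n) powr p) powr (1 / p) \<le> Sup A" if "F \<in> schreier_sets" "F \<noteq> {}" for F
    using that bdd by (intro cSup_upper) (auto simp: A_def)
  have nonneg: "0 \<le> Sup A"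
    using upper[OF singleton_schreier[of 1]] by (meson insert_not_empty order_refl order_trans powr_ge_zero)
  show "mass p 1 x I F \<le> schreier_norm p x powr p" if fam: "family True I F"
  proof (cases "I = {}")
    case True
    then show ?thesis by (simp add: mass_def)
  next
    case False
    have "finite I" "card I \<le> 1" using fam unfolding family_def by blast+
    then have "card I = 1" using False card_gt_0_iff[of I] by linarith
    then obtain i where I: "I = {i}" by (auto simp: card_1_singleton_iff)
    have F: "F i \<in> schreier_sets" using familyD(1)[OF fam, of i] I by simp
    have "mass p 1 x I F = (\<Sum>n\<in>F i. norm (x n) powr p)"
      unfolding mass_def I by (simp add: sum_nonneg)
    also have "\<dots> \<le> Sup A powr p"
    proof (cases "F i = {}")
      case False
      then show ?thesis
        using upper[OF F False] powr_inverse_le_iff[OF _ nonneg p] by (simp add: sum_nonneg)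
    qed simp
    finally show ?thesis unfolding norm_eq .
  qed
  show "schreier_norm p x \<le> c"
    if c: "0 \<le> c" and le: "\<And>I F. family True I F \<Longrightarrow> mass p 1 x I F \<le> c powr p"
    unfolding norm_eq
  proof (rule cSup_least[OF ne])
    fix y assume "y \<in> A"
    then obtain F where F: "F \<in> schreier_sets" "y = (\<Sum>n\<in>F. norm (x n) powr p) powr (1 / p)"
      unfolding A_def by blast
    have "mass p 1 x {0} (\<lambda>_. F) \<le> c powr p" using F(1) by (intro le) (simp add: family_def)
    then have "(\<Sum>n\<in>F. norm (x n) powr p) \<le> c powr p" by (simp add: mass_def sum_nonneg)
    then show "y \<le> c" unfolding F(2) using powr_inverse_le_iff[OF _ c p] by (simp add: sum_nonneg)
  qed
qed

lemma consecutive_less: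
  fixes F :: "nat \<Rightarrow> nat set"
  assumes fin: "\<And>j. j \<in> {1..m} \<Longrightarrow> finite (F j) \<and> F j \<noteq> {}"
    and succ: "\<And>j. 1 \<le> j \<Longrightarrow> j < m \<Longrightarrow> Max (F j) < Min (F (j + 1))"
    and ij: "1 \<le> i" "i < j" "j \<le> m"
  shows "\<forall>a\<in>F i. \<forall>b\<in>F j. a < b"
proof -
  have *: "Max (F i) < Min (F j)"
    using ij(2,3)
  proof (induction j rule: less_induct)
    case (less j)
    then obtain k where k: "j = Suc k" by (metis less_imp_Suc_add)
    show ?case
    proof (cases "k = i")
      case True
      then show ?thesis using succ[of i] ij(1) less.prems k by simp
    next
      case False
      then have "Max (F i) < Min (F k)" using less k by simp
      also have "Min (F k) \<le> Max (F k)" using fin[of k] ij(1) less.prems k False by simp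
      also have "Max (F k) < Min (F j)" using succ[of k] ij(1) less.prems k False by simp
      finally show ?thesis .
    qed
  qed
  show ?thesis
  proof (intro ballI)
    fix a b assume "a \<in> F i" "b \<in> F j"
    then have "a \<le> Max (F i)" "Min (F j) \<le> b" using fin[of i] fin[of j] ij by simp_all
    then show "a < b" using * by linarith
  qed
qed

text \<open>
  After dropping empty sets, the index set of a family can be renumbered increasingly, so families have the same masses as
  the numbered sequences of sets in the definition of the norm.
\<close>

lemma baernstein_norm_props:
  fixes x :: "nat \<Rightarrow> 'k::real_normed_vector"
  assumes p: "1 \<le> p" and x: "x \<in> c00"
  shows "family False I F \<Longrightarrow> mass 1 p x I F \<le> baernstein_norm p x powr p"
    and "0 \<le> c \<Longrightarrow> (\<And>I F. family False I F \<Longrightarrow> mass 1 p x I F \<le> c powr p) \<Longrightarrow> baernstein_norm p x \<le> c"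
proof -
  define ok where "ok m F \<longleftrightarrow> 1 \<le> m \<and> (\<forall>j\<in>{1..m}. F j \<in> schreier_sets - {{}}) \<and>
            (\<forall>j. 1 \<le> j \<and> j < m \<longrightarrow> Max (F j) < Min (F (j + 1)))" for m :: nat and F :: "nat \<Rightarrow> nat set"
  define A where "A = {(\<Sum>j=1..m. (\<Sum>n\<in>F j. norm (x n)) powr p) powr (1 / p) | (m::nat) F. ok m F}"
  have norm_eq: "baernstein_norm p x = Sup A" by (simp add: baernstein_norm_def A_def ok_def)
  have finS: "finite {n. x n \<noteq> 0}" using x by (rule c00_support_finite)
  have fam_ok: "family False {1..m} F" if ok: "ok m F" for m F
    unfolding family_def
  proof (intro conjI ballI impI)
    show "F j \<in> schreier_sets" if "j \<in> {1..m}" for j using ok that unfolding ok_def by blast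
    have ne: "finite (F j) \<and> F j \<noteq> {}" if j: "j \<in> {1..m}" for j
    proof -
      have "F j \<in> schreier_sets - {{}}" using ok j unfolding ok_def by blast
      then show ?thesis by (simp add: schreier_sets_iff)
    qed
    have succ: "Max (F j) < Min (F (j + 1))" if "1 \<le> j" "j < m" for j
      using ok that unfolding ok_def by blast
    fix i j a b assume ij: "i \<in> {1..m}" "j \<in> {1..m}" "i < j" and ab: "a \<in> F i" "b \<in> F j"
    have "\<forall>a\<in>F i. \<forall>b\<in>F j. a < b"
    proof (rule consecutive_less[where F = F and m = m])
      show "finite (F k) \<and> F k \<noteq> {}" if "k \<in> {1..m}" for k using ne[OF that] .
      show "Max (F k) < Min (F (k + 1))" if "1 \<le> k" "k < m" for k using succ[OF that] .
      show "1 \<le> i" "i < j" "j \<le> m" using ij by simp_all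
    qed
    then show "a < b" using ab by blast
  qed simp_all
  define S where "S = (\<Sum>n | x n \<noteq> 0. norm (x n))"
  have S0: "0 \<le> S" unfolding S_def by (simp add: sum_nonneg)
  \<comment> \<open>the masses are bounded, as needed to compare them with the supremum\<close>
  have mass_S: "mass 1 p x I F \<le> S powr (p - 1) * S" if fam: "family False I F" for I F
  proof -
    have finI: "finite I" "\<And>i. i \<in> I \<Longrightarrow> finite (F i)" using finite_family[OF fam] by auto
    define g where "g i = (\<Sum>n\<in>F i \<inter> {n. x n \<noteq> 0}. norm (x n))" for i
    have g0: "0 \<le> g i" for i unfolding g_def by (simp add: sum_nonneg)
    have gS: "g i \<le> S" for i unfolding g_def S_def using finS by (intro sum_mono2) auto
    have geq: "(\<Sum>n\<in>F i. norm (x n)) = g i" if "i \<in> I" for i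
      unfolding g_def using finI(2)[OF that] by (intro sum.mono_neutral_right) auto
    have "(\<Sum>i\<in>I. g i) = (\<Sum>n\<in>(\<Union>i\<in>I. F i \<inter> {n. x n \<noteq> 0}). norm (x n))"
      unfolding g_def using finI family_disjoint[OF fam] by (intro sum.UNION_disjoint[symmetric]) auto
    also have "\<dots> \<le> S" unfolding S_def using finS by (intro sum_mono2) auto
    finally have sum_g: "(\<Sum>i\<in>I. g i) \<le> S" .
    have "mass 1 p x I F = (\<Sum>i\<in>I. g i powr p)"
      unfolding mass_def using geq by (intro sum.cong) auto
    also have "\<dots> \<le> (\<Sum>i\<in>I. S powr (p - 1) * g i)"
    proof (rule sum_mono)
      fix i
      have "g i powr p = g i powr (p - 1) * g i"
        using powr_add[of "g i" "p - 1" 1] g0[of i] by simp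
      also have "\<dots> \<le> S powr (p - 1) * g i"
        using p g0 gS by (intro mult_right_mono powr_mono2) auto
      finally show "g i powr p \<le> S powr (p - 1) * g i" .
    qed
    also have "\<dots> = S powr (p - 1) * (\<Sum>i\<in>I. g i)" by (simp add: sum_distrib_left)
    also have "\<dots> \<le> S powr (p - 1) * S" using sum_g by (intro mult_left_mono) auto
    finally show ?thesis .
  qed
  have mass_eq: "(\<Sum>j=1..m. (\<Sum>n\<in>F j. norm (x n)) powr p) = mass 1 p x {1..m} F" for m F
    by (simp add: mass_def)
  have mass0: "0 \<le> mass 1 p x I F" for I F by (simp add: mass_def sum_nonneg)
  have "ok 1 (\<lambda>_. {1})" unfolding ok_def using singleton_schreier[of 1] by simp
  then have ne: "A \<noteq> {}" unfolding A_def by blast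
  have bdd: "bdd_above A"
  proof (rule bdd_aboveI)
    fix y assume "y \<in> A"
    then obtain m F where F: "ok m F" "y = mass 1 p x {1..m} F powr (1 / p)"
      unfolding A_def mass_eq by blast
    show "y \<le> (S powr (p - 1) * S) powr (1 / p)"
      unfolding F(2) using p mass_S[OF fam_ok[OF F(1)]] mass0 by (intro powr_mono2) auto
  qed
  have upper: "mass 1 p x {1..m} F powr (1 / p) \<le> Sup A" if "ok m F" for m F
    using that bdd unfolding mass_eq[symmetric] by (intro cSup_upper) (auto simp: A_def)
  have nonneg: "0 \<le> Sup A"
    using upper[OF \<open>ok 1 (\<lambda>_. {1})\<close>] by (meson order_trans powr_ge_zero)
  show "mass 1 p x I F \<le> baernstein_norm p x powr p" if fam: "family False I F"
  proof -
    define I' where "I' = {i \<in> I. F i \<noteq> {}}"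
    have finI: "finite I" using finite_family[OF fam] by blast
    have finI': "finite I'" unfolding I'_def using finI by simp
    have eq: "mass 1 p x I F = mass 1 p x I' F"
      unfolding mass_def I'_def using finI by (intro sum.mono_neutral_right) auto
    show ?thesis
    proof (cases "I' = {}")
      case True
      then show ?thesis unfolding eq by (simp add: mass_def)
    next
      case False
      define m where "m = card I'"
      have m: "1 \<le> m" unfolding m_def using False finI' by (simp add: Suc_le_eq card_gt_0_iff)
      obtain h where h: "bij_betw h {..<m} I'" "strict_mono_on {..<m} h"
        unfolding m_def using ex_bij_betw_strict_mono_card[OF finI'] by blast
      define F' where "F' j = F (h (j - 1))" for j
      have hI: "h (j - 1) \<in> I'" if "j \<in> {1..m}" for j
        using h(1) that unfolding bij_betw_def by auto
      have ok: "ok m F'"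
        unfolding ok_def
      proof (intro conjI ballI allI impI)
        show "1 \<le> m" by (rule m)
        have mem: "F' j \<in> schreier_sets - {{}}" if j: "j \<in> {1..m}" for j
          using familyD(1)[OF fam, of "h (j - 1)"] hI[OF j] unfolding F'_def I'_def by simp
        then show "F' j \<in> schreier_sets - {{}}" if "j \<in> {1..m}" for j using that .
        fix j assume j: "1 \<le> j \<and> j < m"
        have "j - 1 < j" "j < m" using j by linarith+
        then have hlt: "h (j - 1) < h j" by (intro strict_mono_onD[OF h(2)]) simp_all
        have "h (j - 1) \<in> I'" "h (j + 1 - 1) \<in> I'" by (rule hI, use j in force)+
        then have "h (j - 1) \<in> I" "h j \<in> I" unfolding I'_def by simp_all
        from familyD(2)[OF fam this hlt] have lt: "\<forall>a\<in>F' j. \<forall>b\<in>F' (j + 1). a < b"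
          unfolding F'_def by simp
        have "finite (F' j)" "F' j \<noteq> {}" "finite (F' (j + 1))" "F' (j + 1) \<noteq> {}"
          using mem[of j] mem[of "j + 1"] j by (simp_all add: schreier_sets_iff)
        then show "Max (F' j) < Min (F' (j + 1))" using lt[rule_format, OF Max_in Min_in] by blast
      qed
      have "mass 1 p x I' F = mass 1 p x {1..m} F'"
        unfolding mass_def F'_def
      proof (rule sum.reindex_bij_witness[where i = "\<lambda>j. h (j - 1)" and j = "\<lambda>i. Suc (inv_into {..<m} h i)"])
        fix i assume i: "i \<in> I'"
        then have "i \<in> h ` {..<m}" using h(1) unfolding bij_betw_def by simp
        then show "h (Suc (inv_into {..<m} h i) - 1) = i" "Suc (inv_into {..<m} h i) \<in> {1..m}"
          using f_inv_into_f[of i h "{..<m}"] inv_into_into[of i h "{..<m}"] by auto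
      next
        fix j assume j: "j \<in> {1..m}"
        then have "inv_into {..<m} h (h (j - 1)) = j - 1"
          using h(1) unfolding bij_betw_def by (intro inv_into_f_f) auto
        then show "Suc (inv_into {..<m} h (h (j - 1))) = j" using j by simp
        show "h (j - 1) \<in> I'" using hI[OF j] .
      qed (use h(1) in \<open>auto simp: bij_betw_def f_inv_into_f\<close>)
      then show ?thesis
        unfolding eq norm_eq using upper[OF ok] powr_inverse_le_iff[OF mass0 nonneg p] by simp
    qed
  qed
  show "baernstein_norm p x \<le> c"
    if c: "0 \<le> c" and le: "\<And>I F. family False I F \<Longrightarrow> mass 1 p x I F \<le> c powr p"
    unfolding norm_eq
  proof (rule cSup_least[OF ne])
    fix y assume "y \<in> A"
    then obtain m F where F: "ok m F" "y = mass 1 p x {1..m} F powr (1 / p)"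
      unfolding A_def mass_eq by blast
    show "y \<le> c"
      unfolding F(2) using le[OF fam_ok[OF F(1)]] powr_inverse_le_iff[OF mass0 c p] by simp
  qed
qed

lemma schreier_space_intro:
  assumes compl: "is_completion_of_c00 smul \<nu> \<iota>" and "1 \<le> r" "1 \<le> s" "single \<or> 1 < s"
    and "\<And>x I F. x \<in> c00 \<Longrightarrow> family single I F \<Longrightarrow> mass r s x I F \<le> \<nu> x powr (r * s)"
    and "\<And>x c. x \<in> c00 \<Longrightarrow> 0 \<le> c \<Longrightarrow> (\<And>I F. family single I F \<Longrightarrow> mass r s x I F \<le> c powr (r * s)) \<Longrightarrow> \<nu> x \<le> c"
  shows "schreier_space smul \<iota> r s single"
proof -
  have "banach_space_over smul" using compl by (simp add: is_completion_of_c00_def)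
  then interpret banach_space_over smul .
  have n: "norm (\<iota> x) = \<nu> x" if "x \<in> c00" for x
    using compl that by (simp add: is_completion_of_c00_def)
  show ?thesis
    by unfold_locales (use compl assms(2-) n in \<open>simp_all add: is_completion_of_c00_def\<close>)
qed

lemma completion_is_schreier_space:
  fixes smul :: "'k::{real_normed_field,euclidean_space} \<Rightarrow> 'e::banach \<Rightarrow> 'e"
  assumes "1 < p \<and> is_completion_of_c00 smul (baernstein_norm p) \<iota> \<or>
           1 \<le> p \<and> is_completion_of_c00 smul (schreier_norm p) \<iota>"
  shows "\<exists>r s single. schreier_space smul \<iota> r s single"
  using assms
proof (elim disjE conjE)
  assume p: "1 < p" and compl: "is_completion_of_c00 smul (baernstein_norm p) \<iota>"
  have "schreier_space smul \<iota> 1 p False"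
  proof (rule schreier_space_intro[OF compl])
    show "mass 1 p x I F \<le> baernstein_norm p x powr (1 * p)" if "x \<in> c00" "family False I F" for x :: "nat \<Rightarrow> 'k" and I F
      using baernstein_norm_props(1)[OF _ that] p by simp
    show "baernstein_norm p x \<le> c"
      if "x \<in> c00" "0 \<le> c" "\<And>I F. family False I F \<Longrightarrow> mass 1 p x I F \<le> c powr (1 * p)" for x :: "nat \<Rightarrow> 'k" and c
      using baernstein_norm_props(2)[OF _ that(1,2)] that(3) p by simp
  qed (use p in auto)
  then show ?thesis by blast
next
  assume p: "1 \<le> p" and compl: "is_completion_of_c00 smul (schreier_norm p) \<iota>"
  have "schreier_space smul \<iota> p 1 True"
  proof (rule schreier_space_intro[OF compl])
    show "mass p 1 x I F \<le> schreier_norm p x powr (p * 1)" if "x \<in> c00" "family True I F" for x :: "nat \<Rightarrow> 'k" and I F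
      using schreier_norm_props(1)[OF p that] by simp
    show "schreier_norm p x \<le> c"
      if "x \<in> c00" "0 \<le> c" "\<And>I F. family True I F \<Longrightarrow> mass p 1 x I F \<le> c powr (p * 1)" for x :: "nat \<Rightarrow> 'k" and c
      using schreier_norm_props(2)[OF p that(1,2)] that(3) by simp
  qed (use p in auto)
  then show ?thesis by blast
qed

theorem theorem5p4:
  fixes smul :: "'k::{real_normed_field,euclidean_space} \<Rightarrow> 'e::banach \<Rightarrow> 'e"
    and \<iota> :: "(nat \<Rightarrow> 'k) \<Rightarrow> 'e"
    and p :: real
  assumes E: "1 < p \<and> is_completion_of_c00 smul (baernstein_norm p) \<iota> \<or>
              1 \<le> p \<and> is_completion_of_c00 smul (schreier_norm p) \<iota>"
  shows "(nontrivial_spatial_ideals smul \<iota> \<noteq> {} \<and>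
         (\<forall>I\<in>nontrivial_spatial_ideals smul \<iota>.
            \<not> (\<forall>J\<in>nontrivial_spatial_ideals smul \<iota>. J \<subseteq> I \<longrightarrow> J = I) \<and>
            \<not> (\<forall>J\<in>nontrivial_spatial_ideals smul \<iota>. I \<subseteq> J \<longrightarrow> J = I))) \<and>
         (\<forall>I\<in>spatial_ideals smul \<iota>. \<forall>J\<in>spatial_ideals smul \<iota>. I \<subset> J \<longrightarrow>
           (\<exists>(\<Delta> :: nat set set) (\<Gamma> :: nat set \<Rightarrow> ('e \<Rightarrow>\<^sub>L 'e) set set).
              \<Delta> \<approx> (UNIV :: real set) \<and>
              (\<forall>L\<in>\<Delta>.
                 uncountable (\<Gamma> L) \<and> chain\<^sub>\<subseteq> (\<Gamma> L) \<and>
                 (\<forall>A\<in>\<Gamma> L. A \<in> spatial_ideals smul \<iota> \<and> I \<subset> A \<and> A \<subset> J) \<and>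
                 ideal (\<Union>(\<Gamma> L)) (operator_algebra smul) \<and> closed (\<Union>(\<Gamma> L)) \<and>
                 \<Union>(\<Gamma> L) \<notin> spatial_ideals smul \<iota>) \<and>
              (\<forall>L\<in>\<Delta>. \<forall>M\<in>\<Delta>. L \<noteq> M \<longrightarrow>
                 (\<forall>A\<in>\<Gamma> L. \<forall>B\<in>\<Gamma> M. closure {S + T | S T. S \<in> A \<and> T \<in> B} = J)))) \<and>
         ((UNIV :: real set) \<lesssim> {I. maximalideal I (operator_algebra smul)}) \<and>
         \<not> \<Inter>(nontrivial_spatial_ideals smul \<iota>) \<subseteq> strictly_singular_operators smul"
proof -
  from completion_is_schreier_space[OF E] obtain r s single
    where "schreier_space smul \<iota> r s single" by (elim exE)
  then interpret schreier_space smul \<iota> r s single .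
  show ?thesis
    by (intro conjI[OF nontrivial_spatial_ideals_no_extremal] conjI ballI impI
        spatial_chains_between continuum_many_maximal_ideals Inter_nontrivial_not_strictly_singular)
qed

end
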